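(* Let $X$ be an $(n+1)$-dimensional manifold ($n\ge 1$), let $\Delta$ be a one-dimensional foliation on $X$, let $Y=X/\Delta$ be the space of leaves with the quotient topology, and let $p:X\to Y$ be the quotient map. Suppose that all leaves of $\Delta$ are non-compact and that the family of all special leaves of $\Delta$ is locally finite. Then the following conditions are equivalent. (1) The quotient map $p:X\to Y$ is a locally trivial fibration with fiber $\mathbb{R}$, and $Y$ is locally homeomorphic with $\mathbb{R}^n_+$ (though it is not necessarily a Hausdorff space). (2) For each leaf $\omega$ of $\Delta$ there exists an open saturated neighborhood of $\omega$ which is foliated homeomorphic with $\mathbb{R}\times V$, where $V$ is an open subset of $\mathbb{R}^n_+$. (3) For each leaf $\omega$ of $\Delta$ there exists a cross section of $\Delta$ passing through $\omega$.
   Context: Manifolds are topological manifolds in the usual sense (Hausdorff, second countable), possibly with boundary. $\mathbb{R}^n_+=\{(x_1,\dots,x_n)\in\mathbb{R}^n : x_n\ge 0\}$ and $\partial\mathbb{R}^n_+=\{x_n=0\}$. Foliations. A foliated chart on $X$ is a pair $(U,\varphi)$ where $U\subset X$ is open and $\varphi:U\to(a,b)\times B$ is a homeomorphism with $B$ an open subset of $\mathbb{R}^n_+$ and $a<b$ in $\mathbb{R}\cup\{\pm\infty\}$; the sets $\varphi^{-1}((a,b)\times\{y\})$, $y\in B$, are its plaques. A one-dimensional foliation $\Delta$ on $X$ is a partition of $X$ into path-connected subsets (leaves) such that $X$ admits an atlas of foliated charts $(U_i,\varphi_i)$ for which every path component of $\omega\cap U_i$ is a plaque of $(U_i,\varphi_i)$,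 for every leaf $\omega$ and every $i$. A subset of $X$ is saturated if it is a union of leaves. The trivial foliation on $\mathbb{R}\times V$ is the partition into lines $\mathbb{R}\times\{v\}$, $v\in V$. A saturated set is foliated homeomorphic with $\mathbb{R}\times V$ if there is a homeomorphism of $\mathbb{R}\times V$ onto it which sends each line $\mathbb{R}\times\{v\}$ onto a leaf of $\Delta$. Special leaves. For $u\in Y$ the Hausdorff closure of $u$ is $\mathrm{hcl}(u)=\bigcap_{N}\overline{N}$, where $N$ runs over a base of neighborhoods of $u$. A point $u$ is special if $\mathrm{hcl}(u)\neq\{u\}$. A leaf $\omega$ is special if the point $p(\omega)\in Y$ is special. A family of subsets of $X$ is locally finite if every point of $X$ has a neighborhood meeting only finitely many members of the family. $Y$ is locally homeomorphic with $\mathbb{R}^n_+$ if each point of $Y$ has an open neighborhood homeomorphic with an open subset of $\mathbb{R}^n_+$. Cross sections. Let $V$ be an open subset of $\mathbb{R}^n_+$. A continuous map $\gamma:V\to X$ is a cross section of $\Delta$ if $\gamma(V\cap\partial\mathbb{R}^n_+)\subset\partial X$ and $p\circ\gamma:V\to Y$ is injective (distinct points of $V$ are sent to points of distinct leaves). It passes through a leaf $\omega$ if $\gamma(V)\cap\omega\ne\varnothing$. *)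

theory Defs
  imports "HOL-Analysis.Analysis" "HOL-Library.Disjoint_Sets"
begin

section \<open>Half-spaces and manifolds with boundary\<close>

text \<open>The points of \<^term>\<open>Euclidean_space n\<close> are the functions \<^typ>\<open>nat \<Rightarrow> real\<close> vanishing from
  index \<^term>\<open>n\<close> on, so the coordinates are numbered from \<open>0\<close> and the last one has index \<open>n - 1\<close>.
  The definitions involving half-spaces are meant for dimension at least \<open>1\<close>.\<close>

definition half_space :: "nat \<Rightarrow> (nat \<Rightarrow> real) topology" where
  "half_space n = subtopology (Euclidean_space n) {x. 0 \<le> x (n - 1)}"

definition half_space_boundary :: "nat \<Rightarrow> (nat \<Rightarrow> real) set" where
  "half_space_boundary n = {x \<in> topspace (Euclidean_space n). x (n - 1) = 0}"

definition locally_half_space :: "nat \<Rightarrow> 'a topology \<Rightarrow> bool" where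
  "locally_half_space n Y \<longleftrightarrow>
     (\<forall>y \<in> topspace Y. \<exists>U B. openin Y U \<and> y \<in> U \<and> openin (half_space n) B \<and>
        subtopology Y U homeomorphic_space subtopology (half_space n) B)"

definition manifold_with_boundary :: "nat \<Rightarrow> 'a topology \<Rightarrow> bool" where
  "manifold_with_boundary m X \<longleftrightarrow>
     Hausdorff_space X \<and> second_countable X \<and> locally_half_space m X"

definition manifold_boundary :: "nat \<Rightarrow> 'a topology \<Rightarrow> 'a set" where
  "manifold_boundary m X =
     {x \<in> topspace X.
        \<not> (\<exists>U B. openin X U \<and> x \<in> U \<and> openin (Euclidean_space m) B \<and>
              subtopology X U homeomorphic_space subtopology (Euclidean_space m) B)}"


section \<open>One-dimensional foliations\<close>

definition open_interval :: "ereal \<Rightarrow> ereal \<Rightarrow> real set" where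
  "open_interval a b = {t. a < ereal t \<and> ereal t < b}"

definition foliated_chart ::
  "nat \<Rightarrow> 'a topology \<Rightarrow> 'a set \<Rightarrow> ('a \<Rightarrow> real \<times> (nat \<Rightarrow> real)) \<Rightarrow> ereal \<Rightarrow> ereal \<Rightarrow>
     (nat \<Rightarrow> real) set \<Rightarrow> bool" where
  "foliated_chart n X U \<phi> a b B \<longleftrightarrow>
     openin X U \<and> a < b \<and> openin (half_space n) B \<and>
     homeomorphic_map (subtopology X U)
       (prod_topology (top_of_set (open_interval a b)) (subtopology (half_space n) B)) \<phi>"

definition plaques ::
  "'a set \<Rightarrow> ('a \<Rightarrow> real \<times> (nat \<Rightarrow> real)) \<Rightarrow> ereal \<Rightarrow> ereal \<Rightarrow> (nat \<Rightarrow> real) set \<Rightarrow> 'a set set" where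
  "plaques U \<phi> a b B = {{x \<in> U. \<phi> x \<in> open_interval a b \<times> {y}} | y. y \<in> B}"

definition foliation :: "nat \<Rightarrow> 'a topology \<Rightarrow> 'a set set \<Rightarrow> bool" where
  "foliation n X \<Delta> \<longleftrightarrow>
     partition_on (topspace X) \<Delta> \<and>
     (\<forall>\<omega> \<in> \<Delta>. path_connectedin X \<omega>) \<and>
     (\<exists>\<A>. (\<forall>(U, \<phi>, a, b, B) \<in> \<A>. foliated_chart n X U \<phi> a b B) \<and>
           (\<Union>(U, \<phi>, a, b, B) \<in> \<A>. U) = topspace X \<and>
           (\<forall>\<omega> \<in> \<Delta>. \<forall>(U, \<phi>, a, b, B) \<in> \<A>.
               path_components_of (subtopology X (\<omega> \<inter> U)) \<subseteq> plaques U \<phi> a b B))"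

definition saturated :: "'a set set \<Rightarrow> 'a set \<Rightarrow> bool" where
  "saturated \<Delta> W \<longleftrightarrow> (\<exists>\<S> \<subseteq> \<Delta>. W = \<Union>\<S>)"

definition foliated_homeomorphic_trivial ::
  "nat \<Rightarrow> 'a topology \<Rightarrow> 'a set set \<Rightarrow> 'a set \<Rightarrow> (nat \<Rightarrow> real) set \<Rightarrow> bool" where
  "foliated_homeomorphic_trivial n X \<Delta> W V \<longleftrightarrow>
     (\<exists>h. homeomorphic_map (prod_topology euclideanreal (subtopology (half_space n) V))
            (subtopology X W) h \<and>
          (\<forall>v \<in> V. h ` (UNIV \<times> {v}) \<in> \<Delta>))"


section \<open>The space of leaves\<close>

text \<open>A point of the leaf space is a leaf; the map \<open>leaf_proj \<Delta>\<close> below is the quotient map.\<close>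

definition leaf_space :: "'a topology \<Rightarrow> 'a set set \<Rightarrow> 'a set topology" where
  "leaf_space X \<Delta> = topology (\<lambda>\<W>. \<W> \<subseteq> \<Delta> \<and> openin X (\<Union>\<W>))"

definition leaf_proj :: "'a set set \<Rightarrow> 'a \<Rightarrow> 'a set" where
  "leaf_proj \<Delta> x = (THE \<omega>. \<omega> \<in> \<Delta> \<and> x \<in> \<omega>)"

lemma leaf_proj_eq:
  assumes "partition_on A \<Delta>" "\<omega> \<in> \<Delta>" "x \<in> \<omega>"
  shows "leaf_proj \<Delta> x = \<omega>"
  unfolding leaf_proj_def
  using assms by (intro the_equality) (auto simp: partition_on_def disjoint_def)

lemma openin_leaf_space:
  assumes "partition_on A \<Delta>"
  shows "openin (leaf_space X \<Delta>) \<W> \<longleftrightarrow> \<W> \<subseteq> \<Delta> \<and> openin X (\<Union>\<W>)"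
proof -
  have inter: "\<Union>(\<S> \<inter> \<T>) = \<Union>\<S> \<inter> \<Union>\<T>" if "\<S> \<subseteq> \<Delta>" "\<T> \<subseteq> \<Delta>" for \<S> \<T>
  proof
    show "\<Union>\<S> \<inter> \<Union>\<T> \<subseteq> \<Union>(\<S> \<inter> \<T>)"
    proof
      fix x assume "x \<in> \<Union>\<S> \<inter> \<Union>\<T>"
      then obtain S T where "S \<in> \<S>" "x \<in> S" "T \<in> \<T>" "x \<in> T" by blast
      moreover from this have "S = T"
        using leaf_proj_eq[OF assms] that by blast
      ultimately show "x \<in> \<Union>(\<S> \<inter> \<T>)" by blast
    qed
  qed blast
  have union: "openin X (\<Union>(\<Union>\<K>))" if "\<forall>\<W> \<in> \<K>. openin X (\<Union>\<W>)" for \<K>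
  proof -
    have "\<Union>(\<Union>\<K>) = \<Union>(Union ` \<K>)"
      by blast
    then show ?thesis
      using that by (metis (no_types, lifting) imageE openin_Union)
  qed
  have "istopology (\<lambda>\<W>. \<W> \<subseteq> \<Delta> \<and> openin X (\<Union>\<W>))"
    unfolding istopology_def
  proof (intro conjI allI impI)
    fix \<S> \<T> assume "\<S> \<subseteq> \<Delta> \<and> openin X (\<Union>\<S>)" "\<T> \<subseteq> \<Delta> \<and> openin X (\<Union>\<T>)"
    then show "openin X (\<Union>(\<S> \<inter> \<T>))"
      by (simp add: inter openin_Int)
  qed (use union in blast)+
  then show ?thesis
    by (simp add: leaf_space_def topology_inverse')
qed

lemma topspace_leaf_space:
  assumes "partition_on (topspace X) \<Delta>"
  shows "topspace (leaf_space X \<Delta>) = \<Delta>"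
proof -
  have "openin (leaf_space X \<Delta>) \<Delta>"
    using assms openin_leaf_space[OF assms] by (metis openin_topspace order_refl partition_onD1)
  then show ?thesis
    by (metis assms openin_leaf_space openin_subset openin_topspace subset_antisym)
qed

lemma quotient_map_leaf_proj:
  assumes "partition_on (topspace X) \<Delta>"
  shows "quotient_map X (leaf_space X \<Delta>) (leaf_proj \<Delta>)"
proof -
  have eq: "leaf_proj \<Delta> x = \<omega> \<longleftrightarrow> x \<in> \<omega>" if "x \<in> topspace X" "\<omega> \<in> \<Delta>" for x \<omega>
    using that leaf_proj_eq[OF assms] partition_onD1[OF assms] by blast
  have mem: "leaf_proj \<Delta> x \<in> \<Delta> \<and> x \<in> leaf_proj \<Delta> x" if "x \<in> topspace X" for x
    using that leaf_proj_eq[OF assms] partition_onD1[OF assms] by blast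
  have "leaf_proj \<Delta> ` topspace X = \<Delta>"
  proof
    show "\<Delta> \<subseteq> leaf_proj \<Delta> ` topspace X"
    proof
      fix \<omega> assume "\<omega> \<in> \<Delta>"
      then obtain x where "x \<in> \<omega>"
        using partition_onD3[OF assms] by (metis all_not_in_conv)
      then have "x \<in> topspace X" "leaf_proj \<Delta> x = \<omega>"
        using \<open>\<omega> \<in> \<Delta>\<close> leaf_proj_eq[OF assms] partition_onD1[OF assms] by auto
      then show "\<omega> \<in> leaf_proj \<Delta> ` topspace X" by blast
    qed
  qed (use mem in blast)
  moreover have "{x \<in> topspace X. leaf_proj \<Delta> x \<in> \<W>} = \<Union>\<W>" if "\<W> \<subseteq> \<Delta>" for \<W>
  proof
    show "{x \<in> topspace X. leaf_proj \<Delta> x \<in> \<W>} \<subseteq> \<Union>\<W>" using mem by blast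
    show "\<Union>\<W> \<subseteq> {x \<in> topspace X. leaf_proj \<Delta> x \<in> \<W>}"
      using that leaf_proj_eq[OF assms] partition_onD1[OF assms] by blast
  qed
  ultimately show ?thesis
    by (simp add: quotient_map_def topspace_leaf_space[OF assms] openin_leaf_space[OF assms])
qed

text \<open>The Hausdorff closure does not depend on the base of neighborhoods; here it is computed from
  the base of all open neighborhoods.\<close>

definition hausdorff_closure :: "'b topology \<Rightarrow> 'b \<Rightarrow> 'b set" where
  "hausdorff_closure Y u = \<Inter>{Y closure_of N | N. openin Y N \<and> u \<in> N}"

definition special_point :: "'b topology \<Rightarrow> 'b \<Rightarrow> bool" where
  "special_point Y u \<longleftrightarrow> hausdorff_closure Y u \<noteq> {u}"

text \<open>A leaf \<open>\<omega>\<close>, regarded as a point of the leaf space, is the common image of its points.\<close>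

definition special_leaves :: "'a topology \<Rightarrow> 'a set set \<Rightarrow> 'a set set" where
  "special_leaves X \<Delta> = {\<omega> \<in> \<Delta>. special_point (leaf_space X \<Delta>) \<omega>}"


section \<open>Fibrations and cross sections\<close>

definition locally_trivial_fibration ::
  "'a topology \<Rightarrow> 'b topology \<Rightarrow> ('a \<Rightarrow> 'b) \<Rightarrow> 'f topology \<Rightarrow> bool" where
  "locally_trivial_fibration X Y p F \<longleftrightarrow>
     continuous_map X Y p \<and>
     (\<forall>y \<in> topspace Y. \<exists>W h. openin Y W \<and> y \<in> W \<and>
        homeomorphic_map (subtopology X {x \<in> topspace X. p x \<in> W})
          (prod_topology (subtopology Y W) F) h \<and>
        (\<forall>x \<in> topspace X. p x \<in> W \<longrightarrow> fst (h x) = p x))"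

definition cross_section ::
  "nat \<Rightarrow> 'a topology \<Rightarrow> 'a set set \<Rightarrow> (nat \<Rightarrow> real) set \<Rightarrow> ((nat \<Rightarrow> real) \<Rightarrow> 'a) \<Rightarrow> bool" where
  "cross_section n X \<Delta> V \<gamma> \<longleftrightarrow>
     openin (half_space n) V \<and>
     continuous_map (subtopology (half_space n) V) X \<gamma> \<and>
     \<gamma> ` (V \<inter> half_space_boundary n) \<subseteq> manifold_boundary (Suc n) X \<and>
     inj_on (leaf_proj \<Delta> \<circ> \<gamma>) V"

end

theory Submission
  imports Defs "HOL-Homology.Invariance_of_Domain"
begin

text \<open>Only the step from cross sections to trivial neighborhoods is deep. By invariance of domain
  (for half-spaces) a cross section can be replaced by a transverse slice \<open>V\<close> of a foliated chart that
  meets every leaf at most once. Propagating charts along leaves shows that the saturation \<open>S\<close> of the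
  slice is open and carries a continuous projection \<open>q\<close> to \<open>V\<close> whose fibres are leaves, with local
  product charts everywhere. A leaf is then a connected non-compact 1-manifold, hence a line: any two of
  its points lie on an open arc, and every point separates it.

  To trivialize \<open>q\<close> we use Whitney's device. Let \<open>sg x\<close> be the segment of the leaf of \<open>x\<close> between the
  slice and \<open>x\<close>. It depends continuously on \<open>x\<close>, so for continuous \<open>g\<close> the maximum of \<open>g\<close> over \<open>sg x\<close>
  is continuous in \<open>x\<close> and grows with \<open>x\<close> along each half-leaf. Summing over a countable family of bump
  functions and adding the maximum of a proper function gives a height that is strictly increasing and
  unbounded along every half-leaf. The signed height together with \<open>q\<close> is a homeomorphism of \<open>S\<close>
  onto \<open>\<real> \<times> V\<close>.\<close>

section \<open>Open arcs in a Hausdorff space\<close>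

text \<open>The obstacle is to compare different leaves: each is a line, but no parametrization
  varying continuously from leaf to leaf is given, and no length along leaves. So segments are
  described by connected sets alone, as intersections of all connected subsets of the leaf
  containing both ends, and only their two semicontinuities relate neighboring leaves. Orientation
  is the one choice made globally. It is read off from the thickened slice \<open>\<psi>0\<close>,
  whose positive part decides the sign of the height.

  A leaf may accumulate on itself, so that its subspace topology is coarser than its topology as a
  1-manifold. Because the slice meets each leaf at most once, every chart obtained by propagating it
  meets each leaf in at most one plaque. Inside \<open>S\<close> the two topologies therefore agree,
  and the arcs below can be taken in the subspace.

  A cross section sends boundary to boundary. This is what lets the induced map between half-spaces
  extend by reflection to an injective map, to which ordinary invariance of domain applies.\<close>

definition open_arc :: "'a topology \<Rightarrow> (real \<Rightarrow> 'a) \<Rightarrow> bool" where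
  "open_arc L f \<longleftrightarrow> continuous_map euclideanreal L f \<and> open_map euclideanreal L f \<and> inj f"

lemma open_arcD:
  assumes "open_arc L f"
  shows "continuous_map euclideanreal L f" "open_map euclideanreal L f" "inj f"
    "openin L (range f)" "f s = f t \<longleftrightarrow> s = t" "f s \<in> topspace L"
proof -
  show *: "continuous_map euclideanreal L f" "open_map euclideanreal L f" "inj f"
    using assms by (auto simp: open_arc_def)
  then show "openin L (range f)" "f s = f t \<longleftrightarrow> s = t"
    by (auto simp: open_map_def inj_eq)
  show "f s \<in> topspace L"
    using *(1) by (simp add: continuous_map_def Pi_iff)
qed

lemma open_arc_image_open:
  assumes "open_arc L f" "open A"
  shows "openin L (f ` A)"
  using open_arcD(2)[OF assms(1)] assms(2) by (auto simp: open_map_def)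

text \<open>Only \<open>g\<close> has to be an open arc: its inverse is then continuous, while
  \<open>f\<close> enters through continuity alone. This asymmetry lets \<open>open_arcI\<close>
  apply the lemma to a map whose openness is still to be shown.\<close>

lemma open_arc_transition:
  assumes f: "continuous_map euclideanreal L f" and g: "open_arc L g"
  shows "open {s. f s \<in> range g}"
    and "continuous_on {s. f s \<in> range g} (\<lambda>s. inv_into UNIV g (f s))"
    and "inj f \<Longrightarrow> inj_on (\<lambda>s. inv_into UNIV g (f s)) {s. f s \<in> range g}"
proof -
  show op: "open {s. f s \<in> range g}"
    using f open_arcD(4)[OF g] by (auto simp: continuous_map_def)
  show "continuous_on {s. f s \<in> range g} (\<lambda>s. inv_into UNIV g (f s))"
  proof (subst continuous_on_open_vimage[OF op], intro allI impI)
    fix B :: "real set" assume "open B"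
    then have "openin L (g ` B)" by (rule open_arc_image_open[OF g])
    then have "open {s. f s \<in> g ` B}"
      using f by (auto simp: continuous_map_def)
    moreover have "(\<lambda>s. inv_into UNIV g (f s)) -` B \<inter> {s. f s \<in> range g} = {s. f s \<in> g ` B}"
      using open_arcD(3)[OF g] by auto
    ultimately show "open ((\<lambda>s. inv_into UNIV g (f s)) -` B \<inter> {s. f s \<in> range g})" by simp
  qed
  show "inj_on (\<lambda>s. inv_into UNIV g (f s)) {s. f s \<in> range g}" if "inj f"
    using that by (auto simp: inj_on_def) (metis f_inv_into_f rangeI)
qed

text \<open>Read in the coordinate of a local arc, \<open>k\<close> becomes a continuous injection
  of an open set of reals into the reals, and such maps are open. Gluing arcs therefore only
  requires continuity and injectivity.\<close>

lemma open_arcI: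
  assumes k: "continuous_map euclideanreal L k" "inj k"
    and loc: "\<And>u. \<exists>g. open_arc L g \<and> k u \<in> range g"
  shows "open_arc L k"
  unfolding open_arc_def
proof (intro conjI k)
  show "open_map euclideanreal L k"
    unfolding open_map_def
  proof (intro allI impI)
    fix U :: "real set" assume "openin euclideanreal U"
    then have "open U" by simp
    show "openin L (k ` U)"
    proof (subst openin_subopen, clarify)
      fix u assume "u \<in> U"
      obtain g where g: "open_arc L g" "k u \<in> range g" using loc by blast
      define W where "W = {s. k s \<in> range g} \<inter> U"
      have W: "open W" "u \<in> W"
        unfolding W_def using open_arc_transition(1)[OF k(1) g(1)] \<open>open U\<close> g(2) \<open>u \<in> U\<close> by auto
      have "open ((\<lambda>s. inv_into UNIV g (k s)) ` W)"
        using W open_arc_transition(2)[OF k(1) g(1)] open_arc_transition(3)[OF k(1) g(1) k(2)]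
        by (intro injective_into_1d_imp_open_map_UNIV[of _ W])
           (auto simp: W_def intro: continuous_on_subset inj_on_subset)
      then have "openin L (g ` (\<lambda>s. inv_into UNIV g (k s)) ` W)"
        by (rule open_arc_image_open[OF g(1)])
      also have "g ` (\<lambda>s. inv_into UNIV g (k s)) ` W = k ` W"
        unfolding image_image by (rule image_cong) (auto simp: W_def f_inv_into_f)
      finally show "\<exists>T. openin L T \<and> k u \<in> T \<and> T \<subseteq> k ` U"
        using W by (intro exI[of _ "k ` W"]) (auto simp: W_def)
    qed
  qed
qed

lemma open_arc_reparam:
  assumes "open_arc L f" "continuous_on UNIV h" "inj h"
  shows "open_arc L (\<lambda>t. f (h t))"
proof (rule open_arcI)
  show "continuous_map euclideanreal L (\<lambda>t. f (h t))"
    using continuous_map_compose[of euclideanreal euclideanreal h L f] assms open_arcD(1)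
    by (auto simp: o_def)
  show "inj (\<lambda>t. f (h t))"
    using assms(3) open_arcD(5)[OF assms(1)] by (auto simp: inj_def)
qed (use assms(1) in auto)

lemma open_arc_uminus: "open_arc L f \<Longrightarrow> open_arc L (\<lambda>t. f (- t))"
  by (rule open_arc_reparam) (auto intro!: continuous_intros)

lemma open_arc_compactin:
  assumes "open_arc L f" "compact K"
  shows "compactin L (f ` K)"
  using image_compactin[of euclideanreal K L f] open_arcD(1)[OF assms(1)] assms(2) by simp

section \<open>Transition map between two arcs of a Hausdorff space\<close>

locale arc_pair =
  fixes L :: "'a topology" and f g :: "real \<Rightarrow> 'a"
  assumes Hausdorff: "Hausdorff_space L" and f: "open_arc L f" and g: "open_arc L g"
begin

definition T :: "real \<Rightarrow> real" where "T s = inv_into UNIV g (f s)"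

definition dom :: "real set" where "dom = {s. f s \<in> range g}"

lemma T_eq: "f s = g x \<Longrightarrow> T s = x"
  using open_arcD(3)[OF g] by (simp add: T_def)

lemma g_T: "s \<in> dom \<Longrightarrow> g (T s) = f s"
  by (simp add: T_def dom_def f_inv_into_f)

lemma open_dom: "open dom"
  using open_arc_transition(1)[OF open_arcD(1)[OF f] g] by (simp add: dom_def)

lemma T_cont: "A \<subseteq> dom \<Longrightarrow> continuous_on A T"
  using continuous_on_subset[OF open_arc_transition(2)[OF open_arcD(1)[OF f] g]]
  by (simp add: T_def[abs_def] dom_def)

lemma T_inj: "u \<in> dom \<Longrightarrow> v \<in> dom \<Longrightarrow> T u = T v \<Longrightarrow> u = v"
  using g_T open_arcD(5)[OF f] by metis

lemma T_monotone:
  assumes "is_interval A" "A \<subseteq> dom"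
  shows "strict_mono_on A T \<or> strict_antimono_on A T"
proof -
  have "inj_on T A" using T_inj assms(2) by (auto simp: inj_on_def)
  then show ?thesis using injective_eq_monotone_map[OF assms(1) T_cont[OF assms(2)]] by blast
qed

text \<open>The overlap is open, so if \<open>f\<close> ever leaves \<open>range g\<close> there is
  a first parameter \<open>d\<close> outside. Before \<open>d\<close> the coordinate
  \<open>T\<close> is monotone and cannot stay bounded, so it runs off to one end of
  \<open>g\<close> and sweeps out a whole ray.\<close>

lemma right_ray:
  assumes c: "c \<in> dom"
  obtains (all) "{c..} \<subseteq> dom"
  | (part) d where "c < d" "{c..<d} \<subseteq> dom" "T ` {c..<d} = {T c..} \<or> T ` {c..<d} = {..T c}"
proof (cases "{c..} \<subseteq> dom")
  case False
  define B where "B = {c..} - dom"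
  have B: "closed B" "B \<noteq> {}" "bdd_below B"
    using open_dom False by (auto simp: B_def intro!: closed_Diff bdd_belowI[of _ c])
  define d where "d = Inf B"
  have dB: "d \<in> B" unfolding d_def using B closed_contains_Inf by blast
  have cd: "c < d" using dB c by (auto simp: B_def less_le)
  have sub: "{c..<d} \<subseteq> dom"
  proof
    fix s assume s: "s \<in> {c..<d}"
    then have "s \<notin> B" using cInf_lower[OF _ B(3), of s] by (auto simp: d_def)
    then show "s \<in> dom" using s by (simp add: B_def)
  qed
  have conn: "connected (T ` {c..<d})"
    using T_cont[OF sub] by (intro connected_continuous_image) auto
  \<comment> \<open>A bounded coordinate would keep \<open>f\<close> inside the image of a compact
    interval, which is closed in the Hausdorff space \<open>L\<close>; the limit \<open>f d\<close>
    would then lie on \<open>g\<close>, contrary to the choice of \<open>d\<close>.\<close>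
  have unb: "\<not> T ` {c..<d} \<subseteq> {a..b}" for a b
  proof
    assume *: "T ` {c..<d} \<subseteq> {a..b}"
    have "closedin L (g ` {a..b})"
      by (intro compactin_imp_closedin[OF Hausdorff] open_arc_compactin[OF g]) simp
    then have "closed {s. f s \<in> g ` {a..b}}"
      using open_arcD(1)[OF f] by (auto simp: continuous_map_closedin)
    moreover have "{c..<d} \<subseteq> {s. f s \<in> g ` {a..b}}"
    proof
      fix s assume s: "s \<in> {c..<d}"
      then have "s \<in> dom" "T s \<in> {a..b}" using sub * by (meson subsetD imageI)+
      moreover from this have "f s = g (T s)" using g_T by simp
      ultimately show "s \<in> {s. f s \<in> g ` {a..b}}" by blast
    qed
    ultimately have "closure {c..<d} \<subseteq> {s. f s \<in> g ` {a..b}}"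
      by (rule closure_minimal[rotated])
    moreover have "d \<in> closure {c..<d}" using cd by simp
    ultimately have "f d \<in> range g" by auto
    then show False using dB by (auto simp: B_def dom_def)
  qed
  have "T ` {c..<d} = {T c..} \<or> T ` {c..<d} = {..T c}"
    using T_monotone[OF is_interval_co sub]
  proof
    assume m: "strict_mono_on {c..<d} T"
    have ge: "T c \<le> T s" if "s \<in> {c..<d}" for s
      using strict_mono_onD[OF m, of c s] that cd by (cases "s = c") (auto intro: less_imp_le)
    have "x \<in> T ` {c..<d}" if "T c \<le> x" for x
    proof -
      obtain s where s: "s \<in> {c..<d}" "x < T s"
        using unb[of "T c" x] ge by force
      then show ?thesis
        using connectedD_interval[OF conn, of "T c" "T s" x] cd that by auto
    qed
    then show ?thesis using ge by auto
  next
    assume m: "strict_antimono_on {c..<d} T"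
    have ge: "T s \<le> T c" if "s \<in> {c..<d}" for s
      using monotone_onD[OF m, of c s] that cd by (cases "s = c") (auto intro: less_imp_le)
    have "x \<in> T ` {c..<d}" if "x \<le> T c" for x
    proof -
      obtain s where s: "s \<in> {c..<d}" "T s < x"
        using unb[of x "T c"] ge by force
      then show ?thesis
        using connectedD_interval[OF conn, of "T s" "T c" x] cd that by auto
    qed
    then show ?thesis using ge by auto
  qed
  then show thesis using cd sub that(2) by blast
qed

text \<open>The hypothesis on \<open>{c<..c+e}\<close> says that both arcs leave the junction on the
  same side. This excludes a decreasing \<open>T\<close>: either \<open>f\<close> never leaves
  \<open>g\<close>, or \<open>T\<close> covers all of \<open>{t..}\<close> before it does, so one
  right ray contains the other.\<close>

lemma directed_ray:
  assumes ct: "f c = g t" and e: "e > 0" "f ` {c<..c+e} \<subseteq> g ` {t<..}"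
  shows "f ` {c..} \<subseteq> g ` {t..} \<or> g ` {t..} \<subseteq> f ` {c..}"
proof -
  have Te: "T s > t" if "c < s" "s \<le> c + e" for s
  proof -
    have "f s \<in> g ` {t<..}" using that e by auto
    then show ?thesis using T_eq by auto
  qed
  have c: "c \<in> dom" and Tc: "T c = t" using ct T_eq by (auto simp: dom_def)
  show ?thesis
  proof (cases rule: right_ray[OF c, case_names all part])
    case all
    have "\<not> strict_antimono_on {c..} T"
      using monotone_onD[of "{c..}" "(<)" "(>)" T c "c+e"] Te[of "c+e"] Tc e by auto
    then have m: "strict_mono_on {c..} T" using T_monotone[OF is_interval_ci all] by blast
    have "f s \<in> g ` {t..}" if "s \<ge> c" for s
    proof -
      have "T s \<ge> t" using strict_mono_onD[OF m, of c s] that Tc by (cases "s = c") auto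
      moreover have "f s = g (T s)" using g_T[of s] all that by auto
      ultimately show ?thesis by auto
    qed
    then show ?thesis by auto
  next
    case (part d)
    define s where "s = min ((c+d)/2) (c+e)"
    have s: "c < s" "s \<le> c+e" "s < d" using part(1) e by (auto simp: s_def min_def)
    have "T s > t" by (rule Te[OF s(1,2)])
    moreover have "T s \<in> T ` {c..<d}" using s by auto
    ultimately have "T ` {c..<d} \<noteq> {..T c}" using Tc by (metis atMost_iff not_le)
    then have TT: "T ` {c..<d} = {t..}" using part(3) Tc by auto
    have "g x \<in> f ` {c..}" if "x \<ge> t" for x
    proof -
      have "x \<in> T ` {c..<d}" unfolding TT using that by simp
      then obtain s where s: "x = T s" "s \<in> {c..<d}" by (rule imageE)
      moreover have "g (T s) = f s" using g_T part(2) s(2) by blast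
      ultimately show ?thesis using s by (intro image_eqI[of _ _ s]) auto
    qed
    then show ?thesis by auto
  qed
qed

text \<open>If the two arcs meet again behind the junction, they close up to a circle.\<close>

lemma arc_join:
  assumes ct: "f c = g t" and fg: "f ` {c..} \<subseteq> g ` {t..}" and gf: "g ` {..t} \<subseteq> f ` {..c}"
  shows "(\<exists>k. open_arc L k \<and> range k = range f \<union> range g) \<or> (\<exists>C. C \<noteq> {} \<and> compactin L C \<and> openin L C)"
proof (cases "\<exists>s u. s < c \<and> u > t \<and> f s = g u")
  case False
  \<comment> \<open>Follow \<open>f\<close> up to the junction and \<open>g\<close> from there on,
    with the parameter of \<open>g\<close> shifted so that \<open>c\<close> corresponds to
    \<open>t\<close>. Without a second meeting this is injective.\<close>
  define k where "k = (\<lambda>u. if u \<le> c then f u else g (t + (u - c)))"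
  have meet: "s = c \<and> u = t" if "f s = g u" "s \<le> c" "u \<ge> t" for s u
    using False that ct open_arcD(5)[OF f] open_arcD(5)[OF g] by (metis less_le)
  have "continuous_map euclideanreal L k"
    unfolding k_def
  proof (rule continuous_map_cases_le)
    show "continuous_map (subtopology euclideanreal {x \<in> topspace euclideanreal. x \<le> c}) L f"
      by (simp add: continuous_map_from_subtopology open_arcD(1)[OF f])
    have "continuous_map euclideanreal L (g \<circ> (\<lambda>u. t + (u - c)))"
      by (rule continuous_map_compose[OF _ open_arcD(1)[OF g]]) (auto intro!: continuous_intros)
    then show "continuous_map (subtopology euclideanreal {x \<in> topspace euclideanreal. c \<le> x}) L
        (\<lambda>u. g (t + (u - c)))"
      by (simp add: continuous_map_from_subtopology o_def)
  qed (use ct in auto)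
  moreover have "inj k"
  proof (rule linorder_inj_onI)
    fix x y :: real assume "x < y"
    then show "k x \<noteq> k y"
      using meet[of x "t + (y - c)"] open_arcD(5)[OF f] open_arcD(5)[OF g]
      by (auto simp: k_def)
  qed auto
  moreover have "\<exists>h. open_arc L h \<and> k u \<in> range h" for u
    using f g by (auto simp: k_def)
  ultimately have "open_arc L k" by (rule open_arcI)
  moreover have "range k = range f \<union> range g"
  proof
    show "range k \<subseteq> range f \<union> range g" by (auto simp: k_def)
    have k1: "f s \<in> range k" if "s \<le> c" for s
      using that by (intro range_eqI[of _ _ s]) (simp add: k_def)
    have k2: "g u \<in> range k" if "u \<ge> t" for u
      using that ct by (intro range_eqI[of _ _ "c + (u - t)"]) (auto simp: k_def)
    have "f s \<in> range k" for s
    proof (cases "s \<le> c")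
      case False
      then have "f s \<in> g ` {t..}" using fg by auto
      then show ?thesis using k2 by auto
    qed (rule k1)
    moreover have "g u \<in> range k" for u
    proof (cases "u \<ge> t")
      case False
      then have "g u \<in> f ` {..c}" using gf by auto
      then show ?thesis using k1 by auto
    qed (rule k2)
    ultimately show "range f \<union> range g \<subseteq> range k" by auto
  qed
  ultimately show ?thesis by blast
next
  case True
  \<comment> \<open>A second meeting closes a loop: along \<open>f\<close> from \<open>s\<close> to
    \<open>c\<close>, then along \<open>g\<close> from \<open>t\<close> to \<open>t'\<close>, which
    is \<open>f s\<close> again. The rest of the case shows that the loop absorbs both outgoing
    rays.\<close>
  then obtain s t' where s: "s < c" "t' > t" "f s = g t'" by blast
  have Tc: "T c = t" and Ts: "T s = t'" using T_eq ct s by auto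
  have above: "T u > t" if "u > c" for u
  proof -
    have "f u \<in> g ` {t..}" using fg that by auto
    then obtain x where x: "x \<ge> t" "f u = g x" by auto
    moreover have "x \<noteq> t" using x ct that open_arcD(5)[OF f, of u c] by auto
    moreover have "T u = x" by (rule T_eq[OF x(2)])
    ultimately show ?thesis by simp
  qed
  have cdom: "c \<in> dom" "s \<in> dom" using ct s by (auto simp: dom_def)
  \<comment> \<open>Beyond \<open>c\<close> the arc \<open>f\<close> runs in the part of
    \<open>g\<close> above \<open>t = T c\<close>, so \<open>T\<close> cannot decrease to the right
    of \<open>c\<close>.\<close>
  have no_anti: False if "strict_antimono_on A T" "c \<in> A" "v \<in> A" "c < v" for A v
    using monotone_onD[OF that(1,2,3)] that(4) above[OF that(4)] Tc by simp
  \<comment> \<open>\<open>T\<close> would have to decrease from \<open>t'\<close> at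
    \<open>s\<close> to \<open>t\<close> at \<open>c\<close> and, staying monotone, decrease past
    \<open>c\<close>, which \<open>no_anti\<close> forbids. Hence \<open>f\<close> leaves
    \<open>g\<close> at some \<open>d\<close> no later than \<open>c\<close>, and by then it has run
    through all of \<open>g\<close> beyond \<open>t'\<close>.\<close>
  obtain d where d: "s < d" "d \<le> c" "{s..<d} \<subseteq> dom" "T ` {s..<d} = {t'..}"
  proof (cases rule: right_ray[OF cdom(2), case_names all part])
    case all
    have "\<not> strict_mono_on {s..} T"
      using strict_mono_onD[of "{s..}" T s c] s Tc Ts by auto
    then show ?thesis using T_monotone[OF is_interval_ci all] no_anti[of "{s..}" "c+1"] s by auto
  next
    case (part d)
    have c': "c \<notin> {s..<d}"
    proof
      assume cd: "c \<in> {s..<d}"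
      then have "\<not> strict_mono_on {s..<d} T"
        using strict_mono_onD[of "{s..<d}" T s c] s Tc Ts by auto
      then show False using T_monotone[OF is_interval_co part(2)] no_anti[of "{s..<d}" "(c+d)/2"] cd by auto
    qed
    have "T ` {s..<d} \<noteq> {..T s}"
    proof
      assume "T ` {s..<d} = {..T s}"
      then have "t \<in> T ` {s..<d}" using Ts s by auto
      then obtain u where "u \<in> {s..<d}" "T u = T c" using Tc by auto
      then show False using T_inj[of u c] c' cdom part(2) by auto
    qed
    then have "T ` {s..<d} = {t'..}" using part(3) Ts by auto
    then show ?thesis using that part(1,2) c' s by auto
  qed
  have B: "g x \<in> f ` {s..c}" if "x \<ge> t'" for x
  proof -
    have "x \<in> T ` {s..<d}" unfolding d(4) using that by simp
    then obtain u where u: "x = T u" "u \<in> {s..<d}" by (rule imageE)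
    then have "g x = f u" using g_T d(3) by auto
    then show ?thesis using u d by auto
  qed
  \<comment> \<open>The circle, written with closed intervals for compactness. Its corners
    \<open>f s = g t'\<close> and \<open>g t = f c\<close> are interior to the other arc, and longer
    pieces of either arc stay inside, so it is also a union of two open rays and hence open.\<close>
  define C where "C = f ` {s..c} \<union> g ` {t..t'}"
  have gC: "g x \<in> C" if "x \<ge> t" for x
    using B[of x] that by (cases "x \<le> t'") (auto simp: C_def)
  have fC: "f u \<in> C" if "u \<ge> s" for u
  proof (cases "u \<le> c")
    case False
    then have "f u \<in> g ` {t..}" using fg by auto
    then show ?thesis using gC by auto
  qed (use that in \<open>auto simp: C_def\<close>)
  have "C \<subseteq> f ` {s<..} \<union> g ` {t<..}"
  proof
    fix y assume "y \<in> C"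
    then consider u where "y = f u" "s \<le> u" | x where "y = g x" "t \<le> x" by (auto simp: C_def)
    then show "y \<in> f ` {s<..} \<union> g ` {t<..}"
    proof cases
      case 1
      then show ?thesis using s by (cases "u = s") auto
    next
      case 2
      then show ?thesis using s ct[symmetric] by (cases "x = t") auto
    qed
  qed
  then have "C = f ` {s<..} \<union> g ` {t<..}" using fC gC by auto
  then have "openin L C"
    by (auto intro!: openin_Un open_arc_image_open[OF f] open_arc_image_open[OF g])
  moreover have "compactin L C" unfolding C_def
    by (intro compactin_Un open_arc_compactin[OF f] open_arc_compactin[OF g]) auto
  moreover have "C \<noteq> {}" using fC by blast
  ultimately show ?thesis by blast
qed

end

text \<open>Near a common point the transition is monotone. After possibly reversing
  \<open>g\<close> it increases, and \<open>directed_ray\<close> compares the two right rays and the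
  two left rays. The same inclusion on both sides means that one arc contains the other; opposite
  inclusions are the situation of \<open>arc_join\<close>.\<close>

lemma arc_union:
  assumes H: "Hausdorff_space L" and f: "open_arc L f" and g: "open_arc L g"
    and meet: "range f \<inter> range g \<noteq> {}"
  shows "(\<exists>k. open_arc L k \<and> range k = range f \<union> range g) \<or> (\<exists>C. C \<noteq> {} \<and> compactin L C \<and> openin L C)"
proof -
  have main: "(\<exists>k. open_arc L k \<and> range k = range f \<union> range g) \<or> (\<exists>C. C \<noteq> {} \<and> compactin L C \<and> openin L C)"
    if g: "open_arc L g" and ct: "f c = g t" and e: "e > 0"
      and right: "f ` {c<..c+e} \<subseteq> g ` {t<..}" and left: "f ` {c-e..<c} \<subseteq> g ` {..<t}"
    for g c t e
  proof -
    interpret fg: arc_pair L f g by unfold_locales (rule H f g)+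
    interpret gf: arc_pair L g f by unfold_locales (rule H f g)+
    \<comment> \<open>The mirrored pair turns left rays into right rays.\<close>
    interpret m: arc_pair L "\<lambda>u. f (- u)" "\<lambda>u. g (- u)"
      by unfold_locales (rule H open_arc_uminus f g)+
    have R: "f ` {c..} \<subseteq> g ` {t..} \<or> g ` {t..} \<subseteq> f ` {c..}"
      by (rule fg.directed_ray[OF ct e right])
    have L: "f ` {..c} \<subseteq> g ` {..t} \<or> g ` {..t} \<subseteq> f ` {..c}"
    proof -
      have "(\<lambda>u. f (- u)) ` {-c<..-c+e} \<subseteq> f ` {c-e..<c}" by auto
      also note left
      also have "g ` {..<t} \<subseteq> (\<lambda>u. g (- u)) ` {-t<..}"
        by (auto intro!: image_eqI[of _ _ "- x" for x])
      finally have "(\<lambda>u. f (- u)) ` {-c..} \<subseteq> (\<lambda>u. g (- u)) ` {-t..} \<or>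
          (\<lambda>u. g (- u)) ` {-t..} \<subseteq> (\<lambda>u. f (- u)) ` {-c..}"
        using ct e by (intro m.directed_ray) auto
      moreover have "(\<lambda>u. h (- u)) ` {-a..} = h ` {..a}" for h :: "real \<Rightarrow> 'a" and a
        using image_image[of h uminus "{-a..}"] by simp
      ultimately show ?thesis by simp
    qed
    have half: "range h = h ` {..a} \<union> h ` {a..}" for h :: "real \<Rightarrow> 'a" and a
    proof -
      have "UNIV = {..a} \<union> {a..}" by auto
      then show ?thesis by (metis image_Un)
    qed
    from R L show ?thesis
    proof (elim disjE)
      assume "f ` {c..} \<subseteq> g ` {t..}" "f ` {..c} \<subseteq> g ` {..t}"
      then have "range f \<union> range g = range g" by (auto simp: half[of f c])
      then show ?thesis using g by auto
    next
      assume "f ` {c..} \<subseteq> g ` {t..}" "g ` {..t} \<subseteq> f ` {..c}"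
      then show ?thesis by (rule fg.arc_join[OF ct])
    next
      assume "g ` {t..} \<subseteq> f ` {c..}" "f ` {..c} \<subseteq> g ` {..t}"
      then show ?thesis using gf.arc_join[OF ct[symmetric]] by (simp add: Un_commute)
    next
      assume "g ` {t..} \<subseteq> f ` {c..}" "g ` {..t} \<subseteq> f ` {..c}"
      then have "range f \<union> range g = range f" by (auto simp: half[of g t])
      then show ?thesis using f by auto
    qed
  qed
  obtain c t where ct: "f c = g t" using meet by auto
  interpret arc_pair L f g by unfold_locales (rule H f g)+
  have Tc: "T c = t" by (rule T_eq[OF ct])
  have "c \<in> dom" using ct by (auto simp: dom_def)
  then obtain e where e: "e > 0" "cball c e \<subseteq> dom" using open_dom by (meson open_contains_cball)
  then have sub: "{c-e..c+e} \<subseteq> dom" by (auto simp: cball_eq_atLeastAtMost)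
  have gT': "f u = g (T u)" if "c - e \<le> u" "u \<le> c + e" for u
    using g_T[of u] sub that by auto
  consider "strict_mono_on {c-e..c+e} T" | "strict_antimono_on {c-e..c+e} T"
    using T_monotone[OF is_interval_cc sub] by blast
  then show ?thesis
  proof cases
    case 1
    have "f u \<in> g ` {t<..}" if "u \<in> {c<..c+e}" for u
      using strict_mono_onD[OF 1, of c u] gT'[of u] that e Tc by (intro image_eqI[of _ _ "T u"]) auto
    moreover have "f u \<in> g ` {..<t}" if "u \<in> {c-e..<c}" for u
      using strict_mono_onD[OF 1, of u c] gT'[of u] that e Tc by (intro image_eqI[of _ _ "T u"]) auto
    ultimately show ?thesis by (intro main[OF g ct e(1)]) blast+
  next
    case 2
    have "f u \<in> (\<lambda>u. g (- u)) ` {-t<..}" if "u \<in> {c<..c+e}" for u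
      using monotone_onD[OF 2, of c u] gT'[of u] that e Tc by (intro image_eqI[of _ _ "- T u"]) auto
    moreover have "f u \<in> (\<lambda>u. g (- u)) ` {..<-t}" if "u \<in> {c-e..<c}" for u
      using monotone_onD[OF 2, of u c] gT'[of u] that e Tc by (intro image_eqI[of _ _ "- T u"]) auto
    ultimately have "(\<exists>k. open_arc L k \<and> range k = range f \<union> range (\<lambda>u. g (- u))) \<or>
        (\<exists>C. C \<noteq> {} \<and> compactin L C \<and> openin L C)"
      using ct by (intro main[OF open_arc_uminus[OF g] _ e(1), of c "-t"]) auto
    moreover have "range (\<lambda>u. g (- u)) = range g"
      using image_image[of g uminus UNIV] by simp
    ultimately show ?thesis by simp
  qed
qed

section \<open>Connected non-compact 1-manifolds\<close>

lemma arc_sub_reparam: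
  assumes f: "open_arc L f" and g: "open_arc L g" and sub: "range f \<subseteq> range g"
  obtains h where "continuous_on UNIV h" "strict_mono h \<or> strict_antimono_on UNIV h" "\<And>t. f t = g (h t)"
proof -
  define h where "h = (\<lambda>t. inv_into UNIV g (f t))"
  have U: "{s. f s \<in> range g} = UNIV" using sub by auto
  have c: "continuous_on UNIV h" and i: "inj h"
    using open_arc_transition(2)[OF open_arcD(1)[OF f] g]
      open_arc_transition(3)[OF open_arcD(1)[OF f] g open_arcD(3)[OF f]] by (simp_all add: U h_def)
  have "f t = g (h t)" for t using sub by (simp add: h_def f_inv_into_f image_subset_iff)
  moreover have "strict_mono h \<or> strict_antimono_on UNIV h"
    using injective_eq_monotone_map[OF is_interval_univ c] i by blast
  ultimately show thesis using that c by blast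
qed

text \<open>An arc and its reversal have the same range, so the ambient arc may be chosen to run in
  the direction of \<open>f\<close>. This is how orientations are transferred to longer
  arcs.\<close>

lemma arc_sub_reparam_mono:
  assumes f: "open_arc L f" and g: "open_arc L g" and sub: "range f \<subseteq> range g"
  obtains k h where "open_arc L k" "range k = range g" "continuous_on UNIV h" "strict_mono h"
    "\<And>t. f t = k (h t)"
proof -
  obtain h where h: "continuous_on UNIV h" "strict_mono h \<or> strict_antimono_on UNIV h" "\<And>t. f t = g (h t)"
    using arc_sub_reparam[OF assms] by blast
  show thesis
  proof (cases "strict_mono h")
    case True then show thesis using that g h by blast
  next
    case False
    then have a: "strict_antimono_on UNIV h" using h by blast
    have "strict_mono (\<lambda>t. - h t)"
      using monotone_onD[OF a] by (auto simp: strict_mono_def)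
    moreover have "range (\<lambda>t. g (- t)) = range g"
      using image_image[of g uminus UNIV] by simp
    ultimately show thesis
      using that[of "\<lambda>t. g (- t)" "\<lambda>t. - h t"] open_arc_uminus[OF g] h
      by (auto intro!: continuous_intros)
  qed
qed

text \<open>These assumptions also fit the long line, so no global parametrization can be derived
  from them. All arguments use arcs that contain finitely many given points.\<close>

locale open_line =
  fixes L :: "'a topology"
  assumes Hausdorff: "Hausdorff_space L"
    and conn: "connected_space L"
    and noncompact: "\<not> compact_space L"
    and arcs: "x \<in> topspace L \<Longrightarrow> \<exists>f. open_arc L f \<and> x \<in> range f"
begin

text \<open>The circle alternative of \<open>arc_union\<close> is clopen and compact, so it would
  exhaust the connected space \<open>L\<close> and make it compact.\<close>

lemma arc_Un:
  assumes f: "open_arc L f" and g: "open_arc L g" and "range f \<inter> range g \<noteq> {}"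
  obtains k where "open_arc L k" "range k = range f \<union> range g"
proof -
  have "\<not> (\<exists>C. C \<noteq> {} \<and> compactin L C \<and> openin L C)"
  proof clarify
    fix C assume C: "C \<noteq> {}" "compactin L C" "openin L C"
    then have "C = topspace L"
      using conn compactin_imp_closedin[OF Hausdorff] unfolding connected_space_clopen_in by blast
    then show False using C(2) noncompact by (simp add: compact_space_def)
  qed
  then show thesis using arc_union[OF Hausdorff assms] that by blast
qed

text \<open>The points that share an open arc with \<open>x\<close> form an open set. It is also
  closed: an arc around a limit point meets one of these arcs, and \<open>arc_Un\<close> merges the
  two.\<close>

lemma arc_through_two:
  assumes x: "x \<in> topspace L" and y: "y \<in> topspace L"
  obtains f where "open_arc L f" "x \<in> range f" "y \<in> range f"
proof -
  define D where "D = \<Union>{range f | f. open_arc L f \<and> x \<in> range f}"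
  have D_iff: "z \<in> D \<longleftrightarrow> (\<exists>f. open_arc L f \<and> x \<in> range f \<and> z \<in> range f)" for z
    unfolding D_def by blast
  have "openin L D" unfolding D_def by (rule openin_Union) (auto intro: open_arcD(4))
  moreover have "closedin L D"
    unfolding closedin_def
  proof
    show "D \<subseteq> topspace L" using \<open>openin L D\<close> by (rule openin_subset)
    show "openin L (topspace L - D)"
    proof (subst openin_subopen, rule ballI)
      fix z assume z: "z \<in> topspace L - D"
      then obtain g where g: "open_arc L g" "z \<in> range g" using arcs by blast
      have "range g \<inter> D = {}"
      proof (rule ccontr)
        assume "range g \<inter> D \<noteq> {}"
        then obtain f where f: "open_arc L f" "x \<in> range f" "range f \<inter> range g \<noteq> {}"
          using D_iff by blast
        then obtain k where k: "open_arc L k" "range k = range f \<union> range g"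
          using arc_Un g by metis
        then have "x \<in> range k" "z \<in> range k" using f(2) g(2) by simp_all
        then have "z \<in> D" using k(1) D_iff by blast
        then show False using z by blast
      qed
      then show "\<exists>T. openin L T \<and> z \<in> T \<and> T \<subseteq> topspace L - D"
        using g(2) open_arcD(4)[OF g(1)] openin_subset[OF open_arcD(4)[OF g(1)]]
        by (intro exI[of _ "range g"] conjI subsetI DiffI) auto
    qed
  qed
  moreover have "x \<in> D" using arcs[OF x] D_iff by blast
  ultimately have "D = topspace L" using conn unfolding connected_space_clopen_in by blast
  then show thesis using y that D_iff by blast
qed

lemma arc_containing_arcs:
  assumes f: "open_arc L f" and g: "open_arc L g"
  obtains k where "open_arc L k" "range f \<union> range g \<subseteq> range k"
proof -
  obtain l where l: "open_arc L l" "f 0 \<in> range l" "g 0 \<in> range l"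
    using arc_through_two open_arcD(6) f g by metis
  then have "range f \<inter> range l \<noteq> {}" by blast
  then obtain m where m: "open_arc L m" "range m = range f \<union> range l" using arc_Un[OF f l(1)] by blast
  then have "range m \<inter> range g \<noteq> {}" using l by blast
  then obtain k where "open_arc L k" "range k = range m \<union> range g" using arc_Un[OF m(1) g] by blast
  then show thesis using that m by blast
qed

text \<open>Each point of a line cuts it in two. If \<open>C\<close> misses \<open>f s\<close>, the
  points after and before \<open>f s\<close> form open sets \<open>P\<close> and \<open>N\<close>
  that disconnect \<open>C\<close>. As no global order is at hand, before and after are defined
  through all arcs that prolong \<open>f\<close> in its own direction.\<close>

lemma connected_contains_arc:
  assumes f: "open_arc L f" and C: "connectedin L C" and ab: "f a \<in> C" "f b \<in> C" "a \<le> s" "s \<le> b"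
  shows "f s \<in> C"
proof (rule ccontr)
  assume fs: "f s \<notin> C"
  define ext where
    "ext g u \<longleftrightarrow> open_arc L g \<and> g u = f s \<and> (\<exists>h. strict_mono h \<and> (\<forall>t. f t = g (h t)))" for g u
  define P where "P = \<Union>{g ` {u<..} | g u. ext g u}"
  define N where "N = \<Union>{g ` {..<u} | g u. ext g u}"
  have P_iff: "y \<in> P \<longleftrightarrow> (\<exists>g u w. ext g u \<and> u < w \<and> y = g w)" for y unfolding P_def by auto
  have N_iff: "y \<in> N \<longleftrightarrow> (\<exists>g u w. ext g u \<and> w < u \<and> y = g w)" for y unfolding N_def by auto
  have "openin L P" "openin L N"
    unfolding P_def N_def by (rule openin_Union, auto simp: ext_def intro: open_arc_image_open)+
  moreover have "C \<subseteq> P \<union> N"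
  proof
    fix y assume y: "y \<in> C"
    then obtain g0 where g0: "open_arc L g0" "y \<in> range g0" using C arcs connectedin_subset_topspace by blast
    obtain g1 where g1: "open_arc L g1" "range f \<union> range g0 \<subseteq> range g1"
      using arc_containing_arcs[OF f g0(1)] by blast
    have "range f \<subseteq> range g1" and "y \<in> range g1" using g1(2) g0(2) by auto
    then obtain g h where g: "open_arc L g" "range g = range g1" "continuous_on UNIV h" "strict_mono h"
        "\<And>t. f t = g (h t)"
      using arc_sub_reparam_mono[OF f g1(1)] by metis
    then have e: "ext g (h s)" by (auto simp: ext_def)
    obtain w where w: "y = g w" using g(2) \<open>y \<in> range g1\<close> by auto
    have "w \<noteq> h s" using w y fs g by metis
    then show "y \<in> P \<union> N" using w e unfolding Un_iff P_iff N_iff by (metis not_less_iff_gr_or_eq)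
  qed
  \<comment> \<open>Two prolongations of \<open>f\<close> with conflicting verdicts lie in a common
    arc \<open>k\<close>. By \<open>inc\<close> both run increasingly in \<open>k\<close> and give
    \<open>f s\<close> the same coordinate, so the verdicts cannot conflict.\<close>
  moreover have "P \<inter> N = {}"
  proof (rule ccontr)
    assume "P \<inter> N \<noteq> {}"
    then obtain y where "y \<in> P" "y \<in> N" by auto
    then obtain g u w g' u' w' where e: "ext g u" "ext g' u'" and w: "u < w" "w' < u'" "g w = g' w'"
      unfolding P_iff N_iff by metis
    then have g: "open_arc L g" "open_arc L g'" by (auto simp: ext_def)
    obtain k0 where k0: "open_arc L k0" "range g \<union> range g' \<subseteq> range k0"
      using arc_containing_arcs[OF g] by blast
    have rf: "range f \<subseteq> range k0" using e(1) k0 by (auto simp: ext_def)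
    obtain k hf where k: "open_arc L k" "range k = range k0" "continuous_on UNIV hf" "strict_mono hf"
        "\<And>t. f t = k (hf t)"
      using arc_sub_reparam_mono[OF f k0(1) rf] by metis
    have inc: "strict_mono h \<and> hf s = h u" if e: "ext g u" and h: "strict_mono h \<or> strict_antimono_on UNIV h" "\<And>t. g t = k (h t)"
      for g u h
    proof -
      obtain h' where h': "strict_mono h'" "\<And>t. f t = g (h' t)" using e by (auto simp: ext_def)
      then have eq: "hf t = h (h' t)" for t using k h open_arcD(5)[OF k(1)] by metis
      have "\<not> strict_antimono_on UNIV h"
      proof
        assume a: "strict_antimono_on UNIV h"
        have "h (h' 1) < h (h' 0)"
          using strict_monoD[OF h'(1), of 0 1] monotone_onD[OF a, of "h' 0" "h' 1"] by simp
        then show False using eq strict_monoD[OF k(4), of 0 1] by simp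
      qed
      moreover have "hf s = h u" using e k h open_arcD(5)[OF k(1)] by (metis ext_def)
      ultimately show ?thesis using h by blast
    qed
    obtain h where h: "strict_mono h \<or> strict_antimono_on UNIV h" "\<And>t. g t = k (h t)"
      using arc_sub_reparam[OF g(1) k(1)] k0(2) k(2) by (metis le_sup_iff)
    obtain h' where h': "strict_mono h' \<or> strict_antimono_on UNIV h'" "\<And>t. g' t = k (h' t)"
      using arc_sub_reparam[OF g(2) k(1)] k0(2) k(2) by (metis le_sup_iff)
    have "h w = h' w'" using w h h' open_arcD(5)[OF k(1)] by metis
    then show False
      using inc[OF e(1) h] inc[OF e(2) h'] strict_monoD[of h u w] strict_monoD[of h' w' u'] w by force
  qed
  moreover have "f a \<in> N" "f b \<in> P"
  proof -
    have "strict_mono (\<lambda>t::real. t)" by (simp add: strict_mono_def)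
    then have e: "ext f s" using f by (auto simp: ext_def)
    have "a \<noteq> s" "b \<noteq> s" using ab fs by auto
    then show "f a \<in> N" "f b \<in> P" using e ab unfolding P_iff N_iff by force+
  qed
  ultimately show False using C ab unfolding connectedin by blast
qed

text \<open>Connectedness alone is used, so neither a parametrization nor an order has to be chosen;
  \<open>seg_arc\<close> identifies the result with the image of a closed interval.\<close>

definition seg :: "'a \<Rightarrow> 'a \<Rightarrow> 'a set" where
  "seg x y = \<Inter>{C. connectedin L C \<and> x \<in> C \<and> y \<in> C}"

lemma seg_commute: "seg x y = seg y x"
  unfolding seg_def by (simp add: conj_commute)

lemma seg_arc:
  assumes f: "open_arc L f" and st: "s \<le> t"
  shows "seg (f s) (f t) = f ` {s..t}"
proof
  have "connectedin L (f ` {s..t})"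
    using connectedin_continuous_map_image[OF open_arcD(1)[OF f], of "{s..t}"] by simp
  then show "seg (f s) (f t) \<subseteq> f ` {s..t}"
    unfolding seg_def using st by (intro Inter_lower) auto
  show "f ` {s..t} \<subseteq> seg (f s) (f t)"
    unfolding seg_def
  proof (rule Inter_greatest, clarify)
    fix C u assume "connectedin L C" "f s \<in> C" "f t \<in> C" "u \<in> {s..t}"
    then show "f u \<in> C" using connected_contains_arc[OF f, of C s t u] by simp
  qed
qed

lemma seg_props:
  assumes "x \<in> topspace L" "y \<in> topspace L"
  shows "connectedin L (seg x y)" "compactin L (seg x y)" "x \<in> seg x y" "y \<in> seg x y"
proof -
  obtain f where f: "open_arc L f" "x \<in> range f" "y \<in> range f" using arc_through_two assms by blast
  then obtain s t where st: "x = f s" "y = f t" by blast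
  have "\<exists>a b. seg x y = f ` {a..b}"
    unfolding st using seg_arc[OF f(1)] seg_commute by (metis linear)
  then obtain a b where ab: "seg x y = f ` {a..b}" by blast
  show "connectedin L (seg x y)"
    using connectedin_continuous_map_image[OF open_arcD(1)[OF f(1)], of "{a..b}"] by (simp add: ab)
  show "compactin L (seg x y)" by (simp add: ab open_arc_compactin[OF f(1)])
  show "x \<in> seg x y" "y \<in> seg x y" unfolding seg_def by auto
qed

text \<open>The arc \<open>p\<close> serves as the reference orientation, later a line of
  \<open>\<psi>0\<close>. Subtracting \<open>h 0\<close> puts the base point at parameter 0, so that
  the sign of a parameter tells the side of the base point.\<close>

lemma oriented_arc:
  assumes p: "open_arc L p" and x: "x \<in> topspace L" and y: "y \<in> topspace L"
  obtains f h where "open_arc L f" "f 0 = p 0" "x \<in> range f" "y \<in> range f"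
    "strict_mono h" "continuous_on UNIV h" "h 0 = 0" "\<And>t. p t = f (h t)"
proof -
  obtain g where g: "open_arc L g" "x \<in> range g" "y \<in> range g" using arc_through_two x y by blast
  obtain k0 where k0: "open_arc L k0" "range p \<union> range g \<subseteq> range k0" using arc_containing_arcs[OF p g(1)] .
  then obtain k h where k: "open_arc L k" "range k = range k0" "continuous_on UNIV h" "strict_mono h" "\<And>t. p t = k (h t)"
    using arc_sub_reparam_mono[OF p k0(1)] k0(2) by (metis le_sup_iff)
  have "open_arc L (\<lambda>t. k (t + h 0))"
    by (rule open_arc_reparam[OF k(1)]) (auto intro!: continuous_intros)
  moreover have "range (\<lambda>t. k (t + h 0)) = range k"
  proof -
    have "k t \<in> range (\<lambda>t. k (t + h 0))" for t by (rule range_eqI[of _ _ "t - h 0"]) simp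
    then show ?thesis by auto
  qed
  moreover have "x \<in> range k0" "y \<in> range k0" using g(2,3) k0(2) by auto
  moreover have "strict_mono (\<lambda>t. h t - h 0)" using k(4) by (simp add: strict_mono_def)
  moreover have "continuous_on UNIV (\<lambda>t. h t - h 0)" using k(3) by (intro continuous_intros)
  ultimately show thesis
    using that[of "\<lambda>t. k (t + h 0)" "\<lambda>t. h t - h 0"] k(2,5) by simp
qed

text \<open>The side of a point is expressed by a segment meeting one half of \<open>p\<close>. In
  this form it becomes an open condition when \<open>p\<close> varies with the leaf, by
  \<open>sg_lower\<close>.\<close>

lemma positive_side_iff:
  fixes h :: "real \<Rightarrow> real"
  assumes f: "open_arc L f" "f 0 = p 0" and h: "strict_mono h" "continuous_on UNIV h" "h 0 = 0"
    and p: "\<And>t. p t = f (h t)"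
  shows "seg (p 0) (f s) \<inter> p ` {0<..} \<noteq> {} \<longleftrightarrow> s > 0"
proof
  have hp: "h t > 0 \<longleftrightarrow> t > 0" for t
    using strict_mono_less[OF h(1), of 0 t] h(3) by simp
  have seg: "seg (p 0) (f s) = (if s \<ge> 0 then f ` {0..s} else f ` {s..0})"
    using seg_arc[OF f(1), of 0 s] seg_arc[OF f(1), of s 0] seg_commute[of "f 0" "f s"] f(2) by auto
  {
    assume "s > 0"
    \<comment> \<open>A given point of the positive half of \<open>p\<close> may lie beyond
      \<open>f s\<close>; continuity of \<open>h\<close> at 0 supplies one whose coordinate lies
      between 0 and \<open>s\<close>.\<close>
    then obtain d where d: "d > 0" "\<forall>t. \<bar>t\<bar> < d \<longrightarrow> \<bar>h t\<bar> < s"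
      using h(2,3) unfolding continuous_on_iff dist_real_def by (metis UNIV_I diff_zero)
    have "\<bar>h (d/2)\<bar> < s" "0 < h (d/2)" using d(1) d(2)[rule_format, of "d/2"] hp[of "d/2"] by simp_all
    then have "p (d/2) \<in> f ` {0..s}" unfolding p by (intro imageI) simp
    moreover have "p (d/2) \<in> p ` {0<..}" using d by auto
    ultimately show "seg (p 0) (f s) \<inter> p ` {0<..} \<noteq> {}" using \<open>s > 0\<close> by (auto simp: seg)
  next
    assume "seg (p 0) (f s) \<inter> p ` {0<..} \<noteq> {}"
    then obtain t where t: "t > 0" "f (h t) \<in> seg (p 0) (f s)" using p by auto
    have "h t > 0" using hp t by simp
    then show "s > 0" using t open_arcD(5)[OF f(1)] by (auto simp: seg split: if_splits)
  }
qed

lemma negative_side_iff: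
  fixes h :: "real \<Rightarrow> real"
  assumes f: "open_arc L f" "f 0 = p 0" and h: "strict_mono h" "continuous_on UNIV h" "h 0 = 0"
    and p: "\<And>t. p t = f (h t)"
  shows "seg (p 0) (f s) \<inter> p ` {..<0} \<noteq> {} \<longleftrightarrow> s < 0"
proof -
  have "seg (p (- 0)) (f (- (- s))) \<inter> (\<lambda>t. p (- t)) ` {0<..} \<noteq> {} \<longleftrightarrow> - s > 0"
  proof (rule positive_side_iff[of "\<lambda>t. f (- t)" "\<lambda>t. p (- t)" "\<lambda>t. - h (- t)" "- s"])
    show "strict_mono (\<lambda>t. - h (- t))" using strict_monoD[OF h(1)] by (auto simp: strict_mono_def)
    show "continuous_on UNIV (\<lambda>t. - h (- t))"
      by (intro continuous_on_minus continuous_on_compose2[OF h(2)]) (auto intro: continuous_intros)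
    show "p (- t) = f (- (- h (- t)))" for t by (simp add: p)
  qed (use open_arc_uminus[OF f(1)] f(2) h(3) in simp_all)
  moreover have "(\<lambda>t. p (- t)) ` {0<..} = p ` {..<0}" using image_image[of p uminus "{0<..}"] by simp
  ultimately show ?thesis by simp
qed

end

section \<open>Submersions whose fibres are lines\<close>

abbreviation cylinder :: "'b topology \<Rightarrow> 'b set \<Rightarrow> (real \<times> 'b) topology" where
  "cylinder V B \<equiv> prod_topology euclideanreal (subtopology V B)"

text \<open>An inverse chart: an open set of \<open>S\<close> is parametrized by a full line times a
  piece of \<open>V\<close>, so that plaques are open arcs without rescaling.\<close>

definition fibre_chart ::
  "'a topology \<Rightarrow> 'b topology \<Rightarrow> ('a \<Rightarrow> 'b) \<Rightarrow> 'b set \<Rightarrow> (real \<times> 'b \<Rightarrow> 'a) \<Rightarrow> bool" where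
  "fibre_chart S V q B \<psi> \<longleftrightarrow>
     openin V B \<and> continuous_map (cylinder V B) S \<psi> \<and>
     open_map (cylinder V B) S \<psi> \<and> inj_on \<psi> (UNIV \<times> B) \<and>
     (\<forall>t. \<forall>v\<in>B. q (\<psi> (t, v)) = v)"

lemma fibre_chartD:
  assumes "fibre_chart S V q B \<psi>"
  shows "openin V B" "continuous_map (cylinder V B) S \<psi>"
    "v \<in> B \<Longrightarrow> q (\<psi> (t, v)) = v" "v \<in> B \<Longrightarrow> \<psi> (t, v) \<in> topspace S" "B \<subseteq> topspace V"
    "v \<in> B \<Longrightarrow> \<psi> (s, v) = \<psi> (t, v) \<longleftrightarrow> s = t"
proof -
  show B: "openin V B" and c: "continuous_map (cylinder V B) S \<psi>"
    and "v \<in> B \<Longrightarrow> q (\<psi> (t, v)) = v"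
    using assms by (auto simp: fibre_chart_def)
  show sub: "B \<subseteq> topspace V" using B by (rule openin_subset)
  show "v \<in> B \<Longrightarrow> \<psi> (t, v) \<in> topspace S"
    using c sub by (auto simp: continuous_map_def Pi_iff)
  show "v \<in> B \<Longrightarrow> \<psi> (s, v) = \<psi> (t, v) \<longleftrightarrow> s = t"
    using assms by (auto simp: fibre_chart_def inj_on_def)
qed

lemma fibre_chart_image:
  assumes \<psi>: "fibre_chart S V q B \<psi>" and A: "open A" and C: "openin V C"
  shows "openin S (\<psi> ` (A \<times> (B \<inter> C)))"
proof -
  have "openin (cylinder V B) (A \<times> (B \<inter> C))"
    using A C by (auto simp: openin_prod_Times_iff openin_subtopology Int_commute)
  then show ?thesis using \<psi> by (auto simp: fibre_chart_def open_map_def)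
qed

text \<open>The bound on \<open>s\<close> is not strict because later arguments evaluate at both
  ends \<open>t - d\<close> and \<open>t + d\<close>.\<close>

lemma fibre_chart_box:
  assumes \<psi>: "fibre_chart S V q B \<psi>" and U: "openin S U" "\<psi> (t, v) \<in> U" and v: "v \<in> B"
  obtains d C where "d > 0" "openin V C" "v \<in> C" "C \<subseteq> B" "\<And>s w. \<bar>s - t\<bar> \<le> d \<Longrightarrow> w \<in> C \<Longrightarrow> \<psi> (s, w) \<in> U"
proof -
  let ?P = "cylinder V B"
  define W where "W = {p \<in> topspace ?P. \<psi> p \<in> U}"
  have W: "openin ?P W"
    using fibre_chartD(2)[OF \<psi>] U by (auto simp: W_def continuous_map_def)
  have "(t, v) \<in> W"
    using U v fibre_chartD(5)[OF \<psi>] by (auto simp: W_def)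
  then obtain A C where AC: "openin euclideanreal A" "openin (subtopology V B) C" "t \<in> A" "v \<in> C"
    "A \<times> C \<subseteq> W"
    using W[unfolded openin_prod_topology_alt, rule_format] by metis
  have C: "openin V C" "C \<subseteq> B"
    using AC(2) openin_trans_full[OF AC(2) fibre_chartD(1)[OF \<psi>]] openin_imp_subset by auto
  obtain d where d: "d > 0" "cball t d \<subseteq> A" using AC(1,3) by (metis open_openin open_contains_cball)
  show thesis
  proof (rule that[OF d(1) C(1) AC(4) C(2)])
    fix s w assume "\<bar>s - t\<bar> \<le> d" "w \<in> C"
    then have "s \<in> A" using d(2) by (auto simp: dist_real_def abs_minus_commute)
    then have "(s, w) \<in> W" using AC(5) \<open>w \<in> C\<close> by blast
    then show "\<psi> (s, w) \<in> U" by (simp add: W_def)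
  qed
qed

lemma fibre_chart_slice:
  assumes \<psi>: "fibre_chart S V q B \<psi>"
  shows "continuous_map (subtopology V B) S (\<lambda>v. \<psi> (t, v))"
proof -
  have "continuous_map (subtopology V B) (cylinder V B) (\<lambda>v. (t, v))"
    by (simp add: continuous_map_pairwise o_def continuous_map_id[unfolded id_def])
  then show ?thesis using continuous_map_compose[OF _ fibre_chartD(2)[OF \<psi>]] by (auto simp: o_def)
qed

lemma fibre_chart_line:
  assumes \<psi>: "fibre_chart S V q B \<psi>" and v: "v \<in> B"
  shows "continuous_map euclideanreal S (\<lambda>t. \<psi> (t, v))"
proof -
  have "continuous_map euclideanreal (cylinder V B) (\<lambda>t. (t, v))"
    using v fibre_chartD(5)[OF \<psi>] by (auto simp: continuous_map_pairwise o_def)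
  then show ?thesis using continuous_map_compose[OF _ fibre_chartD(2)[OF \<psi>]] by (auto simp: o_def)
qed

text \<open>The chart \<open>\<psi>0\<close> covers all of \<open>V\<close>. It supplies the base
  point of every fibre and a direction that is consistent from fibre to fibre; the other charts may
  run either way.\<close>

locale line_submersion =
  fixes S :: "'a topology" and V :: "'b topology" and q :: "'a \<Rightarrow> 'b" and \<psi>0 :: "real \<times> 'b \<Rightarrow> 'a"
  assumes Hausdorff: "Hausdorff_space S"
    and second_countable: "second_countable S"
    and locally_compact: "locally_compact_space S"
    and q_cont: "continuous_map S V q"
    and charts: "z \<in> topspace S \<Longrightarrow> \<exists>B \<psi>. fibre_chart S V q B \<psi> \<and> z \<in> \<psi> ` (UNIV \<times> B)"
    and chart0: "fibre_chart S V q (topspace V) \<psi>0"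
    and fibre_connected: "v \<in> topspace V \<Longrightarrow> connectedin S {x \<in> topspace S. q x = v}"
    and fibre_noncompact: "v \<in> topspace V \<Longrightarrow> \<not> compactin S {x \<in> topspace S. q x = v}"
begin

definition fib :: "'b \<Rightarrow> 'a set" where
  "fib v = {x \<in> topspace S. q x = v}"

lemma mem_fib [simp]: "x \<in> fib v \<longleftrightarrow> x \<in> topspace S \<and> q x = v"
  by (simp add: fib_def)

abbreviation fib_top :: "'b \<Rightarrow> 'a topology" where
  "fib_top v \<equiv> subtopology S (fib v)"

lemma fib_arcD:
  assumes "open_arc (fib_top v) f"
  shows "f t \<in> topspace S" "q (f t) = v" "v \<in> topspace V" "continuous_map euclideanreal S f"
proof -
  show f: "f t \<in> topspace S" "q (f t) = v" for t using open_arcD(6)[OF assms, of t] by auto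
  have "q (f 0) \<in> topspace V" using q_cont f(1)[of 0] by (auto simp: continuous_map_def Pi_iff)
  then show "v \<in> topspace V" using f(2) by simp
  show "continuous_map euclideanreal S f"
    using open_arcD(1)[OF assms] by (simp add: continuous_map_in_subtopology)
qed

text \<open>Since \<open>q\<close> recovers the parameter \<open>v\<close>, the image of the chart
  meets the fibre of \<open>v\<close> in this plaque only. So the plaque is open in the fibre, and
  the subspace topology serves as the leaf topology.\<close>

lemma chart_plaque:
  assumes \<psi>: "fibre_chart S V q B \<psi>" and v: "v \<in> B"
  shows "open_arc (fib_top v) (\<lambda>t. \<psi> (t, v))"
  unfolding open_arc_def
proof (intro conjI)
  show "continuous_map euclideanreal (fib_top v) (\<lambda>t. \<psi> (t, v))"
    using fibre_chart_line[OF \<psi> v] fibre_chartD(3,4)[OF \<psi> v] by (auto simp: continuous_map_in_subtopology)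
  show "inj (\<lambda>t. \<psi> (t, v))" using fibre_chartD(6)[OF \<psi> v] by (auto simp: inj_def)
  show "open_map euclideanreal (fib_top v) (\<lambda>t. \<psi> (t, v))"
    unfolding open_map_def
  proof (intro allI impI)
    fix A :: "real set" assume "openin euclideanreal A"
    then have "openin S (\<psi> ` (A \<times> (B \<inter> topspace V)))"
      using fibre_chart_image[OF \<psi>, of A "topspace V"] by simp
    moreover have "(\<lambda>t. \<psi> (t, v)) ` A = \<psi> ` (A \<times> (B \<inter> topspace V)) \<inter> fib v"
      using v fibre_chartD(3,4)[OF \<psi>] fibre_chartD(5)[OF \<psi>]
      by (auto simp: image_iff intro!: bexI)
    ultimately show "openin (fib_top v) ((\<lambda>t. \<psi> (t, v)) ` A)"
      by (auto simp: openin_subtopology)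
  qed
qed

lemma fib_line:
  assumes v: "v \<in> topspace V"
  shows "open_line (fib_top v)"
proof
  show "Hausdorff_space (fib_top v)" by (rule Hausdorff_space_subtopology[OF Hausdorff])
  have "connectedin S (fib v)" using fibre_connected[OF v] by (simp add: fib_def)
  then show "connected_space (fib_top v)" by (simp add: connectedin_def)
  have "fib v \<subseteq> topspace S" by auto
  then show "\<not> compact_space (fib_top v)"
    using fibre_noncompact[OF v] by (simp add: fib_def compactin_subspace)
  fix x assume "x \<in> topspace (fib_top v)"
  then have x: "x \<in> topspace S" "q x = v" by auto
  then obtain B \<psi> where \<psi>: "fibre_chart S V q B \<psi>" "x \<in> \<psi> ` (UNIV \<times> B)" using charts by blast
  then obtain t w where "w \<in> B" "x = \<psi> (t, w)" by auto
  then have "v \<in> B" "x = \<psi> (t, v)" using x fibre_chartD(3)[OF \<psi>(1), of w t] by auto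
  then show "\<exists>f. open_arc (fib_top v) f \<and> x \<in> range f"
    using chart_plaque[OF \<psi>(1)] by blast
qed

lemma q_open:
  assumes U: "openin S U"
  shows "openin V (q ` U)"
proof (subst openin_subopen, clarify)
  fix x assume x: "x \<in> U"
  then have "x \<in> topspace S" using openin_subset[OF U] by blast
  then obtain B \<psi> t w where \<psi>: "fibre_chart S V q B \<psi>" "w \<in> B" "x = \<psi> (t, w)" using charts by fastforce
  obtain d C where C: "d > 0" "openin V C" "w \<in> C" "C \<subseteq> B" "\<And>s u. \<bar>s - t\<bar> \<le> d \<Longrightarrow> u \<in> C \<Longrightarrow> \<psi> (s, u) \<in> U"
    using fibre_chart_box[OF \<psi>(1) U] x \<psi> by metis
  have "C \<subseteq> q ` U"
  proof
    fix u assume u: "u \<in> C"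
    then have "\<psi> (t, u) \<in> U" using C(1) C(5)[of t u] by simp
    moreover have "u = q (\<psi> (t, u))" using fibre_chartD(3)[OF \<psi>(1)] u C(4) by auto
    ultimately show "u \<in> q ` U" by (metis imageI)
  qed
  moreover have "q x = w" using fibre_chartD(3)[OF \<psi>(1,2)] \<psi>(3) by simp
  ultimately show "\<exists>T. openin V T \<and> q x \<in> T \<and> T \<subseteq> q ` U" using C by blast
qed

text \<open>Boxes of a fibre chart work: a fibre meets such a box in one interval of a plaque or not
  at all. These are the links of the chain built in \<open>sg_upper\<close>.\<close>

lemma small_plaques:
  assumes U: "openin S U" "x \<in> U"
  obtains A where "openin S A" "x \<in> A" "A \<subseteq> U" "\<And>v. connectedin S (A \<inter> fib v)"
proof -
  have "x \<in> topspace S" using openin_subset[OF U(1)] U(2) by blast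
  then obtain B \<psi> t w where \<psi>: "fibre_chart S V q B \<psi>" "w \<in> B" "x = \<psi> (t, w)" using charts by fastforce
  obtain d C where C: "d > 0" "openin V C" "w \<in> C" "C \<subseteq> B" "\<And>s u. \<bar>s - t\<bar> \<le> d \<Longrightarrow> u \<in> C \<Longrightarrow> \<psi> (s, u) \<in> U"
    using fibre_chart_box[OF \<psi>(1) U(1)] U(2) \<psi> by metis
  define A where "A = \<psi> ` ({t-d<..<t+d} \<times> (B \<inter> C))"
  show thesis
  proof (rule that)
    show "openin S A" unfolding A_def by (rule fibre_chart_image[OF \<psi>(1) _ C(2)]) simp
    show "x \<in> A" using \<psi> C by (auto simp: A_def)
    show "A \<subseteq> U" unfolding A_def using C(5) by auto
    fix v
    show "connectedin S (A \<inter> fib v)"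
    proof (cases "v \<in> C")
      case True
      then have v: "v \<in> B" using C(4) by blast
      have "A \<inter> fib v = (\<lambda>s. \<psi> (s, v)) ` {t-d<..<t+d}"
        using True v fibre_chartD(3,4)[OF \<psi>(1)] by (auto simp: A_def)
      moreover have "connectedin (fib_top v) ((\<lambda>s. \<psi> (s, v)) ` {t-d<..<t+d})"
        by (rule connectedin_continuous_map_image[OF open_arcD(1)[OF chart_plaque[OF \<psi>(1) v]]]) simp
      ultimately show ?thesis by (simp add: connectedin_subtopology)
    next
      case False
      then have "A \<inter> fib v = {}" using fibre_chartD(3)[OF \<psi>(1)] by (auto simp: A_def)
      then show ?thesis by simp
    qed
  qed
qed

definition \<gamma> :: "'b \<Rightarrow> 'a" where "\<gamma> v = \<psi>0 (0, v)"

lemma \<gamma>_props: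
  assumes "v \<in> topspace V" shows "\<gamma> v \<in> topspace S" "q (\<gamma> v) = v" "\<gamma> v \<in> fib v"
  using fibre_chartD(3,4)[OF chart0 assms] by (auto simp: \<gamma>_def)

lemma q_in: "x \<in> topspace S \<Longrightarrow> q x \<in> topspace V"
  using q_cont by (auto simp: continuous_map_def Pi_iff)

lemma \<gamma>_cont: "continuous_map V S \<gamma>"
  using fibre_chart_slice[OF chart0, of 0] by (simp add: \<gamma>_def[abs_def])

lemma \<gamma>q_cont: "continuous_map S S (\<lambda>x. \<gamma> (q x))"
  using continuous_map_compose[OF q_cont \<gamma>_cont] by (simp add: o_def)

definition sg :: "'a \<Rightarrow> 'a set" where
  "sg x = open_line.seg (fib_top (q x)) (\<gamma> (q x)) x"

lemma sg_props:
  assumes x: "x \<in> topspace S"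
  shows "sg x \<subseteq> fib (q x)" "connectedin S (sg x)" "compactin S (sg x)" "\<gamma> (q x) \<in> sg x" "x \<in> sg x"
proof -
  interpret L: open_line "fib_top (q x)" by (rule fib_line[OF q_in[OF x]])
  note * = L.seg_props[of "\<gamma> (q x)" x, folded sg_def]
  have "\<gamma> (q x) \<in> topspace (fib_top (q x))" "x \<in> topspace (fib_top (q x))"
    using \<gamma>_props[OF q_in[OF x]] x by auto
  then show "sg x \<subseteq> fib (q x)" "connectedin S (sg x)" "compactin S (sg x)" "\<gamma> (q x) \<in> sg x" "x \<in> sg x"
    using * by (auto simp: connectedin_subtopology compactin_subtopology)
qed

lemma sg_minimal:
  assumes "connectedin S C" "C \<subseteq> fib (q x)" "\<gamma> (q x) \<in> C" "x \<in> C"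
  shows "sg x \<subseteq> C"
proof -
  have "x \<in> topspace S" using assms by auto
  then interpret L: open_line "fib_top (q x)" using fib_line q_in by blast
  show ?thesis unfolding sg_def L.seg_def using assms by (auto simp: connectedin_subtopology)
qed

lemma fibre_arc:
  assumes x: "x \<in> topspace S" and y: "y \<in> fib (q x)"
  obtains f h s t where "open_arc (fib_top (q x)) f" "f 0 = \<gamma> (q x)" "f s = x" "f t = y"
    "strict_mono (h :: real \<Rightarrow> real)" "continuous_on UNIV h" "h 0 = 0" "\<And>t. \<psi>0 (t, q x) = f (h t)"
proof -
  interpret L: open_line "fib_top (q x)" by (rule fib_line[OF q_in[OF x]])
  have p: "open_arc (fib_top (q x)) (\<lambda>t. \<psi>0 (t, q x))"
    by (rule chart_plaque[OF chart0 q_in[OF x]])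
  have xy: "x \<in> topspace (fib_top (q x))" "y \<in> topspace (fib_top (q x))"
    using x y by auto
  obtain f and h :: "real \<Rightarrow> real" where f: "open_arc (fib_top (q x)) f"
    "f 0 = \<psi>0 (0, q x)" "x \<in> range f" "y \<in> range f"
    "strict_mono h" "continuous_on UNIV h" "h 0 = 0" "\<And>t. \<psi>0 (t, q x) = f (h t)"
    using L.oriented_arc[OF p xy] by metis
  obtain s t where "x = f s" "y = f t" using f(3,4) by auto
  then have st: "f s = x" "f t = y" by simp_all
  show thesis by (rule that[OF f(1) _ st f(5-7)]) (rule f(2)[folded \<gamma>_def], rule f(8))
qed

lemma sg_arc:
  assumes f: "open_arc (fib_top v) f" "f 0 = \<gamma> v"
  shows "s \<ge> 0 \<Longrightarrow> sg (f s) = f ` {0..s}" "s \<le> 0 \<Longrightarrow> sg (f s) = f ` {s..0}"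
proof -
  note fs = fib_arcD[OF f(1)]
  interpret L: open_line "fib_top v" by (rule fib_line[OF fs(3)])
  show "s \<ge> 0 \<Longrightarrow> sg (f s) = f ` {0..s}" "s \<le> 0 \<Longrightarrow> sg (f s) = f ` {s..0}"
    using L.seg_arc[OF f(1), of 0 s] L.seg_arc[OF f(1), of s 0] L.seg_commute[of "f 0" "f s"]
    by (simp_all add: sg_def fs f(2))
qed

text \<open>A point on the negative side is handled by reversing the arc, so that later proofs treat
  one kind of segment only.\<close>

lemma sg_as_arc:
  assumes x: "x \<in> topspace S"
  obtains f s where "open_arc (fib_top (q x)) f" "f 0 = \<gamma> (q x)" "f s = x" "s \<ge> 0"
    "sg x = f ` {0..s}"
proof -
  have "x \<in> fib (q x)" using x by simp
  then obtain f s where f: "open_arc (fib_top (q x)) f" "f 0 = \<gamma> (q x)" "f s = x"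
    using fibre_arc[OF x] by metis
  show thesis
  proof (cases "s \<ge> 0")
    case True
    then show thesis using that f sg_arc(1)[OF f(1,2)] by metis
  next
    case False
    show thesis
    proof (rule that[OF open_arc_uminus[OF f(1)], of "-s"])
      show "sg x = (\<lambda>t. f (- t)) ` {0..- s}"
        using sg_arc(2)[OF f(1,2), of s] False f(3) image_image[of f uminus "{0..-s}"] by simp
    qed (use False f in auto)
  qed
qed

text \<open>Segments on a half-leaf are initial intervals of an arc based at the slice, hence
  nested. This order replaces a coordinate when growth along a half-leaf is stated.\<close>

lemma sg_antisym:
  assumes x: "x \<in> topspace S" and y: "y \<in> sg x" "y \<noteq> x"
  shows "sg y \<subseteq> sg x" "x \<notin> sg y"
proof -
  obtain f s where f: "open_arc (fib_top (q x)) f" "f 0 = \<gamma> (q x)" "f s = x" "s \<ge> 0"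
    "sg x = f ` {0..s}" using sg_as_arc[OF x] .
  then obtain t where t: "y = f t" "0 \<le> t" "t \<le> s" using y(1) f(5) by auto
  have "t \<noteq> s" using y(2) f(3) t(1) by auto
  have "sg y = f ` {0..t}" using sg_arc(1)[OF f(1,2)] t by simp
  then show "sg y \<subseteq> sg x" "x \<notin> sg y" using t \<open>t \<noteq> s\<close> f(3,5) open_arcD(5)[OF f(1)] by auto
qed

text \<open>The segment from the slice to \<open>x\<close> is covered by a chain of small boxes
  inside \<open>N\<close>. Neighboring fibres run through the same chain, and the pieces found there
  join to a connected set that contains the neighboring segment by
  \<open>sg_minimal\<close>.\<close>

lemma sg_upper:
  assumes N: "openin S N"
  shows "openin S {x \<in> topspace S. sg x \<subseteq> N}"
proof (subst openin_subopen, clarify)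
  fix x assume x: "x \<in> topspace S" and xN: "sg x \<subseteq> N"
  obtain f s where f: "open_arc (fib_top (q x)) f" "f 0 = \<gamma> (q x)" "f s = x" "s \<ge> 0"
    "sg x = f ` {0..s}" using sg_as_arc[OF x] .
  note fS = fib_arcD(1,2)[OF f(1)] and fc = fib_arcD(4)[OF f(1)]
  \<comment> \<open>\<open>R A B\<close> is transport inside \<open>N\<close>: points of
    \<open>A\<close> and of \<open>B\<close> on a common fibre are joined by a connected piece of
    that fibre. \<open>Bolzano\<close> builds it from 0 to \<open>s\<close> by composing short
    steps.\<close>
  define R where "R A B \<longleftrightarrow> openin S A \<and> openin S B \<and>
    (\<forall>y\<in>A. \<forall>z\<in>B. q y = q z \<longrightarrow> (\<exists>C. connectedin S C \<and> C \<subseteq> N \<and> C \<subseteq> fib (q y) \<and> y \<in> C \<and> z \<in> C))" for A B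
  have R: "\<exists>C. connectedin S C \<and> C \<subseteq> N \<and> C \<subseteq> fib (q y) \<and> y \<in> C \<and> z \<in> C"
    if "R A B" "y \<in> A" "z \<in> B" "q y = q z" for A B y z
    using that unfolding R_def by blast
  have Ro: "openin S A" "openin S B" if "R A B" for A B
    using that unfolding R_def by blast+
  define P where "P a b \<longleftrightarrow> (0 \<le> a \<and> b \<le> s \<longrightarrow> (\<exists>A B. R A B \<and> f a \<in> A \<and> f b \<in> B))" for a b
  have "P 0 s" using \<open>s \<ge> 0\<close>
  proof (rule Bolzano)
    fix a b c :: real assume Pab: "P a b" and Pbc: "P b c" and abc: "a \<le> b" "b \<le> c"
    show "P a c"
      unfolding P_def
    proof (intro impI)
      assume ac: "0 \<le> a \<and> c \<le> s"
      then have "0 \<le> a \<and> b \<le> s" "0 \<le> b \<and> c \<le> s" using abc by auto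
      then obtain A B B' C where AB: "R A B" "f a \<in> A" "f b \<in> B" and BC: "R B' C" "f b \<in> B'" "f c \<in> C"
        using Pab Pbc unfolding P_def by blast
      \<comment> \<open>Composition needs an intermediate point on each fibre. Restricting
        \<open>A\<close> to the fibres through \<open>B \<inter> B'\<close>, an open condition
        because \<open>q\<close> is open, guarantees one.\<close>
      define Q where "Q = q ` (B \<inter> B')"
      have Q: "openin V Q" unfolding Q_def by (intro q_open openin_Int Ro(2)[OF AB(1)] Ro(1)[OF BC(1)])
      define A' where "A' = {y \<in> topspace S. q y \<in> Q} \<inter> A"
      have "openin S A'" unfolding A'_def using Q q_cont Ro(1)[OF AB(1)] by (auto simp: continuous_map_def)
      moreover have "q (f b) \<in> Q" unfolding Q_def using AB BC by blast
      then have "f a \<in> A'" unfolding A'_def using fS[of a] fS[of b] AB by simp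
      moreover have "\<exists>D. connectedin S D \<and> D \<subseteq> N \<and> D \<subseteq> fib (q y) \<and> y \<in> D \<and> z \<in> D"
        if yz: "y \<in> A'" "z \<in> C" "q y = q z" for y z
      proof -
        obtain w where w: "w \<in> B" "w \<in> B'" "q w = q y" using yz unfolding A'_def Q_def by auto
        obtain D where D: "connectedin S D" "D \<subseteq> N" "D \<subseteq> fib (q y)" "y \<in> D" "w \<in> D"
          using R[OF AB(1), of y w] w yz unfolding A'_def by auto
        obtain E where E: "connectedin S E" "E \<subseteq> N" "E \<subseteq> fib (q w)" "w \<in> E" "z \<in> E"
          using R[OF BC(1), of w z] w yz by auto
        have "connectedin S (D \<union> E)" using D E by (intro connectedin_Un) auto
        then show ?thesis using D E w by (intro exI[of _ "D \<union> E"]) simp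
      qed
      ultimately have "R A' C" using Ro(2)[OF BC(1)] unfolding R_def by blast
      then show "\<exists>A B. R A B \<and> f a \<in> A \<and> f c \<in> B" using \<open>f a \<in> A'\<close> BC(3) by blast
    qed
  next
    fix t assume "0 \<le> t" "t \<le> s"
    then have "f t \<in> N" using xN f(5) by auto
    then obtain A where A: "openin S A" "f t \<in> A" "A \<subseteq> N" "\<And>v. connectedin S (A \<inter> fib v)"
      using small_plaques[OF N] by metis
    have "open {u. f u \<in> A}" using fc A(1) by (auto simp: continuous_map_def)
    then obtain d where d: "d > 0" "ball t d \<subseteq> {u. f u \<in> A}" using A(2) by (metis mem_Collect_eq open_contains_ball)
    have "\<exists>C. connectedin S C \<and> C \<subseteq> N \<and> C \<subseteq> fib (q y) \<and> y \<in> C \<and> z \<in> C"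
        if "y \<in> A" "z \<in> A" "q y = q z" for y z
      using that A openin_subset[OF A(1)] by (intro exI[of _ "A \<inter> fib (q y)"]) auto
    then have "R A A" unfolding R_def using A(1) by blast
    moreover have "f a \<in> A" "f b \<in> A" if "a \<le> t" "t \<le> b" "b - a < d" for a b
      using that d(2) by (auto simp: dist_real_def subset_iff)
    ultimately have "P a b" if "a \<le> t" "t \<le> b" "b - a < d" for a b
      using that unfolding P_def by blast
    then show "\<exists>d>0. \<forall>a b. a \<le> t \<and> t \<le> b \<and> b - a < d \<longrightarrow> P a b" using d(1) by blast
  qed
  then obtain A B where AB: "R A B" "f 0 \<in> A" "f s \<in> B"
    unfolding P_def using \<open>s \<ge> 0\<close> by auto
  \<comment> \<open>Shrink \<open>B\<close> to points whose own base point lies in \<open>A\<close>,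
    so that transport starts at the slice.\<close>
  define B' where "B' = {z \<in> topspace S. \<gamma> (q z) \<in> A} \<inter> B"
  have "openin S B'" unfolding B'_def using \<gamma>q_cont Ro[OF AB(1)] by (auto simp: continuous_map_def)
  moreover have "x \<in> B'" unfolding B'_def using x f AB by auto
  moreover have "sg z \<subseteq> N" if "z \<in> B'" for z
  proof -
    have z: "z \<in> topspace S" "\<gamma> (q z) \<in> A" "z \<in> B" using that by (auto simp: B'_def)
    then obtain C where "connectedin S C" "C \<subseteq> N" "C \<subseteq> fib (q z)" "\<gamma> (q z) \<in> C" "z \<in> C"
      using R[OF AB(1), of "\<gamma> (q z)" z] \<gamma>_props[OF q_in[OF z(1)]] by auto
    then show ?thesis using sg_minimal by blast
  qed
  ultimately show "\<exists>T. openin S T \<and> x \<in> T \<and> T \<subseteq> {x \<in> topspace S. sg x \<subseteq> N}"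
    by (intro exI[of _ B']) (auto simp: B'_def)
qed

text \<open>Outside \<open>N\<close> the segment of \<open>x\<close> falls into two disjoint compact
  pieces, before and after \<open>f u\<close>, with disjoint open neighborhoods \<open>A\<close> and
  \<open>B\<close>. By \<open>sg_upper\<close> a nearby segment stays in
  \<open>A \<union> B \<union> N\<close>, and it runs from \<open>A \<union> N\<close> to
  \<open>B \<union> N\<close>; missing \<open>N\<close> would disconnect it.\<close>

lemma sg_lower:
  assumes N: "openin S N"
  shows "openin S {x \<in> topspace S. sg x \<inter> N \<noteq> {}}"
proof (subst openin_subopen, rule ballI)
  fix x assume "x \<in> {x \<in> topspace S. sg x \<inter> N \<noteq> {}}"
  then have x: "x \<in> topspace S" and xN: "sg x \<inter> N \<noteq> {}" by auto
  obtain f s where f: "open_arc (fib_top (q x)) f" "f 0 = \<gamma> (q x)" "f s = x" "s \<ge> 0"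
    "sg x = f ` {0..s}" using sg_as_arc[OF x] .
  note fS = fib_arcD(1,2)[OF f(1)] and fc = fib_arcD(4)[OF f(1)]
  obtain u where u: "0 \<le> u" "u \<le> s" "f u \<in> N" using xN f(5) by auto
  define K where "K I = f ` I - N" for I
  have K: "compactin S (K I)" if "compact I" for I
  proof -
    have "K I = f ` I \<inter> (topspace S - N)" using fS by (auto simp: K_def)
    moreover have "compactin S (f ` I)" using image_compactin[OF _ fc] that by simp
    moreover have "closedin S (topspace S - N)" using N by blast
    ultimately show ?thesis by (simp add: compact_Int_closedin)
  qed
  have "disjnt (K {0..u}) (K {u..s})"
    using u(3) open_arcD(5)[OF f(1)] by (auto simp: K_def disjnt_iff)
  then obtain A B where AB: "openin S A" "openin S B" "K {0..u} \<subseteq> A" "K {u..s} \<subseteq> B" "disjnt A B"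
    using Hausdorff_space_compact_separation[OF Hausdorff K K] by (metis compact_Icc)
  define M where "M = {y \<in> topspace S. sg y \<subseteq> A \<union> B \<union> N} \<inter> {y \<in> topspace S. \<gamma> (q y) \<in> A \<union> N} \<inter> (B \<union> N)"
  have "openin S {y \<in> topspace S. sg y \<subseteq> A \<union> B \<union> N}" using AB N by (intro sg_upper) auto
  moreover have "openin S {y \<in> topspace S. \<gamma> (q y) \<in> A \<union> N}"
    using \<gamma>q_cont openin_Un[OF AB(1) N] unfolding continuous_map_def by blast
  ultimately have M: "openin S M" unfolding M_def using AB(2) N by blast
  moreover have "x \<in> M"
  proof -
    have "sg x \<subseteq> A \<union> B \<union> N"
    proof
      fix y assume "y \<in> sg x"
      then obtain r where "y = f r" "0 \<le> r" "r \<le> s" using f(5) by auto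
      then have "y \<in> N \<or> y \<in> K {0..u} \<or> y \<in> K {u..s}" by (cases "r \<le> u") (auto simp: K_def)
      then show "y \<in> A \<union> B \<union> N" using AB by blast
    qed
    moreover have "f 0 \<in> A \<union> N" "f s \<in> B \<union> N" using AB(3,4) u by (auto simp: K_def)
    ultimately show ?thesis using x f by (auto simp: M_def)
  qed
  moreover have "sg y \<inter> N \<noteq> {}" if "y \<in> M" for y
  proof
    assume e: "sg y \<inter> N = {}"
    have y: "y \<in> topspace S" using that by (simp add: M_def)
    note p = sg_props[OF y]
    have "sg y \<subseteq> A \<union> B" "\<gamma> (q y) \<in> A" "y \<in> B" using that e p(4,5) by (auto simp: M_def)
    moreover have "A \<inter> B \<inter> sg y = {}" using AB(5) by (auto simp: disjnt_iff)
    ultimately show False using p(2,4,5) AB(1,2) unfolding connectedin by blast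
  qed
  ultimately show "\<exists>T. openin S T \<and> x \<in> T \<and> T \<subseteq> {x \<in> topspace S. sg x \<inter> N \<noteq> {}}"
    by (intro exI[of _ M]) (auto simp: M_def)
qed

end

section \<open>Weighted series and a countable family of bump functions\<close>

lemma summable_geometric_times:
  fixes c :: "nat \<Rightarrow> real"
  assumes "\<And>i. 0 \<le> c i \<and> c i \<le> 1"
  shows "summable (\<lambda>i. (1/2)^i * c i)"
proof (rule summable_comparison_test)
  show "\<exists>N. \<forall>n\<ge>N. norm ((1/2)^n * c n) \<le> (1/2)^n"
    using assms by (auto simp: abs_mult intro!: mult_left_le)
  show "summable (\<lambda>i. (1/2::real)^i)" by (rule summable_geometric) simp
qed

lemma continuous_map_suminf_geometric:
  assumes g: "\<And>i. continuous_map S euclideanreal (g i)"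
    and b: "\<And>i x. x \<in> topspace S \<Longrightarrow> 0 \<le> g i x \<and> g i x \<le> 1"
  shows "continuous_map S euclideanreal (\<lambda>x. suminf (\<lambda>i. (1/2)^i * g i x))"
proof -
  have "uniform_limit (topspace S) (\<lambda>n x. \<Sum>i<n. (1/2)^i * g i x) (\<lambda>x. suminf (\<lambda>i. (1/2)^i * g i x)) sequentially"
  proof (rule Weierstrass_m_test)
    show "norm ((1/2)^n * g n x) \<le> (1/2)^n" if "x \<in> topspace S" for n x
      using b[OF that] by (auto simp: abs_mult intro!: mult_left_le)
    show "summable (\<lambda>i. (1/2::real)^i)" by (rule summable_geometric) simp
  qed
  then have lim: "\<forall>\<^sub>F n in sequentially. \<forall>x\<in>topspace S. suminf (\<lambda>i. (1/2)^i * g i x) \<in> UNIV \<and>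
      dist (\<Sum>i<n. (1/2)^i * g i x) (suminf (\<lambda>i. (1/2)^i * g i x)) < e" if "e > 0" for e
    using that by (auto dest: uniform_limitD)
  have cont: "continuous_map S Met_TC.mtopology (\<lambda>x. \<Sum>i<n. (1/2)^i * g i x)" for n
    unfolding mtopology_is_euclidean by (intro continuous_map_sum continuous_map_real_mult_left g) auto
  have "continuous_map S Met_TC.mtopology (\<lambda>x. suminf (\<lambda>i. (1/2)^i * g i x))"
  proof (rule Met_TC.continuous_map_uniform_limit[where F = sequentially])
    show "\<forall>\<^sub>F n in sequentially. continuous_map S Met_TC.mtopology (\<lambda>x. \<Sum>i<n. (1/2)^i * g i x)"
      by (intro always_eventually allI cont)
  qed (use lim in auto)
  then show ?thesis by simp
qed

text \<open>One function is chosen for each pair \<open>(B1, B')\<close> of basic open sets that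
  admits one: positive on \<open>B1\<close>, zero outside \<open>B'\<close>, with \<open>B'\<close>
  inside a compact set. There are countably many pairs, and complete regularity provides enough
  functions near every point.\<close>

lemma countable_bump_functions:
  fixes S :: "'a topology"
  assumes "Hausdorff_space S" "locally_compact_space S" "second_countable S"
  obtains g :: "nat \<Rightarrow> 'a \<Rightarrow> real" where
    "\<And>i. continuous_map S euclideanreal (g i)" "\<And>i x. x \<in> topspace S \<Longrightarrow> 0 \<le> g i x \<and> g i x \<le> 1"
    "\<And>i. \<exists>K. compactin S K \<and> (\<forall>x\<in>topspace S - K. g i x = 0)"
    "\<And>N x. openin S N \<Longrightarrow> x \<in> N \<Longrightarrow> \<exists>i. g i x > 0 \<and> (\<forall>y\<in>topspace S - N. g i y = 0)"
proof -
  have cr: "completely_regular_space S"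
    using assms locally_compact_Hausdorff_imp_regular_space
      locally_compact_regular_imp_completely_regular_space by blast
  obtain \<B> where B: "countable \<B>" "\<And>V. V \<in> \<B> \<Longrightarrow> openin S V"
    "\<And>U x. openin S U \<Longrightarrow> x \<in> U \<Longrightarrow> \<exists>V\<in>\<B>. x \<in> V \<and> V \<subseteq> U"
    using assms(3) unfolding second_countable_def by metis
  define bump where "bump p f \<longleftrightarrow> continuous_map S euclideanreal f \<and> (\<forall>x\<in>topspace S. 0 \<le> f x \<and> f x \<le> 1) \<and>
    (\<forall>x\<in>fst p. f x > 0) \<and> (\<forall>x\<in>topspace S - snd p. f x = 0) \<and> (\<exists>K. compactin S K \<and> snd p \<subseteq> K)" for p and f :: "'a \<Rightarrow> real"
  define G where "G p = (if \<exists>f. bump p f then SOME f. bump p f else (\<lambda>x. 0))" for p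
  have G: "bump p (G p) \<or> G p = (\<lambda>x. 0)" for p
    unfolding G_def using someI_ex[of "bump p"] by auto
  have G1: "bump p (G p)" if "bump p f" for p f
    using that unfolding G_def using someI_ex[of "bump p"] by auto
  \<comment> \<open>The empty pair keeps \<open>C\<close> nonempty, so that
    \<open>from_nat_into C\<close> enumerates it even when the base is empty.\<close>
  define C where "C = insert ({}, {}) (\<B> \<times> \<B>)"
  have C: "countable C" "C \<noteq> {}" unfolding C_def using B(1) by auto
  define g where "g i = G (from_nat_into C i)" for i
  show thesis
  proof (rule that[of g])
    fix i
    have Gi: "bump (from_nat_into C i) (g i) \<or> g i = (\<lambda>x. 0)" unfolding g_def by (rule G)
    then show "continuous_map S euclideanreal (g i)" by (auto simp: bump_def)
    show "0 \<le> g i x \<and> g i x \<le> 1" if "x \<in> topspace S" for x using Gi that by (auto simp: bump_def)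
    show "\<exists>K. compactin S K \<and> (\<forall>x\<in>topspace S - K. g i x = 0)"
      using Gi
    proof
      assume "bump (from_nat_into C i) (g i)"
      then show ?thesis unfolding bump_def by (meson Diff_iff subsetD)
    next
      assume "g i = (\<lambda>x. 0)"
      then show ?thesis by (intro exI[of _ "{}"]) auto
    qed
  next
    fix N x assume N: "openin S N" "x \<in> N"
    then have x: "x \<in> topspace S" using openin_subset by blast
    obtain U K where U: "openin S U" "compactin S K" "x \<in> U" "U \<subseteq> K"
      using assms(2) x unfolding locally_compact_space_def by blast
    obtain B' where B': "B' \<in> \<B>" "x \<in> B'" "B' \<subseteq> N \<inter> U"
      using B(3)[of "N \<inter> U" x] N U by blast
    have "closedin S (topspace S - B')" using B(2)[OF B'(1)] by blast
    moreover have "x \<in> topspace S - (topspace S - B')" using x B' by blast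
    ultimately obtain f where f: "continuous_map S (top_of_set {0..1::real}) f" "f x = 0" "f ` (topspace S - B') \<subseteq> {1}"
      using cr unfolding completely_regular_space_def by metis
    have f': "continuous_map S euclideanreal f" "\<And>y. y \<in> topspace S \<Longrightarrow> 0 \<le> f y \<and> f y \<le> 1"
      using f(1) by (auto simp: continuous_map_in_subtopology Pi_iff)
    \<comment> \<open>The separating function is 0 at \<open>x\<close> and 1 off \<open>B'\<close>,
      so the bump is \<open>1 - f\<close>; it is positive where \<open>f < 1\<close>, and
      \<open>B1\<close> is chosen inside that open set.\<close>
    have "openin S {y \<in> topspace S. f y \<in> {..<1}}"
      using f'(1) open_lessThan[of "1::real"] unfolding continuous_map_def by (metis open_openin)
    then obtain B1 where B1: "B1 \<in> \<B>" "x \<in> B1" "B1 \<subseteq> {y \<in> topspace S. f y \<in> {..<1}}"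
      using B(3) x f(2) by (metis (no_types, lifting) lessThan_iff mem_Collect_eq zero_less_one)
    have "continuous_map S euclideanreal (\<lambda>y. 1 - f y)" using f'(1) by (intro continuous_intros) auto
    moreover have "\<exists>K. compactin S K \<and> B' \<subseteq> K" using U(2,4) B'(3) by (intro exI[of _ K]) auto
    ultimately have "bump (B1, B') (\<lambda>y. 1 - f y)"
      unfolding bump_def using f'(2) f(3) B1(3) by auto
    then have b: "bump (B1, B') (G (B1, B'))" by (rule G1)
    have "(B1, B') \<in> C" using B1 B' by (auto simp: C_def)
    then obtain i where "from_nat_into C i = (B1, B')" using C by (metis from_nat_into_surj)
    then have "g i = G (B1, B')" by (simp add: g_def)
    then show "\<exists>i. g i x > 0 \<and> (\<forall>y\<in>topspace S - N. g i y = 0)"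
      using b B1(2) B'(3) unfolding bump_def by (intro exI[of _ i]) auto
  qed
qed

section \<open>A proper height function growing along half-leaves\<close>

context line_submersion
begin

definition sgmax :: "('a \<Rightarrow> real) \<Rightarrow> 'a \<Rightarrow> real" where
  "sgmax g x = Sup (g ` sg x)"

lemma sgmax_attained:
  assumes g: "continuous_map S euclideanreal g" and x: "x \<in> topspace S"
  obtains y where "y \<in> sg x" "sgmax g x = g y" "\<And>z. z \<in> sg x \<Longrightarrow> g z \<le> g y"
proof -
  have "compact (g ` sg x)" using image_compactin[OF sg_props(3)[OF x] g] by simp
  moreover have "g ` sg x \<noteq> {}" using sg_props(5)[OF x] by auto
  ultimately obtain y where y: "y \<in> sg x" "\<And>z. z \<in> sg x \<Longrightarrow> g z \<le> g y"
    using compact_attains_sup[of "g ` sg x"] by auto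
  then have "sgmax g x = g y" unfolding sgmax_def by (intro cSup_eq_maximum) auto
  then show thesis using that y by blast
qed

text \<open>The two semicontinuities of segments match the two of the function: the maximum exceeds
  \<open>a\<close> iff the segment meets an open set, and stays below \<open>a\<close> iff the
  segment lies in one. The second equivalence relies on the maximum being attained.\<close>

lemma sgmax_cont:
  assumes g: "continuous_map S euclideanreal g"
  shows "continuous_map S euclideanreal (sgmax g)"
  unfolding continuous_map_upper_lower_semicontinuous_lt
proof (intro conjI allI)
  fix a
  have "openin S {y \<in> topspace S. g y > a}" "openin S {y \<in> topspace S. g y < a}"
    using g unfolding continuous_map_upper_lower_semicontinuous_lt by blast+
  note * = sg_lower[OF this(1)] sg_upper[OF this(2)]
  have "(sg x \<inter> {y \<in> topspace S. g y > a} \<noteq> {} \<longleftrightarrow> sgmax g x > a) \<and>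
      (sg x \<subseteq> {y \<in> topspace S. g y < a} \<longleftrightarrow> sgmax g x < a)" if x: "x \<in> topspace S" for x
  proof -
    obtain y where "y \<in> sg x" "sgmax g x = g y" "\<And>z. z \<in> sg x \<Longrightarrow> g z \<le> g y"
      using sgmax_attained[OF g x] by metis
    then show ?thesis using sg_props(1)[OF x] by fastforce
  qed
  then show "openin S {x \<in> topspace S. sgmax g x > a}" "openin S {x \<in> topspace S. sgmax g x < a}"
    using * by (simp_all cong: conj_cong)
qed

lemma sgmax_mono:
  assumes g: "continuous_map S euclideanreal g" and y: "y \<in> topspace S" and x: "x \<in> sg y"
  shows "sgmax g x \<le> sgmax g y"
proof -
  have xS: "x \<in> topspace S" using sg_props(1)[OF y] x by auto
  have sub: "sg x \<subseteq> sg y" using sg_antisym(1)[OF y x] by blast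
  obtain u where "u \<in> sg x" "sgmax g x = g u" using sgmax_attained[OF g xS] by metis
  moreover obtain w where "sgmax g y = g w" "\<And>z. z \<in> sg y \<Longrightarrow> g z \<le> g w" using sgmax_attained[OF g y] by metis
  ultimately show ?thesis using sub by auto
qed

text \<open>Strictness: if \<open>x\<close> precedes \<open>y\<close>, the segment of
  \<open>x\<close> is closed and misses \<open>y\<close>, so some bump is positive at
  \<open>y\<close> and zero on that segment; its maximum jumps from 0 to a positive value.
  Properness: the weighted sum \<open>G\<close> of the bumps tends to 0 off compact sets, so
  \<open>1 / G\<close> is proper, and its maximum over a segment is at least its value at the
  end.\<close>

lemma exists_height:
  obtains H where "continuous_map S euclideanreal H"
    "\<And>x y. y \<in> topspace S \<Longrightarrow> x \<in> sg y \<Longrightarrow> x \<noteq> y \<Longrightarrow> H x < H y"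
    "\<And>c. \<exists>K. compactin S K \<and> {x \<in> topspace S. H x \<le> c} \<subseteq> K"
proof (rule countable_bump_functions[OF Hausdorff locally_compact second_countable])
  fix g :: "nat \<Rightarrow> 'a \<Rightarrow> real" assume g: "\<And>i. continuous_map S euclideanreal (g i)"
    and g01: "\<And>i x. x \<in> topspace S \<Longrightarrow> 0 \<le> g i x \<and> g i x \<le> 1"
    and gK: "\<And>i. \<exists>K. compactin S K \<and> (\<forall>x\<in>topspace S - K. g i x = 0)"
    and gN: "\<And>N x. openin S N \<Longrightarrow> x \<in> N \<Longrightarrow> \<exists>i. g i x > 0 \<and> (\<forall>y\<in>topspace S - N. g i y = 0)"
  define G where "G x = (suminf (\<lambda>i. (1/2)^i * g i x))" for x
  have G_cont: "continuous_map S euclideanreal G"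
    unfolding G_def by (rule continuous_map_suminf_geometric[OF g g01])
  have G_pos: "G x > 0" if x: "x \<in> topspace S" for x
  proof -
    obtain i where i: "g i x > 0" using gN[OF openin_topspace x] by blast
    show ?thesis unfolding G_def
      by (rule suminf_pos2[of _ i]) (use g01[OF x] i in \<open>auto intro!: summable_geometric_times\<close>)
  qed
  have P_cont: "continuous_map S euclideanreal (\<lambda>x. 1 / G x)"
    using G_cont G_pos by (intro continuous_map_real_divide) (auto simp: less_imp_neq[symmetric] dest: less_imp_neq)
  have m01: "0 \<le> sgmax (g i) x \<and> sgmax (g i) x \<le> 1" if x: "x \<in> topspace S" for i x
  proof -
    obtain u where "u \<in> sg x" "sgmax (g i) x = g i u" using sgmax_attained[OF g x] by metis
    then show ?thesis using g01[of u i] sg_props(1)[OF x] by auto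
  qed
  define H where "H x = (suminf (\<lambda>i. (1/2)^i * sgmax (g i) x)) + sgmax (\<lambda>x. 1 / G x) x" for x
  show thesis
  proof (rule that[of H])
    show "continuous_map S euclideanreal H"
      unfolding H_def
      by (intro continuous_map_add continuous_map_suminf_geometric sgmax_cont g m01 P_cont) auto
    fix x y assume y: "y \<in> topspace S" and x: "x \<in> sg y" "x \<noteq> y"
    have xS: "x \<in> topspace S" using sg_props(1)[OF y] x by auto
    have ynx: "y \<notin> sg x" using sg_antisym(2)[OF y x] .
    have "closedin S (sg x)" by (rule compactin_imp_closedin[OF Hausdorff sg_props(3)[OF xS]])
    then have "openin S (topspace S - sg x)" by blast
    then obtain i where i: "g i y > 0" "\<forall>z\<in>topspace S - (topspace S - sg x). g i z = 0"
      using gN[of "topspace S - sg x" y] y ynx by blast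
    have "(suminf (\<lambda>i. (1/2)^i * sgmax (g i) x)) < (suminf (\<lambda>i. (1/2)^i * sgmax (g i) y))"
    proof -
      have sm: "summable (\<lambda>i. (1/2)^i * sgmax (g i) z)" if "z \<in> topspace S" for z
        by (rule summable_geometric_times) (rule m01[OF that])
      obtain u where u: "u \<in> sg x" "sgmax (g i) x = g i u" using sgmax_attained[OF g xS] by metis
      then have "sgmax (g i) x = 0" using i(2) sg_props(1)[OF xS] by auto
      moreover have "sgmax (g i) y > 0"
      proof -
        obtain w where "sgmax (g i) y = g i w" "\<And>z. z \<in> sg y \<Longrightarrow> g i z \<le> g i w"
          using sgmax_attained[OF g y] by metis
        then show ?thesis using i(1) sg_props(5)[OF y] by force
      qed
      ultimately have "0 < (suminf (\<lambda>i. (1/2)^i * sgmax (g i) y - (1/2)^i * sgmax (g i) x))"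
        using sgmax_mono[OF g y x(1)]
        by (intro suminf_pos2[of _ i] summable_diff sm y xS) (auto simp: mult_left_mono)
      then show ?thesis using suminf_diff[OF sm[OF y] sm[OF xS]] by simp
    qed
    then show "H x < H y" unfolding H_def using sgmax_mono[OF P_cont y x(1)] by linarith
  next
    fix c :: real
    obtain K where K: "\<And>i. compactin S (K i)" "\<And>i x. x \<in> topspace S - K i \<Longrightarrow> g i x = 0" using gK by metis
    \<comment> \<open>The maximum with 1 makes \<open>c'\<close> positive. Off the first
      \<open>n\<close> compact sets only the tail of \<open>G\<close> survives, at most
      \<open>2 * (1/2)^n < 1 / c'\<close>, which forces the height above \<open>c'\<close>.\<close>
    define c' where "c' = max c 1"
    obtain n where n: "(1/2::real)^n < 1 / (2 * c')"
      using real_arch_pow_inv[of "1 / (2 * c')" "1/2"] by (auto simp: c'_def)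
    have "compactin S (\<Union>i<n. K i)" by (rule compactin_Union) (use K in auto)
    moreover have "x \<in> (\<Union>i<n. K i)" if x: "x \<in> topspace S" "H x \<le> c" for x
    proof (rule ccontr)
      assume "x \<notin> (\<Union>i<n. K i)"
      then have z: "g i x = 0" if "i < n" for i using that K(2) x(1) by blast
      have sm: "summable (\<lambda>i. (1/2)^i * g i x)" by (rule summable_geometric_times) (rule g01[OF x(1)])
      have "G x = (suminf (\<lambda>i. (1/2)^(i+n) * g (i+n) x))"
        unfolding G_def using suminf_split_initial_segment[OF sm, of n] z by simp
      also have "\<dots> \<le> (suminf (\<lambda>i. (1/2)^n * (1/2::real)^i))"
      proof (rule suminf_le)
        show "summable (\<lambda>i. (1/2)^(i+n) * g (i+n) x)" using summable_iff_shift[of "\<lambda>i. (1/2)^i * g i x" n] sm by simp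
        show "summable (\<lambda>i. (1/2)^n * (1/2::real)^i)" by (intro summable_mult summable_geometric) simp
        show "(1/2)^(i+n) * g (i+n) x \<le> (1/2)^n * (1/2)^i" for i
          using g01[OF x(1), of "i+n"] by (auto simp: power_add mult.commute intro!: mult_left_le)
      qed
      also have "\<dots> = (1/2)^n * 2"
        by (subst suminf_mult) (auto simp: suminf_geometric intro: summable_geometric)
      also have "\<dots> < 1 / c'" using n by (simp add: field_simps)
      finally have "G x < 1 / c'" .
      moreover have "c' > 0" by (simp add: c'_def)
      ultimately have "c' < 1 / G x" using G_pos[OF x(1)] by (simp add: field_simps)
      also have "\<dots> \<le> sgmax (\<lambda>x. 1 / G x) x"
        using sgmax_attained[OF P_cont x(1)] sg_props(5)[OF x(1)] by metis
      also have "\<dots> \<le> H x"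
        unfolding H_def using m01[OF x(1)]
        by (simp add: suminf_nonneg[OF summable_geometric_times])
      finally show False using x(2) by (simp add: c'_def)
    qed
    ultimately show "\<exists>K. compactin S K \<and> {x \<in> topspace S. H x \<le> c} \<subseteq> K" by blast
  qed
qed

text \<open>Separation is borrowed from \<open>S\<close> through the section: the fibre is the
  preimage of the closed point \<open>\<gamma> v\<close> under
  \<open>\<gamma> \<circ> q\<close>.\<close>

lemma fib_closed:
  assumes v: "v \<in> topspace V"
  shows "closedin S (fib v)"
proof -
  have "closedin S {\<gamma> v}"
    by (intro compactin_imp_closedin[OF Hausdorff]) (simp add: \<gamma>_props(1)[OF v])
  then have "closedin S {x \<in> topspace S. \<gamma> (q x) \<in> {\<gamma> v}}"
    using \<gamma>q_cont by (auto simp: continuous_map_closedin)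
  moreover have "{x \<in> topspace S. \<gamma> (q x) \<in> {\<gamma> v}} = fib v"
    using \<gamma>_props(2)[OF v] \<gamma>_props(2)[OF q_in] by (auto, metis)
  ultimately show ?thesis by simp
qed

section \<open>Continuous functions that are injective on every fibre\<close>

context
  fixes F :: "'a \<Rightarrow> real"
  assumes F_cont: "continuous_map S euclideanreal F"
    and F_inj: "\<And>x y. x \<in> topspace S \<Longrightarrow> y \<in> topspace S \<Longrightarrow> q x = q y \<Longrightarrow> F x = F y \<Longrightarrow> x = y"
begin

lemma fibre_function_plaque:
  assumes \<psi>: "fibre_chart S V q B \<psi>" "v \<in> B"
  shows "continuous_on UNIV (\<lambda>t. F (\<psi> (t, v)))" "inj (\<lambda>t. F (\<psi> (t, v)))"
proof -
  have "continuous_map euclideanreal euclideanreal (F \<circ> (\<lambda>t. \<psi> (t, v)))"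
    using fibre_chart_line[OF \<psi>] F_cont by (rule continuous_map_compose)
  then show "continuous_on UNIV (\<lambda>t. F (\<psi> (t, v)))" by (simp add: o_def)
  show "inj (\<lambda>t. F (\<psi> (t, v)))"
  proof (rule injI)
    fix s t assume "F (\<psi> (s, v)) = F (\<psi> (t, v))"
    then have "\<psi> (s, v) = \<psi> (t, v)"
      using fibre_chartD(3,4)[OF \<psi>(1,2)] by (intro F_inj) auto
    then show "s = t" using fibre_chartD(6)[OF \<psi>(1,2)] by blast
  qed
qed

text \<open>On a plaque interval \<open>F\<close> is strictly monotone, but the direction is unknown
  because general charts are not oriented. So \<open>a\<close> and \<open>b\<close> are the two ends
  in whichever order fits.\<close>

lemma fibre_function_between:
  assumes \<psi>: "fibre_chart S V q B \<psi>" "v \<in> B" and d: "d > 0"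
  shows "\<exists>a b. a \<in> {t - d..t + d} \<and> b \<in> {t - d..t + d} \<and>
    F (\<psi> (a, v)) < F (\<psi> (t, v)) \<and> F (\<psi> (t, v)) < F (\<psi> (b, v))"
proof -
  have "(F (\<psi> (t - d, v)) < F (\<psi> (t, v)) \<and> F (\<psi> (t, v)) < F (\<psi> (t + d, v))) \<or>
    (F (\<psi> (t + d, v)) < F (\<psi> (t, v)) \<and> F (\<psi> (t, v)) < F (\<psi> (t - d, v)))"
    using d continuous_on_subset[OF fibre_function_plaque(1)[OF \<psi>]] inj_on_subset[OF fibre_function_plaque(2)[OF \<psi>]]
    by (intro continuous_inj_imp_mono) auto
  moreover have "t - d \<in> {t - d..t + d}" "t + d \<in> {t - d..t + d}" using d by auto
  ultimately show ?thesis by blast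
qed

lemma fibre_function_no_max:
  assumes x: "x \<in> topspace S"
  shows "\<exists>y \<in> fib (q x). F y > F x"
proof -
  obtain B \<psi> t v where \<psi>: "fibre_chart S V q B \<psi>" "v \<in> B" "x = \<psi> (t, v)" using charts[OF x] by fastforce
  have "\<psi> (u, v) \<in> fib (q x)" for u using fibre_chartD(3,4)[OF \<psi>(1,2)] \<psi>(3) by simp
  then show ?thesis using fibre_function_between[OF \<psi>(1,2), of 1 t] \<psi>(3) by (meson zero_less_one)
qed

text \<open>Under a bound, the part of the fibre where \<open>F\<close> is nonnegative would be a
  closed subset of a compact set, and \<open>F\<close> would attain a maximum there. Yet
  \<open>F\<close> can always be increased by moving along a plaque.\<close>

lemma fibre_function_unbounded:
  assumes proper: "\<And>c. \<exists>K. compactin S K \<and> {x \<in> fib v. 0 \<le> F x \<and> F x \<le> c} \<subseteq> K"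
    and x0: "x0 \<in> fib v" "F x0 \<ge> 0"
  shows "\<exists>x\<in>fib v. F x > c"
proof (rule ccontr)
  assume "\<not> (\<exists>x\<in>fib v. F x > c)"
  then have b: "F x \<le> c" if "x \<in> fib v" for x using that by force
  define A where "A = fib v \<inter> {x \<in> topspace S. F x \<ge> 0}"
  obtain K where K: "compactin S K" "{x \<in> fib v. 0 \<le> F x \<and> F x \<le> c} \<subseteq> K" using proper by blast
  have "closedin S {x \<in> topspace S. F x \<ge> 0}"
    using F_cont unfolding continuous_map_upper_lower_semicontinuous_le by blast
  moreover have "closedin S (fib v)" using x0(1) q_in by (intro fib_closed) auto
  ultimately have "closedin S A" unfolding A_def by (rule closedin_Int[rotated])
  moreover have "A \<subseteq> K" using b K(2) by (auto simp: A_def)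
  ultimately have "compactin S A" using closed_compactin[OF K(1)] by blast
  then have "compact (F ` A)" using image_compactin[OF _ F_cont] by simp
  moreover have "x0 \<in> A" using x0 by (simp add: A_def)
  ultimately obtain x where x: "x \<in> A" "\<And>y. y \<in> A \<Longrightarrow> F y \<le> F x"
    using compact_attains_sup[of "F ` A"] by auto
  then have xS: "x \<in> topspace S" "q x = v" by (auto simp: A_def)
  obtain y where "y \<in> fib v" "F y > F x" using fibre_function_no_max[OF xS(1)] xS(2) by auto
  moreover from this have "y \<in> A" using x(1) by (auto simp: A_def)
  ultimately show False using x(2) by force
qed

text \<open>Surjectivity is the intermediate value theorem on each connected fibre. For openness,
  strict inequalities at the two ends of a short plaque persist on neighboring plaques, where the
  intermediate value theorem again yields all values near \<open>F x\<close>.\<close>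

lemma fibre_function_homeomorphic:
  assumes unbounded: "\<And>v c. v \<in> topspace V \<Longrightarrow> \<exists>x\<in>fib v. F x > c" "\<And>v c. v \<in> topspace V \<Longrightarrow> \<exists>x\<in>fib v. F x < - c"
  shows "homeomorphic_map S (prod_topology euclideanreal V) (\<lambda>x. (F x, q x))"
proof (rule bijective_open_imp_homeomorphic_map)
  show "continuous_map S (prod_topology euclideanreal V) (\<lambda>x. (F x, q x))"
    using F_cont q_cont by (simp add: continuous_map_pairwise o_def)
  show "inj_on (\<lambda>x. (F x, q x)) (topspace S)"
    using F_inj by (auto simp: inj_on_def)
  show "(\<lambda>x. (F x, q x)) ` topspace S = topspace (prod_topology euclideanreal V)"
  proof
    show "(\<lambda>x. (F x, q x)) ` topspace S \<subseteq> topspace (prod_topology euclideanreal V)"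
      using q_in by auto
    show "topspace (prod_topology euclideanreal V) \<subseteq> (\<lambda>x. (F x, q x)) ` topspace S"
    proof (clarsimp)
      fix c v assume v: "v \<in> topspace V"
      obtain x y where xy: "x \<in> fib v" "F x > c" "y \<in> fib v" "F y < c"
        using unbounded(1)[OF v, of c] unbounded(2)[OF v, of "- c"] by auto
      have "connectedin S (fib v)" using fibre_connected[OF v] by (simp add: fib_def)
      then have "connected (F ` fib v)" using connectedin_continuous_map_image[OF F_cont] by simp
      then have "c \<in> F ` fib v"
        using connectedD_interval[of "F ` fib v" "F y" "F x" c] xy by auto
      then show "(c, v) \<in> (\<lambda>x. (F x, q x)) ` topspace S" by (auto simp: image_iff)
    qed
  qed
  show "open_map S (prod_topology euclideanreal V) (\<lambda>x. (F x, q x))"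
    unfolding open_map_def openin_prod_topology_alt
  proof (intro allI impI)
    fix U c w assume U: "openin S U" and "(c, w) \<in> (\<lambda>x. (F x, q x)) ` U"
    then obtain x where x: "x \<in> U" "c = F x" "w = q x" by auto
    then have "x \<in> topspace S" using openin_subset[OF U] by blast
    then obtain B \<psi> t v where \<psi>: "fibre_chart S V q B \<psi>" "v \<in> B" "x = \<psi> (t, v)" using charts by fastforce
    have v: "v = w" using fibre_chartD(3)[OF \<psi>(1,2)] \<psi>(3) x(3) by simp
    obtain d C where C: "d > 0" "openin V C" "v \<in> C" "C \<subseteq> B" "\<And>s u. \<bar>s - t\<bar> \<le> d \<Longrightarrow> u \<in> C \<Longrightarrow> \<psi> (s, u) \<in> U"
      using fibre_chart_box[OF \<psi>(1) U] x \<psi> by metis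
    obtain a b where ab: "a \<in> {t - d..t + d}" "b \<in> {t - d..t + d}" "F (\<psi> (a, v)) < F x" "F x < F (\<psi> (b, v))"
      using fibre_function_between[OF \<psi>(1,2) C(1), of t] \<psi>(3) by metis
    \<comment> \<open>Midpoints leave room on both sides: the interval from \<open>c1\<close> to
      \<open>c2\<close> contains \<open>F x\<close>, while the end values on nearby plaques stay
      outside it.\<close>
    define c1 where "c1 = (F (\<psi> (a, v)) + F x) / 2"
    define c2 where "c2 = (F (\<psi> (b, v)) + F x) / 2"
    have c12: "F (\<psi> (a, v)) < c1" "c1 < F x" "F x < c2" "c2 < F (\<psi> (b, v))"
      using ab by (auto simp: c1_def c2_def)
    have slice: "continuous_map (subtopology V C) euclideanreal (\<lambda>u. F (\<psi> (r, u)))" for r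
    proof -
      have "continuous_map (subtopology V B) euclideanreal (\<lambda>u. F (\<psi> (r, u)))"
        using continuous_map_compose[OF fibre_chart_slice[OF \<psi>(1)] F_cont] by (simp add: o_def)
      then show ?thesis using C(4) by (rule continuous_map_from_subtopology_mono)
    qed
    define E where "E = {u \<in> topspace (subtopology V C). F (\<psi> (a, u)) < c1} \<inter> {u \<in> topspace (subtopology V C). F (\<psi> (b, u)) > c2}"
    have "openin (subtopology V C) E"
      using slice unfolding E_def continuous_map_upper_lower_semicontinuous_lt by (intro openin_Int) blast+
    then have "openin V E" using C(2) by (rule openin_trans_full)
    moreover have "v \<in> E" using c12 C(3) openin_subset[OF C(2)] by (auto simp: E_def)
    moreover have "{c1<..<c2} \<times> E \<subseteq> (\<lambda>x. (F x, q x)) ` U"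
    proof clarify
      fix r u assume r: "r \<in> {c1<..<c2}" and u: "u \<in> E"
      then have uC: "u \<in> C" "F (\<psi> (a, u)) < c1" "F (\<psi> (b, u)) > c2" by (auto simp: E_def)
      then have uB: "u \<in> B" using C(4) by blast
      have "connected ((\<lambda>t. F (\<psi> (t, u))) ` {t - d..t + d})"
        by (intro connected_continuous_image continuous_on_subset[OF fibre_function_plaque(1)[OF \<psi>(1) uB]]) auto
      then have "r \<in> (\<lambda>t. F (\<psi> (t, u))) ` {t - d..t + d}"
        using connectedD_interval[of "(\<lambda>t. F (\<psi> (t, u))) ` {t - d..t + d}" "F (\<psi> (a, u))" "F (\<psi> (b, u))" r]
          ab(1,2) uC r by auto
      then obtain p where p: "p \<in> {t - d..t + d}" "r = F (\<psi> (p, u))" by auto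
      then have "\<psi> (p, u) \<in> U" using C(5)[of p u] uC by auto
      moreover have "q (\<psi> (p, u)) = u" using fibre_chartD(3)[OF \<psi>(1) uB] .
      ultimately show "(r, u) \<in> (\<lambda>x. (F x, q x)) ` U" using p by (auto simp: image_iff)
    qed
    ultimately show "\<exists>A E. openin euclideanreal A \<and> openin V E \<and> c \<in> A \<and> w \<in> E \<and> A \<times> E \<subseteq> (\<lambda>x. (F x, q x)) ` U"
      using c12 x(2) v by (intro exI[of _ "{c1<..<c2}"] exI[of _ E]) auto
  qed
qed

end

text \<open>The coordinate is the height above the slice, with the sign of the side on which the
  point lies. \<open>P\<close> and \<open>N\<close> are the two open sides; what remains of
  \<open>S\<close> is the slice itself, where \<open>D\<close> vanishes, so the sign change is
  continuous.\<close>

lemma height_imp_trivial: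
  assumes H: "continuous_map S euclideanreal H"
    and mono: "\<And>x y. y \<in> topspace S \<Longrightarrow> x \<in> sg y \<Longrightarrow> x \<noteq> y \<Longrightarrow> H x < H y"
    and proper: "\<And>c. \<exists>K. compactin S K \<and> {x \<in> topspace S. H x \<le> c} \<subseteq> K"
  obtains F :: "'a \<Rightarrow> real" where "homeomorphic_map S (prod_topology euclideanreal V) (\<lambda>x. (F x, q x))"
proof -
  define P where "P = {x \<in> topspace S. sg x \<inter> \<psi>0 ` ({0<..} \<times> topspace V) \<noteq> {}}"
  define N where "N = {x \<in> topspace S. sg x \<inter> \<psi>0 ` ({..<0} \<times> topspace V) \<noteq> {}}"
  have PN_open: "openin S P" "openin S N"
    using fibre_chart_image[OF chart0, of _ "topspace V"] unfolding P_def N_def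
    by (intro sg_lower; simp)+
  define D where "D x = H x - H (\<gamma> (q x))" for x
  define F where "F x = (if x \<in> P then D x else - D x)" for x
  have D_cont: "continuous_map S euclideanreal D"
    unfolding D_def using continuous_map_compose[OF \<gamma>q_cont H] H
    by (intro continuous_map_diff) (simp_all add: o_def)
  have D_nonneg: "D x \<ge> 0" if x: "x \<in> topspace S" for x
    using mono[OF x sg_props(4)[OF x]] unfolding D_def by fastforce
  \<comment> \<open>On an arc oriented like \<open>\<psi>0\<close> and based at the slice, the side
    is the sign of the parameter. The segment conditions in \<open>P\<close> and \<open>N\<close>
    are translated to the single fibre here.\<close>
  have side: "(f s \<in> P \<longleftrightarrow> s > 0) \<and> (f s \<in> N \<longleftrightarrow> s < 0)"
    if f: "open_arc (fib_top v) f" "f 0 = \<gamma> v" and h: "strict_mono (h :: real \<Rightarrow> real)" "continuous_on UNIV h" "h 0 = 0"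
      and p: "\<And>t. \<psi>0 (t, v) = f (h t)" for f h v s
  proof -
    note fs = fib_arcD(1,2)[OF f(1)] and v = fib_arcD(3)[OF f(1)]
    interpret L: open_line "fib_top v" by (rule fib_line[OF v])
    have eq: "sg (f s) \<inter> \<psi>0 ` (A \<times> topspace V) = L.seg (\<psi>0 (0, v)) (f s) \<inter> (\<lambda>t. \<psi>0 (t, v)) ` A" for A
    proof -
      have "sg (f s) \<subseteq> fib v" using sg_props(1)[OF fs(1), of s] fs(2) by simp
      moreover have "fib v \<inter> \<psi>0 ` (A \<times> topspace V) = (\<lambda>t. \<psi>0 (t, v)) ` A"
        using fibre_chartD(3,4)[OF chart0] v by (auto simp: image_iff intro!: bexI)
      moreover have "sg (f s) = L.seg (\<psi>0 (0, v)) (f s)" by (simp add: sg_def fs \<gamma>_def)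
      ultimately show ?thesis by blast
    qed
    have f0: "f 0 = \<psi>0 (0, v)" using f(2) by (simp add: \<gamma>_def)
    have *: "L.seg (\<psi>0 (0, v)) (f s) \<inter> (\<lambda>t. \<psi>0 (t, v)) ` {0<..} \<noteq> {} \<longleftrightarrow> s > 0"
      "L.seg (\<psi>0 (0, v)) (f s) \<inter> (\<lambda>t. \<psi>0 (t, v)) ` {..<0} \<noteq> {} \<longleftrightarrow> s < 0"
      using L.positive_side_iff[of f "\<lambda>t. \<psi>0 (t, v)" h s, OF f(1) f0 h p]
        L.negative_side_iff[of f "\<lambda>t. \<psi>0 (t, v)" h s, OF f(1) f0 h p] by simp_all
    show ?thesis unfolding P_def N_def mem_Collect_eq eq using * fs(1) by simp
  qed
  \<comment> \<open>Along such an arc the height falls towards the slice and rises after it.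
    Negating it before the slice makes \<open>F\<close> increasing throughout.\<close>
  have F_arc: "F (f s) < F (f t)"
    if f: "open_arc (fib_top v) f" "f 0 = \<gamma> v" and h: "strict_mono (h :: real \<Rightarrow> real)" "continuous_on UNIV h" "h 0 = 0"
      and p: "\<And>t. \<psi>0 (t, v) = f (h t)" and st: "s < t" for f h v s t
  proof -
    note fs = fib_arcD(1,2)[OF f(1)]
    have fi: "f a = f b \<longleftrightarrow> a = b" for a b by (rule open_arcD(5)[OF f(1)])
    have g: "\<gamma> v = f 0" using f(2) by simp
    have val: "F (f u) = (if u > 0 then H (f u) - H (f 0) else H (f 0) - H (f u))" for u
      using side[OF f h p, of u] by (simp add: F_def D_def fs g)
    have up: "H (f a) < H (f b)" if ab: "0 \<le> a" "a < b" for a b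
    proof (rule mono[OF fs(1)])
      have "sg (f b) = f ` {0..b}" by (rule sg_arc(1)[OF f]) (use ab in simp)
      then show "f a \<in> sg (f b)" using ab by simp
      show "f a \<noteq> f b" using ab fi by simp
    qed
    have dn: "H (f b) < H (f a)" if ab: "b \<le> 0" "a < b" for a b
    proof (rule mono[OF fs(1)])
      have "sg (f a) = f ` {a..0}" by (rule sg_arc(2)[OF f]) (use ab in simp)
      then show "f b \<in> sg (f a)" using ab by simp
      show "f b \<noteq> f a" using ab fi by simp
    qed
    consider "s > 0" | "s \<le> 0" "t > 0" | "t \<le> 0" by linarith
    then show ?thesis
    proof cases
      case 1 then show ?thesis using up[of s t] st by (simp add: val)
    next
      case 2
      have "H (f 0) < H (f t)" using up[of 0 t] 2 by simp
      moreover have "H (f 0) \<le> H (f s)" using dn[of 0 s] 2 by (cases "s = 0") auto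
      ultimately show ?thesis using 2 by (simp add: val)
    next
      case 3 then show ?thesis using dn[of t s] st by (simp add: val)
    qed
  qed
  have cover: "x \<in> P \<or> x \<in> N \<or> D x = 0" and not_both: "\<not> (x \<in> P \<and> x \<in> N)" if x: "x \<in> topspace S" for x
  proof -
    have "x \<in> fib (q x)" using x by simp
    then obtain f s and h :: "real \<Rightarrow> real" where f: "open_arc (fib_top (q x)) f" "f 0 = \<gamma> (q x)" "f s = x"
      "strict_mono h" "continuous_on UNIV h" "h 0 = 0" "\<And>t. \<psi>0 (t, q x) = f (h t)"
      using fibre_arc[OF x] by metis
    have "(x \<in> P \<longleftrightarrow> s > 0) \<and> (x \<in> N \<longleftrightarrow> s < 0)" using side[OF f(1,2,4-7), of s] f(3) by simp
    moreover have "s = 0 \<Longrightarrow> D x = 0" using f(2,3) by (auto simp: D_def)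
    ultimately show "x \<in> P \<or> x \<in> N \<or> D x = 0" "\<not> (x \<in> P \<and> x \<in> N)" by auto
  qed
  have F_cont: "continuous_map S euclideanreal F"
    unfolding continuous_map_upper_lower_semicontinuous_lt
  proof (intro conjI allI)
    fix a :: real
    have op: "openin S {x \<in> topspace S. D x > b}" "openin S {x \<in> topspace S. D x < b}" for b
      using D_cont unfolding continuous_map_upper_lower_semicontinuous_lt by blast+
    have PS: "P \<subseteq> topspace S" "N \<subseteq> topspace S" by (auto simp: P_def N_def)
    \<comment> \<open>\<open>F > a\<close> becomes a condition on \<open>D\<close> and on one open
      side: an intersection with \<open>P\<close> for \<open>a \<ge> 0\<close>, a union with
      \<open>P\<close> for negative \<open>a\<close>.\<close>
    show "openin S {x \<in> topspace S. F x > a}"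
    proof (cases "a \<ge> 0")
      case True
      have "F x > a \<longleftrightarrow> x \<in> P \<and> D x > a" if "x \<in> topspace S" for x
        using D_nonneg[OF that] True by (auto simp: F_def)
      then have "{x \<in> topspace S. F x > a} = P \<inter> {x \<in> topspace S. D x > a}" using PS by auto
      then show ?thesis using op PN_open by (simp add: openin_Int)
    next
      case False
      have "F x > a \<longleftrightarrow> x \<in> P \<or> D x < - a" if "x \<in> topspace S" for x
        using D_nonneg[OF that] False by (auto simp: F_def)
      then have "{x \<in> topspace S. F x > a} = P \<union> {x \<in> topspace S. D x < - a}" using PS by auto
      then show ?thesis using op PN_open by (simp add: openin_Un)
    qed
    show "openin S {x \<in> topspace S. F x < a}"
    proof (cases "a \<le> 0")
      case True
      have "F x < a \<longleftrightarrow> x \<in> N \<and> D x > - a" if "x \<in> topspace S" for x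
        using D_nonneg[OF that] cover[OF that] not_both[OF that] True by (auto simp: F_def)
      then have "{x \<in> topspace S. F x < a} = N \<inter> {x \<in> topspace S. D x > - a}" using PS by auto
      then show ?thesis using op PN_open by (simp add: openin_Int)
    next
      case False
      have "F x < a \<longleftrightarrow> x \<in> N \<or> D x < a" if "x \<in> topspace S" for x
        using D_nonneg[OF that] cover[OF that] not_both[OF that] False by (auto simp: F_def)
      then have "{x \<in> topspace S. F x < a} = N \<union> {x \<in> topspace S. D x < a}" using PS by auto
      then show ?thesis using op PN_open by (simp add: openin_Un)
    qed
  qed
  have F_inj: "x = y" if xy: "x \<in> topspace S" "y \<in> topspace S" "q x = q y" "F x = F y" for x y
  proof -
    have "y \<in> fib (q x)" using xy by simp
    then obtain f s t and h :: "real \<Rightarrow> real" where f: "open_arc (fib_top (q x)) f" "f 0 = \<gamma> (q x)" "f s = x" "f t = y"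
      "strict_mono h" "continuous_on UNIV h" "h 0 = 0" "\<And>t. \<psi>0 (t, q x) = f (h t)"
      using fibre_arc[OF xy(1)] by metis
    have "F (f a) < F (f b)" if "a < b" for a b using F_arc[OF f(1,2,5-8) that] .
    then have "s = t" using f(3,4) xy(4) by (metis less_irrefl linorder_neq_iff)
    then show ?thesis using f by simp
  qed
  have F_abs: "\<bar>F x\<bar> = D x" if "x \<in> topspace S" for x
    using D_nonneg[OF that] by (simp add: F_def)
  \<comment> \<open>Both ends of the line are treated at once by taking \<open>G\<close> to be
    \<open>F\<close> or its negative. On a fibre, \<open>0 \<le> G x \<le> c\<close> bounds the
    height by \<open>c + H (\<gamma> v)\<close>, so properness of \<open>H\<close> applies.\<close>
  have "\<exists>x\<in>fib v. G x > c" if G: "G = F \<or> G = (\<lambda>x. - F x)" and v: "v \<in> topspace V" for G v c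
  proof (rule fibre_function_unbounded)
    show "continuous_map S euclideanreal G" using G F_cont continuous_map_minus[OF F_cont] by blast
    show "x = y" if "x \<in> topspace S" "y \<in> topspace S" "q x = q y" "G x = G y" for x y
      using F_inj that G by auto
    show "\<gamma> v \<in> fib v" "G (\<gamma> v) \<ge> 0" using \<gamma>_props[OF v] G by (auto simp: F_def D_def)
    fix c
    obtain K where K: "compactin S K" "{x \<in> topspace S. H x \<le> c + H (\<gamma> v)} \<subseteq> K" using proper by blast
    have "H x \<le> c + H (\<gamma> v)" if "x \<in> fib v" "0 \<le> G x" "G x \<le> c" for x
      using F_abs[of x] that G by (auto simp: D_def)
    then show "\<exists>K. compactin S K \<and> {x \<in> fib v. 0 \<le> G x \<and> G x \<le> c} \<subseteq> K"
      using K by (intro exI[of _ K]) auto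
  qed
  note unb = this[of F] this[of "\<lambda>x. - F x"]
  have "\<exists>x\<in>fib v. F x > c" "\<exists>x\<in>fib v. F x < - c" if "v \<in> topspace V" for v c
    using unb(1)[OF _ that, of c] unb(2)[OF _ that, of c] by (auto intro: bexI[rotated])
  then show thesis by (intro that[of F] fibre_function_homeomorphic F_cont F_inj) auto
qed

theorem trivialization:
  obtains F :: "'a \<Rightarrow> real" where "homeomorphic_map S (prod_topology euclideanreal V) (\<lambda>x. (F x, q x))"
proof (rule exists_height)
  fix H :: "'a \<Rightarrow> real"
  assume H: "continuous_map S euclideanreal H"
    "\<And>x y. y \<in> topspace S \<Longrightarrow> x \<in> sg y \<Longrightarrow> x \<noteq> y \<Longrightarrow> H x < H y"
    "\<And>c. \<exists>K. compactin S K \<and> {x \<in> topspace S. H x \<le> c} \<subseteq> K"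
  show thesis by (rule height_imp_trivial[OF H that])
qed

end

section \<open>Invariance of domain for half-spaces\<close>

lemma continuous_map_into_Euclidean_space:
  "continuous_map X (Euclidean_space n) f \<longleftrightarrow>
     (\<forall>i. continuous_map X euclideanreal (\<lambda>x. f x i)) \<and> (\<forall>x\<in>topspace X. \<forall>i\<ge>n. f x i = 0)"
  by (auto simp: Euclidean_space_def continuous_map_in_subtopology continuous_map_componentwise_UNIV Pi_iff)

lemma continuous_map_Euclidean_space_coord:
  "continuous_map (Euclidean_space n) euclideanreal (\<lambda>x. x i)"
  using continuous_map_into_Euclidean_space[of "Euclidean_space n" n "\<lambda>x. x"] continuous_map_id[of "Euclidean_space n"]
  by (simp add: id_def)

lemma openin_half_space_positive:
  assumes "openin (half_space n) B"
  shows "openin (Euclidean_space n) {x \<in> B. 0 < x (n - 1)}"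
proof -
  obtain U where U: "openin (Euclidean_space n) U" "B = U \<inter> {x. 0 \<le> x (n - 1)}"
    using assms by (auto simp: half_space_def openin_subtopology)
  have "openin (Euclidean_space n) {x \<in> topspace (Euclidean_space n). x (n - 1) > 0}"
    using continuous_map_Euclidean_space_coord[of n "n - 1"]
    unfolding continuous_map_upper_lower_semicontinuous_lt by blast
  then have "openin (Euclidean_space n) (U \<inter> {x \<in> topspace (Euclidean_space n). x (n - 1) > 0})"
    using U(1) by (rule openin_Int[rotated])
  moreover have "{x \<in> B. 0 < x (n - 1)} = U \<inter> {x \<in> topspace (Euclidean_space n). x (n - 1) > 0}"
    using U openin_subset[OF U(1)] by auto
  ultimately show ?thesis by simp
qed

lemma topspace_half_space: "topspace (half_space n) = {x \<in> topspace (Euclidean_space n). 0 \<le> x (n - 1)}"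
  by (auto simp: half_space_def)

text \<open>Lowering coordinate \<open>k\<close> slightly below 0 stays in an open set. This gives
  the contradiction wherever an open set would have to lie on one side of a hyperplane that it
  touches.\<close>

lemma openin_Euclidean_space_contains_negative:
  assumes n: "k < n" and U: "openin (Euclidean_space n) U" "z \<in> U" "z k = 0"
  shows "\<exists>w\<in>U. w k < 0"
proof -
  have zt: "z \<in> topspace (Euclidean_space n)" using U openin_subset by blast
  define p where "p t = z(k := t)" for t :: real
  have "continuous_map euclideanreal (Euclidean_space n) p"
    unfolding continuous_map_into_Euclidean_space p_def
    using zt n by (auto simp: topspace_Euclidean_space)
  then have "openin euclideanreal {t \<in> topspace euclideanreal. p t \<in> U}"
    using U(1) unfolding continuous_map_def by blast
  then have "open {t. p t \<in> U}" by simp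
  moreover have "p 0 = z" using U(3) by (auto simp: p_def fun_eq_iff)
  ultimately obtain e where e: "e > 0" "ball 0 e \<subseteq> {t. p t \<in> U}"
    using U(2) by (metis mem_Collect_eq open_contains_ball)
  have "p (- (e/2)) \<in> U" using e by (auto simp: subset_iff dist_real_def)
  moreover have "p (- (e/2)) k < 0" using e by (simp add: p_def)
  ultimately show ?thesis by blast
qed

text \<open>Doubling across the boundary hyperplane reduces this to the boundaryless case.\<close>

theorem invariance_of_domain_half_space:
  assumes n: "n \<ge> 1" and V: "openin (half_space n) V"
    and \<beta>: "continuous_map (subtopology (half_space n) V) (half_space n) \<beta>" and inj: "inj_on \<beta> V"
    and bdry: "\<And>x. x \<in> V \<Longrightarrow> x (n - 1) = 0 \<Longrightarrow> \<beta> x (n - 1) = 0"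
  shows "openin (half_space n) (\<beta> ` V)"
proof -
  let ?E = "Euclidean_space n"
  define r :: "(nat \<Rightarrow> real) \<Rightarrow> nat \<Rightarrow> real" where "r x = x(n - 1 := - x (n - 1))" for x
  define fold where "fold x = x(n - 1 := \<bar>x (n - 1)\<bar>)" for x :: "nat \<Rightarrow> real"
  have coord: "continuous_map ?E euclideanreal (\<lambda>x. x i)" for i
    by (rule continuous_map_Euclidean_space_coord)
  have r_cont: "continuous_map ?E ?E r"
    unfolding continuous_map_into_Euclidean_space
  proof (intro conjI allI)
    show "continuous_map ?E euclideanreal (\<lambda>x. r x i)" for i
      using coord by (cases "i = n - 1") (auto simp: r_def intro: continuous_map_minus)
  qed (use n in \<open>auto simp: r_def topspace_Euclidean_space\<close>)
  have fold_cont: "continuous_map ?E ?E fold"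
    unfolding continuous_map_into_Euclidean_space
  proof (intro conjI allI)
    show "continuous_map ?E euclideanreal (\<lambda>x. fold x i)" for i
      using coord by (cases "i = n - 1") (auto simp: fold_def intro: continuous_map_real_abs)
  qed (use n in \<open>auto simp: fold_def topspace_Euclidean_space\<close>)
  have rr [simp]: "r (r x) = x" for x by (auto simp: r_def fun_eq_iff)
  have rc [simp]: "r x (n - Suc 0) = - x (n - Suc 0)" for x by (simp add: r_def)
  have fold_cases: "fold x = (if 0 \<le> x (n - 1) then x else r x)" for x
    by (auto simp: r_def fold_def fun_eq_iff)
  have VE: "V \<subseteq> topspace ?E" "\<And>x. x \<in> V \<Longrightarrow> 0 \<le> x (n - 1)"
    using openin_subset[OF V] by (auto simp: topspace_half_space)
  have \<beta>E: "\<beta> x \<in> topspace ?E" "0 \<le> \<beta> x (n - 1)" if "x \<in> V" for x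
    using \<beta> that VE by (auto simp: continuous_map_def Pi_iff topspace_half_space)
  have subV: "subtopology (half_space n) V = subtopology ?E V"
    using VE by (auto simp: half_space_def subtopology_subtopology intro!: arg_cong2[of _ _ _ _ subtopology])
  have \<beta>_cont: "continuous_map (subtopology ?E V) ?E \<beta>"
    using \<beta> unfolding subV by (auto simp: half_space_def continuous_map_in_subtopology)
  define D where "D = {x \<in> topspace ?E. fold x \<in> V}"
  have D: "openin ?E D"
  proof -
    have "continuous_map ?E (half_space n) fold"
      using fold_cont by (auto simp: half_space_def continuous_map_in_subtopology fold_def)
    then show ?thesis using V by (auto simp: D_def continuous_map_def)
  qed
  \<comment> \<open>The extension that commutes with the reflection \<open>r\<close>. Both branches
    agree on the hyperplane because \<open>\<beta>\<close> sends it into itself, by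
    \<open>bdry\<close>.\<close>
  define b where "b x = (if 0 \<le> x (n - 1) then \<beta> x else r (\<beta> (r x)))" for x
  have b_cont: "continuous_map (subtopology ?E D) ?E b"
    unfolding b_def
  proof (rule continuous_map_cases_le)
    show "continuous_map (subtopology ?E D) euclideanreal (\<lambda>x. 0)" by simp
    show "continuous_map (subtopology ?E D) euclideanreal (\<lambda>x. x (n - 1))"
      by (rule continuous_map_from_subtopology[OF coord])
    have "continuous_map (subtopology ?E {x \<in> topspace (subtopology ?E D). 0 \<le> x (n - 1)}) ?E \<beta>"
      by (rule continuous_map_from_subtopology_mono[OF \<beta>_cont]) (auto simp: D_def fold_cases)
    then show "continuous_map (subtopology (subtopology ?E D) {x \<in> topspace (subtopology ?E D). 0 \<le> x (n - 1)}) ?E \<beta>"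
      unfolding subtopology_subtopology by (rule continuous_map_from_subtopology_mono) auto
    let ?N = "{x \<in> topspace (subtopology ?E D). x (n - 1) \<le> 0}"
    have "r x \<in> V" if "x \<in> ?N" for x
    proof (cases "x (n - 1) = 0")
      case True
      then have "r x = x" by (auto simp: r_def fun_eq_iff)
      then show ?thesis using that True by (auto simp: D_def fold_cases)
    next
      case False
      then show ?thesis using that by (auto simp: D_def fold_cases split: if_splits)
    qed
    then have "continuous_map (subtopology ?E ?N) (subtopology ?E V) r"
      using r_cont by (auto simp: continuous_map_in_subtopology intro: continuous_map_from_subtopology)
    then have "continuous_map (subtopology ?E ?N) ?E (r \<circ> (\<beta> \<circ> r))"
      by (intro continuous_map_compose[OF _ r_cont] continuous_map_compose[OF _ \<beta>_cont])
    then have "continuous_map (subtopology ?E ?N) ?E (\<lambda>x. r (\<beta> (r x)))" by (simp add: o_def)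
    then show "continuous_map (subtopology (subtopology ?E D) ?N) ?E (\<lambda>x. r (\<beta> (r x)))"
      unfolding subtopology_subtopology by (rule continuous_map_from_subtopology_mono) auto
    fix x assume x: "x \<in> topspace (subtopology ?E D)" "0 = x (n - 1)"
    then have "r x = x" "x \<in> V" by (auto simp: r_def fun_eq_iff D_def fold_cases)
    moreover have "\<beta> x (n - 1) = 0" using bdry[OF \<open>x \<in> V\<close>] x by simp
    then have "r (\<beta> x) = \<beta> x" by (auto simp: r_def fun_eq_iff)
    ultimately show "\<beta> x = r (\<beta> (r x))" by simp
  qed
  define V' where "V' = {x \<in> V. 0 < x (n - 1)}"
  have V'_open: "openin ?E V'" unfolding V'_def by (rule openin_half_space_positive[OF V])
  \<comment> \<open>If an interior point went to the hyperplane, the image of the interior part,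
    open by the boundaryless theorem, would reach below the hyperplane. So \<open>b\<close>
    preserves signs, and injectivity can be checked on each side separately.\<close>
  have pos: "\<beta> x (n - 1) > 0" if x: "x \<in> V'" for x
  proof (rule ccontr)
    assume "\<not> \<beta> x (n - 1) > 0"
    then have z: "\<beta> x (n - 1) = 0" using \<beta>E(2)[of x] x by (auto simp: V'_def)
    have "openin ?E (\<beta> ` V')"
    proof (rule invariance_of_domain_Euclidean_space[OF V'_open])
      show "continuous_map (subtopology ?E V') ?E \<beta>"
        by (rule continuous_map_from_subtopology_mono[OF \<beta>_cont]) (auto simp: V'_def)
      show "inj_on \<beta> V'" by (rule inj_on_subset[OF inj]) (auto simp: V'_def)
    qed
    then obtain w where "w \<in> \<beta> ` V'" "w (n - 1) < 0"
      using openin_Euclidean_space_contains_negative[of "n - 1" n "\<beta> ` V'" "\<beta> x"] n x z by auto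
    then show False using \<beta>E(2) by (force simp: V'_def)
  qed
  have signs: "(x (n - 1) > 0 \<longrightarrow> b x (n - 1) > 0) \<and> (x (n - 1) = 0 \<longrightarrow> b x (n - 1) = 0) \<and>
      (x (n - 1) < 0 \<longrightarrow> b x (n - 1) < 0)" if "x \<in> D" for x
    using that pos[of x] pos[of "r x"] bdry[of x]
    by (auto simp: b_def D_def fold_cases V'_def split: if_splits)
  have "inj_on b D"
  proof (rule inj_onI)
    fix x y assume xy: "x \<in> D" "y \<in> D" "b x = b y"
    show "x = y"
    proof (cases "0 \<le> x (n - 1)")
      case True
      then have y: "0 \<le> y (n - 1)" using signs[OF xy(1)] signs[OF xy(2)] xy(3) by (cases "x (n - 1) = 0") force+
      then have "\<beta> x = \<beta> y" "x \<in> V" "y \<in> V" using xy True by (auto simp: b_def D_def fold_cases)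
      then show ?thesis using inj by (auto dest: inj_onD)
    next
      case False
      then have y: "\<not> 0 \<le> y (n - 1)" using signs[OF xy(1)] signs[OF xy(2)] xy(3) by (cases "y (n - 1) = 0") force+
      then have *: "r (\<beta> (r x)) = r (\<beta> (r y))" "r x \<in> V" "r y \<in> V"
        using xy False by (auto simp: b_def D_def fold_cases)
      then have "\<beta> (r x) = \<beta> (r y)" by (metis rr)
      then have "r x = r y" using inj * by (auto dest: inj_onD)
      then show ?thesis by (metis rr)
    qed
  qed
  then have "openin ?E (b ` D)" by (rule invariance_of_domain_Euclidean_space[OF D b_cont])
  moreover have "\<beta> ` V = b ` D \<inter> {x. 0 \<le> x (n - 1)}"
  proof
    show "\<beta> ` V \<subseteq> b ` D \<inter> {x. 0 \<le> x (n - 1)}"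
    proof
      fix y assume "y \<in> \<beta> ` V"
      then obtain x where x: "x \<in> V" "y = \<beta> x" by auto
      then have "x \<in> D" "y = b x" using VE by (auto simp: D_def fold_cases b_def)
      moreover have "0 \<le> y (n - 1)" using x \<beta>E(2)[OF x(1)] by simp
      ultimately show "y \<in> b ` D \<inter> {x. 0 \<le> x (n - 1)}" by auto
    qed
    show "b ` D \<inter> {x. 0 \<le> x (n - 1)} \<subseteq> \<beta> ` V"
    proof
      fix y assume "y \<in> b ` D \<inter> {x. 0 \<le> x (n - 1)}"
      then obtain x where x: "x \<in> D" "y = b x" "0 \<le> b x (n - 1)" by auto
      then have "0 \<le> x (n - 1)" using signs[OF x(1)] by (meson not_le)
      then have "x \<in> V" "y = \<beta> x" using x by (auto simp: D_def fold_cases b_def)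
      then show "y \<in> \<beta> ` V" by simp
    qed
  qed
  ultimately show ?thesis by (auto simp: half_space_def openin_subtopology)
qed

text \<open>The plaque coordinate is placed at the new index \<open>n\<close>, so the half-space
  coordinate keeps index \<open>n - 1\<close> although it is no longer the last one. This is
  harmless because boundary points are tested against charts in the full Euclidean space.\<close>

definition euclid_append :: "nat \<Rightarrow> real \<times> (nat \<Rightarrow> real) \<Rightarrow> nat \<Rightarrow> real" where
  "euclid_append n p = (snd p)(n := fst p)"

lemma homeomorphic_map_euclid_append:
  "homeomorphic_map (prod_topology euclideanreal (Euclidean_space n)) (Euclidean_space (Suc n)) (euclid_append n)"
proof -
  let ?E = "Euclidean_space n" and ?E' = "Euclidean_space (Suc n)"
  let ?P = "prod_topology euclideanreal ?E"
  have "homeomorphic_maps ?P ?E' (euclid_append n) (\<lambda>x. (x n, x(n := 0)))"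
    unfolding homeomorphic_maps_def
  proof (intro conjI)
    show "continuous_map ?P ?E' (euclid_append n)"
      unfolding continuous_map_into_Euclidean_space
    proof (intro conjI allI)
      fix i
      show "continuous_map ?P euclideanreal (\<lambda>p. euclid_append n p i)"
      proof (cases "i = n")
        case True
        then show ?thesis by (simp add: euclid_append_def continuous_map_fst)
      next
        case False
        have "continuous_map ?P euclideanreal ((\<lambda>x. x i) \<circ> snd)"
          by (rule continuous_map_compose[OF continuous_map_snd continuous_map_Euclidean_space_coord])
        then show ?thesis using False by (simp add: euclid_append_def o_def)
      qed
    qed (auto simp: euclid_append_def topspace_Euclidean_space)
    have "continuous_map ?E' ?E (\<lambda>x. x(n := 0))"
      unfolding continuous_map_into_Euclidean_space
    proof (intro conjI allI)
      show "continuous_map ?E' euclideanreal (\<lambda>x. (x(n := 0)) i)" for i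
        by (cases "i = n") (auto simp: continuous_map_Euclidean_space_coord)
    qed (auto simp: topspace_Euclidean_space)
    then show "continuous_map ?E' ?P (\<lambda>x. (x n, x(n := 0)))"
      by (simp add: continuous_map_pairwise o_def continuous_map_Euclidean_space_coord)
  qed (auto simp: euclid_append_def topspace_Euclidean_space fun_eq_iff)
  then show ?thesis by (rule homeomorphic_maps_imp_map)
qed

text \<open>Where the transverse half-space coordinate is positive, the chart restricts to one onto
  an open set of the full Euclidean space of dimension \<open>Suc n\<close>.\<close>

lemma foliated_chart_interior:
  assumes c: "foliated_chart n X U \<phi> a b B" and x: "x \<in> U" "0 < snd (\<phi> x) (n - 1)"
  shows "x \<notin> manifold_boundary (Suc n) X"
proof -
  let ?E = "Euclidean_space n" and ?E' = "Euclidean_space (Suc n)"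
  let ?P = "prod_topology euclideanreal ?E"
  have U: "openin X U" and B: "openin (half_space n) B"
    and \<phi>: "homeomorphic_map (subtopology X U) (prod_topology (top_of_set (open_interval a b)) (subtopology (half_space n) B)) \<phi>"
    using c by (auto simp: foliated_chart_def)
  define I where "I = open_interval a b"
  have I: "open I"
  proof -
    have "I = ereal -` {a<..<b}" by (auto simp: I_def open_interval_def)
    then show ?thesis by (simp add: open_ereal_vimage)
  qed
  have BE: "B \<subseteq> topspace ?E" "\<And>y. y \<in> B \<Longrightarrow> 0 \<le> y (n - 1)"
    using openin_subset[OF B] by (auto simp: topspace_half_space)
  have "subtopology (half_space n) B = subtopology ?E B"
    using BE by (auto simp: half_space_def subtopology_subtopology intro!: arg_cong2[of _ _ _ _ subtopology])
  then have \<phi>': "homeomorphic_map (subtopology X U) (subtopology ?P (I \<times> B)) \<phi>"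
    using \<phi> by (simp add: subtopology_Times I_def)
  define B' where "B' = {y \<in> B. 0 < y (n - 1)}"
  have B': "openin ?E B'" unfolding B'_def by (rule openin_half_space_positive[OF B])
  define U' where "U' = {z \<in> topspace (subtopology X U). \<phi> z \<in> I \<times> B'}"
  have sub: "I \<times> B' \<subseteq> I \<times> B" by (auto simp: B'_def)
  have IB: "openin ?P (I \<times> B')" using I B' by (simp add: openin_prod_Times_iff)
  then have IB': "openin (subtopology ?P (I \<times> B)) (I \<times> B')"
    using sub by (auto simp: openin_subtopology)
  have "openin (subtopology X U) U'"
    unfolding U'_def using homeomorphic_imp_continuous_map[OF \<phi>'] IB' by (auto simp: continuous_map_def)
  then have U'_open: "openin X U'" using U by (rule openin_trans_full)
  have U'sub: "U' \<subseteq> U" by (auto simp: U'_def)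
  have "homeomorphic_map (subtopology (subtopology X U) U') (subtopology (subtopology ?P (I \<times> B)) (I \<times> B')) \<phi>"
    by (rule homeomorphic_map_subtopologies_alt[OF \<phi>']) (auto simp: U'_def)
  then have h1: "subtopology X U' homeomorphic_space subtopology ?P (I \<times> B')"
    using U'sub sub by (auto simp: subtopology_subtopology Int_absorb1 Int_absorb2 inf.absorb2 dest: homeomorphic_map_imp_homeomorphic_space)
  note e = homeomorphic_map_euclid_append[of n]
  have op: "openin ?E' (euclid_append n ` (I \<times> B'))"
    using homeomorphic_imp_open_map[OF e] IB by (auto simp: open_map_def)
  have "homeomorphic_map (subtopology ?P (I \<times> B')) (subtopology ?E' (euclid_append n ` (I \<times> B'))) (euclid_append n)"
    using openin_subset[OF IB] openin_subset[OF op]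
    by (intro homeomorphic_map_subtopologies[OF e]) (simp add: Int_absorb1 inf.absorb2)
  then have "subtopology X U' homeomorphic_space subtopology ?E' (euclid_append n ` (I \<times> B'))"
    using h1 homeomorphic_map_imp_homeomorphic_space homeomorphic_space_trans by blast
  moreover have "x \<in> U'"
  proof -
    have xt: "x \<in> topspace (subtopology X U)" using x openin_subset[OF U] by auto
    then have "\<phi> x \<in> topspace (subtopology ?P (I \<times> B))"
      using homeomorphic_imp_continuous_map[OF \<phi>'] by (auto simp: continuous_map_def Pi_iff)
    then have "\<phi> x \<in> I \<times> B'" using x(2) by (cases "\<phi> x") (auto simp: B'_def)
    then show ?thesis using xt by (simp add: U'_def)
  qed
  ultimately show ?thesis using U'_open op unfolding manifold_boundary_def by blast
qed

text \<open>The inverse of a Euclidean chart at such a point, followed by the product coordinates,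
  would map an open set injectively into a half-space. By invariance of domain the image is open,
  yet it touches the boundary hyperplane.\<close>

lemma product_chart_boundary:
  assumes n: "n \<ge> 1" and W: "openin X W"
    and h: "homeomorphic_map (cylinder (half_space n) V) (subtopology X W) h"
    and V: "openin (half_space n) V" and v: "v \<in> V" "v (n - 1) = 0"
  shows "h (t, v) \<in> manifold_boundary (Suc n) X"
proof -
  let ?E = "Euclidean_space n" and ?E' = "Euclidean_space (Suc n)"
  let ?P = "cylinder (half_space n) V"
  have VE: "V \<subseteq> topspace ?E" "\<And>y. y \<in> V \<Longrightarrow> 0 \<le> y (n - 1)"
    using openin_subset[OF V] by (auto simp: topspace_half_space)
  have tP: "topspace ?P = UNIV \<times> V" using VE by (auto simp: topspace_half_space)
  have ht: "h (t, v) \<in> topspace (subtopology X W)"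
    using homeomorphic_imp_continuous_map[OF h] tP v by (auto simp: continuous_map_def Pi_iff)
  obtain g where g: "homeomorphic_maps ?P (subtopology X W) h g" using h by (auto simp: homeomorphic_map_maps)
  have e: "continuous_map ?P ?E' (euclid_append n)"
  proof -
    have "continuous_map (subtopology (half_space n) V) ?E (\<lambda>x. x)"
      unfolding half_space_def by (intro continuous_map_from_subtopology) (simp add: continuous_map_id[unfolded id_def])
    then have "continuous_map ?P ?E snd" using continuous_map_compose[OF continuous_map_snd] by (auto simp: o_def)
    then have "continuous_map ?P (prod_topology euclideanreal ?E) (\<lambda>p. (fst p, snd p))"
      by (simp only: continuous_map_pairwise o_def fst_conv snd_conv) (simp add: continuous_map_fst)
    then show ?thesis
      using continuous_map_compose[OF _ homeomorphic_imp_continuous_map[OF homeomorphic_map_euclid_append[of n]]]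
      by (simp add: o_def)
  qed
  have False if UB: "openin X U" "h (t, v) \<in> U" "openin ?E' B" "subtopology X U homeomorphic_space subtopology ?E' B" for U B
  proof -
    obtain k l where kl: "homeomorphic_maps (subtopology X U) (subtopology ?E' B) k l"
      using UB(4) by (auto simp: homeomorphic_space_def)
    have k: "homeomorphic_map (subtopology X U) (subtopology ?E' B) k" using kl by (rule homeomorphic_maps_imp_map)
    have lk: "l (k x) = x" if "x \<in> U" for x
      using kl that openin_subset[OF UB(1)] by (auto simp: homeomorphic_maps_def)
    have hg: "h (g x) = x" if "x \<in> W" for x
      using g that openin_subset[OF W] by (auto simp: homeomorphic_maps_def)
    have gP: "g x \<in> UNIV \<times> V" if "x \<in> W" for x
      using g that openin_subset[OF W] tP by (auto simp: homeomorphic_maps_def continuous_map_def Pi_iff)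
    define Q where "Q = k ` (U \<inter> W)"
    have "openin (subtopology X U) (U \<inter> W)" using W by (auto simp: openin_subtopology_Int2)
    then have "openin (subtopology ?E' B) Q"
      unfolding Q_def using homeomorphic_imp_open_map[OF k] by (auto simp: open_map_def)
    then have Q: "openin ?E' Q" "Q \<subseteq> B" using openin_trans_full[OF _ UB(3)] openin_imp_subset by blast+
    define m where "m = euclid_append n \<circ> (g \<circ> l)"
    have lQ: "l z \<in> U \<inter> W" if "z \<in> Q" for z using that lk by (auto simp: Q_def)
    have "continuous_map (subtopology ?E' Q) (subtopology X U) l"
      using kl Q(2) by (auto simp: homeomorphic_maps_def intro: continuous_map_from_subtopology_mono)
    then have "continuous_map (subtopology ?E' Q) (subtopology X W) l"
      using lQ by (auto simp: continuous_map_in_subtopology)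
    then have "continuous_map (subtopology ?E' Q) ?E' m"
      unfolding m_def using g by (intro continuous_map_compose[OF _ e] continuous_map_compose[where X' = "subtopology X W"])
        (auto simp: homeomorphic_maps_def)
    moreover have "inj_on m Q"
    proof (rule inj_onI)
      fix y z assume yz: "y \<in> Q" "z \<in> Q" "m y = m z"
      obtain y' z' where y': "y' \<in> U" "y' \<in> W" "y = k y'" and z': "z' \<in> U" "z' \<in> W" "z = k z'"
        using yz by (auto simp: Q_def)
      have "g y' \<in> topspace (prod_topology euclideanreal ?E)" "g z' \<in> topspace (prod_topology euclideanreal ?E)"
        using gP[OF y'(2)] gP[OF z'(2)] VE(1) by auto
      moreover have "euclid_append n (g y') = euclid_append n (g z')"
        using yz y' z' lk by (simp add: m_def)
      ultimately have "g y' = g z'"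
        using homeomorphic_imp_injective_map[OF homeomorphic_map_euclid_append[of n]] by (auto dest: inj_onD)
      then show "y = z" using hg y' z' by metis
    qed
    ultimately have op: "openin ?E' (m ` Q)" by (rule invariance_of_domain_Euclidean_space[OF Q(1)])
    have hW: "h (t, v) \<in> W" using ht by auto
    have "k (h (t, v)) \<in> Q" using UB(2) hW by (simp add: Q_def)
    moreover have "m (k (h (t, v))) = euclid_append n (t, v)"
    proof -
      have "g (h (t, v)) = (t, v)" using g v tP by (auto simp: homeomorphic_maps_def)
      then show ?thesis by (simp add: m_def lk UB(2))
    qed
    ultimately have mem: "euclid_append n (t, v) \<in> m ` Q" by force
    have nn: "n - 1 \<noteq> n" "n - 1 < Suc n" using n by auto
    have "euclid_append n (t, v) (n - 1) = 0" using v nn by (simp add: euclid_append_def)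
    then obtain w where w: "w \<in> m ` Q" "w (n - 1) < 0"
      using openin_Euclidean_space_contains_negative[OF nn(2) op mem] by auto
    then obtain z where z: "z \<in> Q" "w = m z" by auto
    have "g (l z) \<in> UNIV \<times> V" using lQ[OF z(1)] gP by simp
    then show False using w(2) z(2) VE(2) nn by (auto simp: m_def euclid_append_def) (use VE(2) in force)
  qed
  then show ?thesis using ht unfolding manifold_boundary_def by auto
qed

section \<open>Foliated charts and transversals\<close>

lemma open_open_interval: "open (open_interval a b)"
proof -
  have "open_interval a b = ereal -` {a<..<b}" by (auto simp: open_interval_def)
  then show ?thesis by (simp add: open_ereal_vimage)
qed

text \<open>A scaled arctangent: \<open>2 / pi\<close> normalizes its range to the open interval
  from -1 to 1, then \<open>e\<close> and \<open>s\<close> move it into place.\<close>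

lemma reals_into_ball:
  fixes s e :: real
  assumes "e > 0"
  obtains h :: "real \<Rightarrow> real" where "continuous_on UNIV h" "inj h" "h 0 = s" "\<And>t. h t \<in> ball s e"
proof
  let ?h = "\<lambda>t::real. s + e * (2 / pi) * arctan t"
  show "continuous_on UNIV ?h" by (intro continuous_intros)
  show "inj ?h" using assms by (auto simp: inj_def arctan_eq_iff)
  show "?h 0 = s" by simp
  fix t
  have "\<bar>arctan t\<bar> < pi / 2" using arctan_lbound[of t] arctan_ubound[of t] by (simp add: abs_less_iff)
  then have "(2 / pi) * \<bar>arctan t\<bar> < 1" by (simp add: field_simps)
  then have "e * ((2 / pi) * \<bar>arctan t\<bar>) < e * 1" using assms by (intro mult_strict_left_mono)
  then show "?h t \<in> ball s e" using assms by (simp add: dist_real_def abs_mult mult.assoc)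
qed

text \<open>The inverse chart is precomposed with a product map: the line is squeezed into the
  plaque interval around height \<open>s\<close>, and the transverse variable is replaced by
  \<open>\<beta>\<close>. The initial slice uses it with \<open>\<beta>\<close> the identity,
  \<open>covered_plaque\<close> with \<open>\<beta>\<close> a transition along plaques.\<close>

lemma foliated_chart_reparam:
  assumes c: "foliated_chart n X U \<phi> a b B" and s: "s \<in> open_interval a b"
    and V: "openin V C" and \<beta>: "continuous_map (subtopology V C) (half_space n) \<beta>"
    and \<beta>_open: "\<And>D. openin V D \<Longrightarrow> D \<subseteq> C \<Longrightarrow> openin (half_space n) (\<beta> ` D)"
    and \<beta>B: "\<beta> ` C \<subseteq> B" and inj: "inj_on \<beta> C"
  obtains \<psi> where "continuous_map (cylinder V C) X \<psi>"
    "open_map (cylinder V C) X \<psi>" "inj_on \<psi> (UNIV \<times> C)"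
    "\<And>t v. v \<in> C \<Longrightarrow> \<psi> (t, v) \<in> U \<and> snd (\<phi> (\<psi> (t, v))) = \<beta> v"
    "\<And>x v. v \<in> C \<Longrightarrow> x \<in> U \<Longrightarrow> \<phi> x = (s, \<beta> v) \<Longrightarrow> \<psi> (0, v) = x"
proof -
  let ?P = "cylinder V C"
  let ?Q = "prod_topology (top_of_set (open_interval a b)) (subtopology (half_space n) B)"
  have U: "openin X U" and B: "openin (half_space n) B" and \<phi>: "homeomorphic_map (subtopology X U) ?Q \<phi>"
    using c by (auto simp: foliated_chart_def)
  have BH: "B \<subseteq> topspace (half_space n)" using B by (rule openin_subset)
  have UX: "U \<subseteq> topspace X" using U by (rule openin_subset)
  obtain \<theta> where \<theta>: "homeomorphic_maps (subtopology X U) ?Q \<phi> \<theta>"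
    using \<phi> by (auto simp: homeomorphic_map_maps)
  have \<theta>h: "homeomorphic_map ?Q (subtopology X U) \<theta>"
    using \<theta> homeomorphic_maps_sym homeomorphic_maps_imp_map by blast
  have \<theta>\<phi>: "\<theta> (\<phi> x) = x" if "x \<in> U" for x using \<theta> that UX by (auto simp: homeomorphic_maps_def)
  have tQ: "topspace ?Q = open_interval a b \<times> B" using BH by auto
  have \<phi>\<theta>: "\<phi> (\<theta> p) = p" "\<theta> p \<in> U" if "p \<in> open_interval a b \<times> B" for p
  proof -
    show "\<phi> (\<theta> p) = p" using \<theta> that unfolding homeomorphic_maps_def tQ by blast
    have "\<theta> ` topspace ?Q \<subseteq> topspace (subtopology X U)"
      by (rule continuous_map_image_subset_topspace[OF homeomorphic_imp_continuous_map[OF \<theta>h]])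
    then have "\<theta> p \<in> topspace (subtopology X U)" using that tQ by blast
    then show "\<theta> p \<in> U" by simp
  qed
  obtain e where e: "e > 0" "ball s e \<subseteq> open_interval a b"
    using open_open_interval[of a b] s by (meson open_contains_ball)
  obtain h :: "real \<Rightarrow> real" where h: "continuous_on UNIV h" "inj h" "h 0 = s" "\<And>t. h t \<in> ball s e"
    using reals_into_ball[OF e(1)] by metis
  have hI: "h t \<in> open_interval a b" for t using h(4)[of t] e(2) by blast
  define m where "m p = (h (fst p), \<beta> (snd p))" for p
  have mQ: "m (t, v) \<in> open_interval a b \<times> B" if "v \<in> C" for t v
    using hI \<beta>B that by (auto simp: m_def)
  have m_cont: "continuous_map ?P ?Q m"
    unfolding continuous_map_pairwise
  proof
    have "continuous_map ?P euclideanreal (h \<circ> fst)"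
      using h(1) by (intro continuous_map_compose[OF continuous_map_fst]) simp
    then show "continuous_map ?P (top_of_set (open_interval a b)) (fst \<circ> m)"
      using hI by (auto simp: continuous_map_in_subtopology o_def m_def)
    have "continuous_map ?P (half_space n) (\<beta> \<circ> snd)"
      by (rule continuous_map_compose[OF continuous_map_snd \<beta>])
    then show "continuous_map ?P (subtopology (half_space n) B) (snd \<circ> m)"
      using \<beta>B by (auto simp: continuous_map_in_subtopology o_def m_def)
  qed
  have m_open: "open_map ?P ?Q m"
    unfolding open_map_def
  proof (intro allI impI)
    fix W assume W: "openin ?P W"
    show "openin ?Q (m ` W)"
      unfolding openin_prod_topology_alt
    proof (intro allI impI)
      fix c d assume "(c, d) \<in> m ` W"
      then obtain t v where tv: "(t, v) \<in> W" "c = h t" "d = \<beta> v" by (auto simp: m_def)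
      obtain A D where AD: "openin euclideanreal A" "openin (subtopology V C) D" "t \<in> A" "v \<in> D" "A \<times> D \<subseteq> W"
        using W[unfolded openin_prod_topology_alt, rule_format, OF tv(1)] by metis
      have "open (h ` A)" using AD(1) h(1,2)
        by (intro injective_into_1d_imp_open_map_UNIV[of A UNIV]) auto
      then have 1: "openin (top_of_set (open_interval a b)) (h ` A)"
        using hI by (auto simp: openin_open_eq open_open_interval)
      have "openin V D" "D \<subseteq> C" using openin_trans_full[OF AD(2) V] openin_imp_subset[OF AD(2)] by auto
      then have "openin (half_space n) (\<beta> ` D)" by (rule \<beta>_open)
      moreover have "\<beta> ` D \<subseteq> B" using \<open>D \<subseteq> C\<close> \<beta>B by auto
      ultimately have 2: "openin (subtopology (half_space n) B) (\<beta> ` D)"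
        using B by (simp add: openin_open_subtopology)
      have "h ` A \<times> \<beta> ` D \<subseteq> m ` W"
      proof clarify
        fix t' v' assume "t' \<in> A" "v' \<in> D"
        then have "(t', v') \<in> W" using AD(5) by blast
        then show "(h t', \<beta> v') \<in> m ` W" by (auto simp: m_def image_iff intro!: bexI)
      qed
      then show "\<exists>A' D'. openin (top_of_set (open_interval a b)) A' \<and> openin (subtopology (half_space n) B) D' \<and>
          c \<in> A' \<and> d \<in> D' \<and> A' \<times> D' \<subseteq> m ` W"
        using 1 2 AD(3,4) tv(2,3) by (intro exI[of _ "h ` A"] exI[of _ "\<beta> ` D"]) auto
    qed
  qed
  show thesis
  proof (rule that[of "\<theta> \<circ> m"])
    have "continuous_map ?P (subtopology X U) (\<theta> \<circ> m)"
      by (rule continuous_map_compose[OF m_cont homeomorphic_imp_continuous_map[OF \<theta>h]])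
    then show "continuous_map ?P X (\<theta> \<circ> m)" by (rule continuous_map_into_fulltopology)
    have "open_map ?P (subtopology X U) (\<theta> \<circ> m)"
      by (rule open_map_compose[OF m_open homeomorphic_imp_open_map[OF \<theta>h]])
    then show "open_map ?P X (\<theta> \<circ> m)"
      unfolding open_map_def using openin_trans_full[OF _ U] by blast
    show "inj_on (\<theta> \<circ> m) (UNIV \<times> C)"
    proof (rule inj_onI, clarify)
      fix t v t' v' assume v: "v \<in> C" "v' \<in> C" and eq: "(\<theta> \<circ> m) (t, v) = (\<theta> \<circ> m) (t', v')"
      then have "m (t, v) = m (t', v')" using \<phi>\<theta>(1)[OF mQ] by (metis comp_apply)
      then show "t = t' \<and> v = v'" using h(2) inj v by (auto simp: m_def inj_eq dest: inj_onD)
    qed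
    show "(\<theta> \<circ> m) (t, v) \<in> U \<and> snd (\<phi> ((\<theta> \<circ> m) (t, v))) = \<beta> v" if "v \<in> C" for t v
      using \<phi>\<theta>[OF mQ[OF that, of t]] by (simp add: m_def)
    show "(\<theta> \<circ> m) (0, v) = x" if "v \<in> C" "x \<in> U" "\<phi> x = (s, \<beta> v)" for x v
      using \<theta>\<phi>[OF that(2)] that(3) by (simp add: m_def h(3))
  qed
qed

lemma locally_compact_half_space: "locally_compact_space (half_space n)"
proof -
  have "closedin (Euclidean_space n) {x \<in> topspace (Euclidean_space n). 0 \<le> x (n - 1)}"
    using continuous_map_Euclidean_space_coord[of n "n - 1"]
    unfolding continuous_map_upper_lower_semicontinuous_le by blast
  then have "locally_compact_space (subtopology (Euclidean_space n) {x \<in> topspace (Euclidean_space n). 0 \<le> x (n - 1)})"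
    by (rule locally_compact_space_closed_subset[OF locally_compact_Euclidean_space])
  moreover have "subtopology (Euclidean_space n) {x \<in> topspace (Euclidean_space n). 0 \<le> x (n - 1)} = half_space n"
    unfolding half_space_def subtopology_restrict[of _ "{x. 0 \<le> x (n - 1)}", symmetric]
    by (simp add: Collect_conj_eq)
  ultimately show ?thesis by simp
qed

lemma Hausdorff_half_space: "Hausdorff_space (half_space n)"
  unfolding half_space_def by (rule Hausdorff_space_subtopology[OF Hausdorff_Euclidean_space])

lemma manifold_locally_compact:
  assumes "manifold_with_boundary m X"
  shows "locally_compact_space X"
  unfolding locally_compact_space_def
proof
  fix x assume "x \<in> topspace X"
  then obtain U B where U: "openin X U" "x \<in> U" "openin (half_space m) B"
    "subtopology X U homeomorphic_space subtopology (half_space m) B"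
    using assms unfolding manifold_with_boundary_def locally_half_space_def by blast
  have "locally_compact_space (subtopology (half_space m) B)"
    by (rule locally_compact_space_open_subset[OF _ locally_compact_half_space U(3)]) (simp add: Hausdorff_half_space)
  then have "locally_compact_space (subtopology X U)"
    using homeomorphic_locally_compact_space[OF U(4)] by simp
  moreover have "x \<in> topspace (subtopology X U)" using U(2) openin_subset[OF U(1)] by auto
  ultimately obtain W K where W: "openin (subtopology X U) W" "compactin (subtopology X U) K" "x \<in> W" "W \<subseteq> K"
    unfolding locally_compact_space_def by blast
  then have "openin X W" "compactin X K" using openin_trans_full[OF _ U(1)] by (auto simp: compactin_subtopology)
  then show "\<exists>U K. openin X U \<and> compactin X K \<and> x \<in> U \<and> U \<subseteq> K" using W by blast
qed

lemma leaf_proj_in_partition: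
  assumes "partition_on (topspace X) \<Delta>" "x \<in> topspace X"
  shows "leaf_proj \<Delta> x \<in> \<Delta>" "x \<in> leaf_proj \<Delta> x"
  using leaf_proj_eq[OF assms(1)] partition_onD1[OF assms(1)] assms(2) by blast+

section \<open>Plaques and leaves relative to a fixed atlas\<close>

locale foliated_space =
  fixes n :: nat and X :: "'a topology" and \<Delta> :: "'a set set"
    and \<A> :: "('a set \<times> ('a \<Rightarrow> real \<times> (nat \<Rightarrow> real)) \<times> ereal \<times> ereal \<times> (nat \<Rightarrow> real) set) set"
  assumes part: "partition_on (topspace X) \<Delta>"
    and leaf_path_connected: "\<omega> \<in> \<Delta> \<Longrightarrow> path_connectedin X \<omega>"
    and atlas_chart: "(U, \<phi>, a, b, B) \<in> \<A> \<Longrightarrow> foliated_chart n X U \<phi> a b B"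
    and atlas_cover: "x \<in> topspace X \<Longrightarrow> \<exists>U \<phi> a b B. (U, \<phi>, a, b, B) \<in> \<A> \<and> x \<in> U"
    and atlas_plaques: "\<omega> \<in> \<Delta> \<Longrightarrow> (U, \<phi>, a, b, B) \<in> \<A> \<Longrightarrow>
      path_components_of (subtopology X (\<omega> \<inter> U)) \<subseteq> plaques U \<phi> a b B"
begin

lemmas leaf_proj_in = leaf_proj_in_partition[OF part]

lemma leaf_proj_iff:
  assumes "\<omega> \<in> \<Delta>" shows "x \<in> \<omega> \<longleftrightarrow> x \<in> topspace X \<and> leaf_proj \<Delta> x = \<omega>"
  using leaf_proj_eq[OF part assms] leaf_proj_in partition_onD1[OF part] assms by blast

lemma chart_value:
  assumes A: "(U, \<phi>, a, b, B) \<in> \<A>" and x: "x \<in> U"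
  shows "fst (\<phi> x) \<in> open_interval a b" "snd (\<phi> x) \<in> B" "x \<in> topspace X"
proof -
  have c: "openin X U" "homeomorphic_map (subtopology X U)
       (prod_topology (top_of_set (open_interval a b)) (subtopology (half_space n) B)) \<phi>"
    using atlas_chart[OF A] by (auto simp: foliated_chart_def)
  show "x \<in> topspace X" using openin_subset[OF c(1)] x by blast
  then have "x \<in> topspace (subtopology X U)" using x by simp
  then have "\<phi> x \<in> topspace (prod_topology (top_of_set (open_interval a b)) (subtopology (half_space n) B))"
    using homeomorphic_imp_surjective_map[OF c(2)] by blast
  then show "fst (\<phi> x) \<in> open_interval a b" "snd (\<phi> x) \<in> B" by auto
qed

lemma continuous_transverse_coordinate:
  assumes A: "(U, \<phi>, a, b, B) \<in> \<A>" and k: "continuous_map Y X k" "\<And>y. y \<in> topspace Y \<Longrightarrow> k y \<in> U"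
  shows "continuous_map Y (half_space n) (\<lambda>y. snd (\<phi> (k y)))"
proof -
  have \<phi>: "homeomorphic_map (subtopology X U)
       (prod_topology (top_of_set (open_interval a b)) (subtopology (half_space n) B)) \<phi>"
    using atlas_chart[OF A] by (simp add: foliated_chart_def)
  have "continuous_map Y (subtopology X U) k" using k by (auto simp: continuous_map_in_subtopology)
  then have "continuous_map Y (subtopology (half_space n) B) (snd \<circ> (\<phi> \<circ> k))"
    by (rule continuous_map_compose[OF continuous_map_compose[OF _ homeomorphic_imp_continuous_map[OF \<phi>]] continuous_map_snd])
  then show ?thesis by (simp add: continuous_map_in_subtopology o_def)
qed

text \<open>By compatibility of the atlas the path component is itself a plaque, and containing
  \<open>x\<close> determines which one. Connection inside \<open>U\<close> thereby becomes equality
  of transverse coordinates.\<close>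

lemma plaque_component:
  assumes A: "(U, \<phi>, a, b, B) \<in> \<A>" and w: "\<omega> \<in> \<Delta>" and x: "x \<in> \<omega>" "x \<in> U"
  shows "path_component_of (subtopology X (\<omega> \<inter> U)) x y \<longleftrightarrow> y \<in> U \<and> snd (\<phi> y) = snd (\<phi> x)"
proof -
  let ?T = "subtopology X (\<omega> \<inter> U)"
  have xT: "x \<in> topspace ?T" using x chart_value[OF A] by auto
  then have "path_component_of_set ?T x \<in> path_components_of ?T" by (simp add: path_components_of_def)
  then obtain z where z: "path_component_of_set ?T x = {y \<in> U. \<phi> y \<in> open_interval a b \<times> {z}}"
    using atlas_plaques[OF w A] unfolding plaques_def by blast
  have "x \<in> path_component_of_set ?T x" using xT by (simp add: path_component_of_refl)
  then have zx: "z = snd (\<phi> x)" using z by auto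
  have "path_component_of ?T x y \<longleftrightarrow> y \<in> path_component_of_set ?T x" by simp
  also have "\<dots> \<longleftrightarrow> y \<in> U \<and> \<phi> y \<in> open_interval a b \<times> {z}" unfolding z by simp
  also have "\<dots> \<longleftrightarrow> y \<in> U \<and> snd (\<phi> y) = z" using chart_value(1)[OF A, of y] by (cases "\<phi> y") auto
  finally show ?thesis by (simp add: zx)
qed

lemma same_plaque_same_leaf:
  assumes A: "(U, \<phi>, a, b, B) \<in> \<A>" and xy: "x \<in> U" "y \<in> U" "snd (\<phi> x) = snd (\<phi> y)"
  shows "leaf_proj \<Delta> x = leaf_proj \<Delta> y"
proof -
  note w = leaf_proj_in[OF chart_value(3)[OF A xy(1)]]
  have "path_component_of (subtopology X (leaf_proj \<Delta> x \<inter> U)) x y"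
    using plaque_component[OF A w xy(1)] xy by simp
  then have "y \<in> leaf_proj \<Delta> x" by (auto simp: path_component_of_equiv)
  then show ?thesis using leaf_proj_eq[OF part w(1)] by simp
qed

text \<open>A path-connected piece of a leaf inside \<open>U\<close> cannot jump between plaques,
  even if the leaf returns to \<open>U\<close> many times. This is the tool for moving along leaves
  chart by chart.\<close>

lemma path_in_leaf_same_plaque:
  assumes A: "(U, \<phi>, a, b, B) \<in> \<A>" and w: "\<omega> \<in> \<Delta>" and C: "path_connectedin X C" "C \<subseteq> \<omega>" "C \<subseteq> U"
    and xy: "x \<in> C" "y \<in> C"
  shows "snd (\<phi> x) = snd (\<phi> y)"
proof -
  have "path_connectedin (subtopology X (\<omega> \<inter> U)) C" using C by (simp add: path_connectedin_subtopology)
  then have "path_component_of (subtopology X (\<omega> \<inter> U)) x y"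
    unfolding path_component_of using xy by (intro exI[of _ C]) simp
  moreover have "x \<in> \<omega>" "x \<in> U" using xy C by auto
  ultimately show ?thesis using plaque_component[OF A w, of x y] by simp
qed

end

text \<open>\<open>\<psi>0\<close> is a line of parallel slices, and \<open>leaf v\<close> is the
  leaf through parameter \<open>v\<close>. Injectivity of \<open>leaf\<close> says that a slice
  meets each leaf at most once.\<close>

locale transversal = foliated_space +
  fixes V0 :: "(nat \<Rightarrow> real) set" and leaf :: "(nat \<Rightarrow> real) \<Rightarrow> 'a set" and \<psi>0 :: "real \<times> (nat \<Rightarrow> real) \<Rightarrow> 'a"
  assumes V0: "openin (half_space n) V0"
    and leaf: "\<And>v. v \<in> V0 \<Longrightarrow> leaf v \<in> \<Delta>" "inj_on leaf V0"
    and \<psi>0: "continuous_map (cylinder (half_space n) V0) X \<psi>0"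
      "open_map (cylinder (half_space n) V0) X \<psi>0"
      "inj_on \<psi>0 (UNIV \<times> V0)" "\<And>t v. v \<in> V0 \<Longrightarrow> \<psi>0 (t, v) \<in> leaf v"
begin

definition V where "V = subtopology (half_space n) V0"

lemma topspace_V [simp]: "topspace V = V0"
  using openin_subset[OF V0] by (auto simp: V_def)

definition q where "q x = inv_into V0 leaf (leaf_proj \<Delta> x)"

lemma q_leaf: "v \<in> V0 \<Longrightarrow> x \<in> leaf v \<Longrightarrow> q x = v"
  using leaf_proj_eq[OF part leaf(1)] leaf(2) by (simp add: q_def)

definition S where "S = \<Union>(leaf ` V0)"

lemma q_in_V0: "x \<in> S \<Longrightarrow> q x \<in> V0 \<and> x \<in> leaf (q x)"
  unfolding S_def using q_leaf by auto

text \<open>Membership in \<open>leaf v\<close> is demanded in addition to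
  \<open>q (\<psi> (t, v)) = v\<close>, because off \<open>S\<close> the value of \<open>q\<close>
  is unspecified and says nothing about the leaf. Tubes are charts in \<open>X\<close>, since
  openness of \<open>S\<close> is only derived from them.\<close>

definition tube :: "(nat \<Rightarrow> real) set \<Rightarrow> (real \<times> (nat \<Rightarrow> real) \<Rightarrow> 'a) \<Rightarrow> bool" where
  "tube C \<psi> \<longleftrightarrow> fibre_chart X V q C \<psi> \<and> (\<forall>t. \<forall>v\<in>C. \<psi> (t, v) \<in> leaf v)"

lemma tubeI:
  assumes "openin V C" "continuous_map (cylinder V C) X \<psi>"
    "open_map (cylinder V C) X \<psi>" "inj_on \<psi> (UNIV \<times> C)"
    "\<And>t v. v \<in> C \<Longrightarrow> \<psi> (t, v) \<in> leaf v"
  shows "tube C \<psi>"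
  using assms q_leaf openin_subset[OF assms(1)] unfolding tube_def fibre_chart_def by (auto simp: subset_iff)

definition covered :: "'a \<Rightarrow> bool" where
  "covered z \<longleftrightarrow> (\<exists>C \<psi>. tube C \<psi> \<and> z \<in> \<psi> ` (UNIV \<times> C))"

lemma tube0: "tube V0 \<psi>0"
proof -
  have "subtopology V V0 = V" unfolding V_def by (simp add: subtopology_subtopology)
  moreover have "openin V V0" using openin_topspace[of V] by simp
  ultimately show ?thesis using \<psi>0 by (intro tubeI) (simp_all add: V_def)
qed

text \<open>Near \<open>z\<close> the slice of the tube at parameter \<open>t\<close> crosses the
  plaques of \<open>U\<close>, which gives an open injection \<open>\<beta>\<close> from tube
  parameters to transverse coordinates. Sliding along the plaques of \<open>U\<close> to the height
  of \<open>x\<close> yields a tube through \<open>x\<close>, over a possibly smaller parameter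
  set.\<close>

lemma covered_plaque:
  assumes A: "(U, \<phi>, a, b, B) \<in> \<A>" and xz: "x \<in> U" "z \<in> U" "snd (\<phi> x) = snd (\<phi> z)" and z: "covered z"
  shows "covered x"
proof -
  obtain E \<psi> t v where tube: "tube E \<psi>" "v \<in> E" "z = \<psi> (t, v)" using z unfolding covered_def by auto
  have \<psi>: "fibre_chart X V q E \<psi>" "\<And>t v. v \<in> E \<Longrightarrow> \<psi> (t, v) \<in> leaf v" using tube(1) by (auto simp: tube_def)
  note D = fibre_chartD[OF \<psi>(1)]
  have EV: "E \<subseteq> V0" using D(5) by simp
  have c: "foliated_chart n X U \<phi> a b B" by (rule atlas_chart[OF A])
  then have U: "openin X U" and B: "openin (half_space n) B" and \<phi>: "homeomorphic_map (subtopology X U)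
       (prod_topology (top_of_set (open_interval a b)) (subtopology (half_space n) B)) \<phi>"
    by (auto simp: foliated_chart_def)
  obtain d C where C: "d > 0" "openin V C" "v \<in> C" "C \<subseteq> E" "\<And>s w. \<bar>s - t\<bar> \<le> d \<Longrightarrow> w \<in> C \<Longrightarrow> \<psi> (s, w) \<in> U"
    using fibre_chart_box[OF \<psi>(1) U _ tube(2), of t] xz(2) tube(3) by metis
  have CV: "C \<subseteq> V0" using C EV by blast
  define \<beta> where "\<beta> w = snd (\<phi> (\<psi> (t, w)))" for w
  have tU: "\<psi> (t, w) \<in> U" if "w \<in> C" for w using C(1) C(5)[of t w] that by simp
  \<comment> \<open>A short piece of a tube line is a path inside one leaf and inside
    \<open>U\<close>, so its transverse coordinate is constant.\<close>
  have same: "snd (\<phi> (\<psi> (s, w))) = \<beta> w" if s: "\<bar>s - t\<bar> \<le> d" and w: "w \<in> C" for s w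
  proof -
    have wE: "w \<in> E" using C w by blast
    have "continuous_map euclideanreal X (\<lambda>t. \<psi> (t, w))" by (rule fibre_chart_line[OF \<psi>(1) wE])
    moreover have "path_connectedin euclideanreal {t-d..t+d}"
      by (simp add: is_interval_cc is_interval_path_connected)
    ultimately have pc: "path_connectedin X ((\<lambda>t. \<psi> (t, w)) ` {t-d..t+d})"
      by (rule path_connectedin_continuous_map_image)
    have "snd (\<phi> (\<psi> (s, w))) = snd (\<phi> (\<psi> (t, w)))"
      by (rule path_in_leaf_same_plaque[OF A leaf(1) pc, of w])
         (use wE EV \<psi>(2) C(1) C(5)[OF _ w] s in \<open>auto simp: abs_le_iff\<close>)
    then show ?thesis by (simp add: \<beta>_def)
  qed
  have \<beta>B: "\<beta> ` C \<subseteq> B" using chart_value(2)[OF A tU] by (auto simp: \<beta>_def)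
  have \<beta>_cont: "continuous_map (subtopology V C) (half_space n) \<beta>"
    unfolding \<beta>_def
    by (rule continuous_transverse_coordinate[OF A continuous_map_from_subtopology_mono[OF fibre_chart_slice[OF \<psi>(1)] C(4)]])
       (simp add: tU)
  \<comment> \<open>Thickening \<open>G\<close> to the box \<open>R\<close> gives an open set of
    \<open>X\<close>, whose transverse projection is open. By \<open>same\<close> the thickening
    does not enlarge the projection, which is therefore the image of \<open>G\<close> under
    \<open>\<beta>\<close>.\<close>
  have \<beta>_open: "openin (half_space n) (\<beta> ` G)" if G: "openin V G" "G \<subseteq> C" for G
  proof -
    define R where "R = \<psi> ` ({t-d<..<t+d} \<times> (E \<inter> G))"
    have RU: "R \<subseteq> U"
      unfolding R_def using C(5) G(2) by (auto simp: subset_iff abs_less_iff intro!: C(5))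
    have "openin X R" unfolding R_def by (rule fibre_chart_image[OF \<psi>(1) _ G(1)]) simp
    then have "openin (subtopology X U) R" using RU U by (simp add: openin_open_subtopology)
    then have "openin (prod_topology (top_of_set (open_interval a b)) (subtopology (half_space n) B)) (\<phi> ` R)"
      using homeomorphic_imp_open_map[OF \<phi>] by (auto simp: open_map_def)
    then have "openin (subtopology (half_space n) B) (snd ` \<phi> ` R)"
      using open_map_snd by (auto simp: open_map_def)
    then have "openin (half_space n) (snd ` \<phi> ` R)" using B by (rule openin_trans_full)
    moreover have "snd ` \<phi> ` R = \<beta> ` G"
    proof
      show "snd ` \<phi> ` R \<subseteq> \<beta> ` G"
      proof
        fix y assume "y \<in> snd ` \<phi> ` R"
        then obtain s w where "s \<in> {t-d<..<t+d}" "w \<in> G" "y = snd (\<phi> (\<psi> (s, w)))" by (auto simp: R_def)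
        then show "y \<in> \<beta> ` G" using same[of s w] G(2) by (auto simp: abs_le_iff)
      qed
      show "\<beta> ` G \<subseteq> snd ` \<phi> ` R"
      proof
        fix y assume "y \<in> \<beta> ` G"
        then obtain w where w: "w \<in> G" "y = snd (\<phi> (\<psi> (t, w)))" by (auto simp: \<beta>_def)
        have "\<psi> (t, w) \<in> R" unfolding R_def using w(1) G(2) C(1,4) by (intro imageI) auto
        then show "y \<in> snd ` \<phi> ` R" using w(2) by blast
      qed
    qed
    ultimately show ?thesis by simp
  qed
  have leafproj: "leaf_proj \<Delta> (\<psi> (t, w)) = leaf w" if "w \<in> C" for w
    using \<psi>(2) that C(4) CV leaf(1) by (intro leaf_proj_eq[OF part]) auto
  have \<beta>_inj: "inj_on \<beta> C"
  proof (rule inj_onI)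
    fix w w' assume w: "w \<in> C" "w' \<in> C" "\<beta> w = \<beta> w'"
    then have "leaf w = leaf w'"
      using same_plaque_same_leaf[OF A tU[OF w(1)] tU[OF w(2)]] leafproj by (simp add: \<beta>_def)
    then show "w = w'" using leaf(2) w CV by (auto dest: inj_onD)
  qed
  show ?thesis
  proof (rule foliated_chart_reparam[OF c chart_value(1)[OF A xz(1)] C(2) \<beta>_cont \<beta>_open \<beta>B \<beta>_inj])
    fix \<psi>' assume \<psi>': "continuous_map (cylinder V C) X \<psi>'"
    "open_map (cylinder V C) X \<psi>'" "inj_on \<psi>' (UNIV \<times> C)"
    "\<And>t v. v \<in> C \<Longrightarrow> \<psi>' (t, v) \<in> U \<and> snd (\<phi> (\<psi>' (t, v))) = \<beta> v"
    "\<And>y v. v \<in> C \<Longrightarrow> y \<in> U \<Longrightarrow> \<phi> y = (fst (\<phi> x), \<beta> v) \<Longrightarrow> \<psi>' (0, v) = y"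
  have "tube C \<psi>'"
  proof (rule tubeI[OF C(2) \<psi>'(1-3)])
    fix s w assume w: "w \<in> C"
    have "leaf_proj \<Delta> (\<psi>' (s, w)) = leaf_proj \<Delta> (\<psi> (t, w))"
      using \<psi>'(4)[OF w, of s] tU[OF w] by (intro same_plaque_same_leaf[OF A]) (auto simp: \<beta>_def)
    then show "\<psi>' (s, w) \<in> leaf w"
      using leafproj[OF w] leaf_proj_in(2)[OF chart_value(3)[OF A]] \<psi>'(4)[OF w, of s] by metis
  qed
  moreover have "\<psi>' (0, v) = x"
    by (rule \<psi>'(5)[OF C(3) xz(1)]) (simp add: \<beta>_def tube(3)[symmetric] xz(3)[symmetric])
  ultimately show ?thesis unfolding covered_def using C(3) by (metis SigmaI UNIV_I imageI)
  qed
qed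

lemma covered_S:
  assumes x: "x \<in> S"
  shows "covered x"
proof -
  obtain v where v: "v \<in> V0" "x \<in> leaf v" using x by (auto simp: S_def)
  note w = leaf(1)[OF v(1)]
  obtain g where g: "pathin X g" "\<And>t. t \<in> {0..1} \<Longrightarrow> g t \<in> leaf v" "g 0 = \<psi>0 (0, v)" "g 1 = x"
    using leaf_path_connected[OF w] \<psi>0(4)[OF v(1), of 0] v(2) unfolding path_connectedin by (metis Pi_iff)
  \<comment> \<open>As an implication, propagation composes along a subdivision of the path from the
    slice to \<open>x\<close>. On a short interval the path stays in one chart, hence in one plaque,
    where \<open>covered_plaque\<close> applies.\<close>
  define P where "P a b \<longleftrightarrow> (0 \<le> a \<and> b \<le> 1 \<and> covered (g a) \<longrightarrow> covered (g b))" for a b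
  have "P 0 1" using zero_le_one
  proof (rule Bolzano)
    show "P a c" if "P a b" "P b c" "a \<le> b" "b \<le> c" for a b c
      using that unfolding P_def by auto
    fix t :: real assume t: "0 \<le> t" "t \<le> 1"
    have "g t \<in> topspace X" using g(2)[of t] t leaf_proj_iff[OF w] by auto
    then obtain U \<phi> a b B where A: "(U, \<phi>, a, b, B) \<in> \<A>" "g t \<in> U" using atlas_cover by blast
    have U: "openin X U" using atlas_chart[OF A(1)] by (auto simp: foliated_chart_def)
    have "openin (top_of_set {0..1}) {s \<in> {0..1}. g s \<in> U}"
      using g(1) U unfolding pathin_def continuous_map_def by auto
    then obtain O' where O': "open O'" "{s \<in> {0..1}. g s \<in> U} = {0..1} \<inter> O'" by (auto simp: openin_open)
    then have "t \<in> O'" using A(2) t by auto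
    then obtain d where d: "d > 0" "ball t d \<subseteq> O'" using O'(1) by (meson open_contains_ball)
    have "P r s" if rs: "r \<le> t" "t \<le> s" "s - r < d" for r s
      unfolding P_def
    proof (intro impI)
      assume *: "0 \<le> r \<and> s \<le> 1 \<and> covered (g r)"
      have U': "g u \<in> U" if "u \<in> {r..s}" for u
      proof -
        have "u \<in> ball t d" using that rs by (auto simp: dist_real_def)
        then have "u \<in> {0..1} \<inter> O'" using d * that by auto
        then show ?thesis using O'(2) by blast
      qed
      have "path_connectedin (top_of_set {0..1}) {r..s}"
        using * by (simp add: path_connectedin_subtopology is_interval_cc is_interval_path_connected)
      then have pc: "path_connectedin X (g ` {r..s})"
        using g(1) unfolding pathin_def by (rule path_connectedin_continuous_map_image[rotated])
      have "snd (\<phi> (g s)) = snd (\<phi> (g r))"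
        by (rule path_in_leaf_same_plaque[OF A(1) w pc]) (use g(2) U' * rs in auto)
      then show "covered (g s)"
        using covered_plaque[OF A(1) U'[of s] U'[of r]] * rs by auto
    qed
    then show "\<exists>d>0. \<forall>r s. r \<le> t \<and> t \<le> s \<and> s - r < d \<longrightarrow> P r s" using d(1) by blast
  qed
  moreover have "covered (g 0)" unfolding covered_def using tube0 v(1) g(3) by blast
  ultimately show ?thesis by (simp add: P_def g(4))
qed

lemma tube_in_S: "tube C \<psi> \<Longrightarrow> v \<in> C \<Longrightarrow> \<psi> (t, v) \<in> S"
  using fibre_chartD(5)[of X V q C \<psi>] unfolding tube_def S_def by auto

lemma tube_image_open:
  assumes "tube C \<psi>" "openin V D"
  shows "openin X (\<psi> ` (UNIV \<times> (C \<inter> D)))"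
  using assms fibre_chart_image[of X V q C \<psi> UNIV D] by (simp add: tube_def)

lemma S_open: "openin X S"
proof (subst openin_subopen, rule ballI)
  fix x assume "x \<in> S"
  then obtain C \<psi> where C: "tube C \<psi>" "x \<in> \<psi> ` (UNIV \<times> C)" using covered_S covered_def by metis
  have "C \<inter> topspace V = C" using C(1) fibre_chartD(5)[of X V q C \<psi>] by (auto simp: tube_def)
  then have "openin X (\<psi> ` (UNIV \<times> C))" using tube_image_open[OF C(1) openin_topspace] by simp
  moreover have "\<psi> ` (UNIV \<times> C) \<subseteq> S" using tube_in_S[OF C(1)] by auto
  ultimately show "\<exists>T. openin X T \<and> x \<in> T \<and> T \<subseteq> S" using C(2) by blast
qed

lemma tube_fibre_chart: 
  assumes "tube C \<psi>" shows "fibre_chart (subtopology X S) V q C \<psi>"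
proof -
  have \<psi>: "fibre_chart X V q C \<psi>" using assms by (simp add: tube_def)
  let ?P = "cylinder V C"
  have im: "\<psi> p \<in> S" if "p \<in> topspace ?P" for p
    using that tube_in_S[OF assms] by (cases p) auto
  then have "continuous_map ?P (subtopology X S) \<psi>"
    using fibre_chartD(2)[OF \<psi>] by (auto simp: continuous_map_in_subtopology)
  moreover have "open_map ?P (subtopology X S) \<psi>"
    unfolding open_map_def
  proof (intro allI impI)
    fix W assume W: "openin ?P W"
    then have "openin X (\<psi> ` W)" using \<psi> by (auto simp: fibre_chart_def open_map_def)
    moreover have "\<psi> ` W \<subseteq> S" using im openin_subset[OF W] by blast
    ultimately show "openin (subtopology X S) (\<psi> ` W)" using S_open by (simp add: openin_open_subtopology)
  qed
  ultimately show ?thesis using \<psi> by (auto simp: fibre_chart_def)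
qed

text \<open>The fibres of \<open>q\<close> on \<open>S\<close> are exactly the leaves, so
  \<open>trivialization\<close> applies; it is inverted because foliated triviality asks for a map
  from the product onto \<open>S\<close>.\<close>

lemma saturation_trivial:
  assumes mfd: "manifold_with_boundary (Suc n) X" and nc: "\<And>\<omega>. \<omega> \<in> \<Delta> \<Longrightarrow> \<not> compactin X \<omega>"
  shows "foliated_homeomorphic_trivial n X \<Delta> S V0"
proof -
  have Haus: "Hausdorff_space X" and sc: "second_countable X" using mfd by (auto simp: manifold_with_boundary_def)
  have SX: "S \<subseteq> topspace X" by (rule openin_subset[OF S_open])
  then have tS: "topspace (subtopology X S) = S" by auto
  have fib: "{x \<in> topspace (subtopology X S). q x = v} = leaf v" if "v \<in> V0" for v
    unfolding tS using q_in_V0 q_leaf[OF that] that by (auto simp: S_def)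
  interpret line_submersion "subtopology X S" V q \<psi>0
  proof
    show "Hausdorff_space (subtopology X S)" by (rule Hausdorff_space_subtopology[OF Haus])
    show "second_countable (subtopology X S)" by (rule second_countable_subtopology[OF sc])
    show "locally_compact_space (subtopology X S)"
      by (rule locally_compact_space_open_subset[OF _ manifold_locally_compact[OF mfd] S_open]) (simp add: Haus)
    show charts: "\<exists>B \<psi>. fibre_chart (subtopology X S) V q B \<psi> \<and> z \<in> \<psi> ` (UNIV \<times> B)"
      if "z \<in> topspace (subtopology X S)" for z
      using that covered_S[of z] tube_fibre_chart tS unfolding covered_def by metis
    show "fibre_chart (subtopology X S) V q (topspace V) \<psi>0"
      using tube_fibre_chart[OF tube0] by simp
    show "continuous_map (subtopology X S) V q"
      unfolding continuous_map_def
    proof (intro conjI allI impI)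
      show "q \<in> topspace (subtopology X S) \<rightarrow> topspace V" using q_in_V0 tS by auto
      fix W assume W: "openin V W"
      show "openin (subtopology X S) {x \<in> topspace (subtopology X S). q x \<in> W}"
      proof (subst openin_subopen, rule ballI)
        fix x assume x: "x \<in> {x \<in> topspace (subtopology X S). q x \<in> W}"
        then obtain C \<psi> where C: "fibre_chart (subtopology X S) V q C \<psi>" "x \<in> \<psi> ` (UNIV \<times> C)" using charts by blast
        note D = fibre_chartD[OF C(1)]
        have "openin (subtopology X S) (\<psi> ` (UNIV \<times> (C \<inter> W)))"
          by (rule fibre_chart_image[OF C(1) _ W]) simp
        moreover have "x \<in> \<psi> ` (UNIV \<times> (C \<inter> W))" using C(2) x D(3) by auto
        moreover have "\<psi> ` (UNIV \<times> (C \<inter> W)) \<subseteq> {x \<in> topspace (subtopology X S). q x \<in> W}"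
        proof clarify
          fix t v assume "v \<in> C" "v \<in> W"
          then show "\<psi> (t, v) \<in> topspace (subtopology X S) \<and> q (\<psi> (t, v)) \<in> W" using D(3,4) by simp
        qed
        ultimately show "\<exists>T. openin (subtopology X S) T \<and> x \<in> T \<and> T \<subseteq> {x \<in> topspace (subtopology X S). q x \<in> W}"
          by blast
      qed
    qed
    fix v assume "v \<in> topspace V"
    then have v: "v \<in> V0" by simp
    have sub: "leaf v \<subseteq> S" using v by (auto simp: S_def)
    show "connectedin (subtopology X S) {x \<in> topspace (subtopology X S). q x = v}"
      unfolding fib[OF v] using sub path_connectedin_imp_connectedin[OF leaf_path_connected[OF leaf(1)[OF v]]]
      by (simp add: connectedin_subtopology)
    show "\<not> compactin (subtopology X S) {x \<in> topspace (subtopology X S). q x = v}"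
      unfolding fib[OF v] using nc[OF leaf(1)[OF v]] by (simp add: compactin_subtopology)
  qed
  obtain F where F: "homeomorphic_map (subtopology X S) (prod_topology euclideanreal V) (\<lambda>x. (F x, q x))"
    using trivialization by blast
  then obtain h where h: "homeomorphic_maps (subtopology X S) (prod_topology euclideanreal V) (\<lambda>x. (F x, q x)) h"
    by (auto simp: homeomorphic_map_maps)
  then have hh: "homeomorphic_map (prod_topology euclideanreal V) (subtopology X S) h"
    using homeomorphic_maps_sym homeomorphic_maps_imp_map by blast
  have hS: "h (t, v) \<in> S" if "v \<in> V0" for t v
  proof -
    have "h ` topspace (prod_topology euclideanreal V) \<subseteq> topspace (subtopology X S)"
      by (rule continuous_map_image_subset_topspace[OF homeomorphic_imp_continuous_map[OF hh]])
    moreover have "(t, v) \<in> topspace (prod_topology euclideanreal V)" using that by simp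
    ultimately show ?thesis unfolding tS by blast
  qed
  have "h ` (UNIV \<times> {v}) = leaf v" if v: "v \<in> V0" for v
  proof
    show "h ` (UNIV \<times> {v}) \<subseteq> leaf v"
    proof clarify
      fix t
      have "(F (h (t, v)), q (h (t, v))) = (t, v)" using h v by (simp add: homeomorphic_maps_def)
      then show "h (t, v) \<in> leaf v" using q_in_V0[OF hS[OF v, of t]] by simp
    qed
    show "leaf v \<subseteq> h ` (UNIV \<times> {v})"
    proof
      fix x assume x: "x \<in> leaf v"
      then have "x \<in> S" unfolding S_def using v by blast
      then have "x \<in> topspace (subtopology X S)" unfolding tS .
      then have "h (F x, q x) = x" using h unfolding homeomorphic_maps_def by blast
      then show "x \<in> h ` (UNIV \<times> {v})" using q_leaf[OF v x] by (metis SigmaI UNIV_I imageI singletonI)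
    qed
  qed
  then show ?thesis
    unfolding foliated_homeomorphic_trivial_def using hh leaf(1) by (auto simp: V_def intro!: exI[of _ h])
qed

end

section \<open>Equivalence of the three conditions\<close>

context foliated_space
begin

text \<open>The cross section serves to find the slice. Its transverse coordinate
  \<open>\<beta>\<close> in a chart is injective, since its values lie on distinct leaves, and sends
  boundary to boundary by \<open>foliated_chart_interior\<close>. Hence its image \<open>V0\<close>
  is open, and the slice is taken inside the chart at constant plaque coordinate over
  \<open>V0\<close>.\<close>

lemma cross_section_imp_trivial:
  assumes n: "n \<ge> 1" and mfd: "manifold_with_boundary (Suc n) X"
    and nc: "\<And>\<omega>. \<omega> \<in> \<Delta> \<Longrightarrow> \<not> compactin X \<omega>"
    and \<omega>: "\<omega> \<in> \<Delta>" and cs: "cross_section n X \<Delta> V \<gamma>" and meet: "\<gamma> ` V \<inter> \<omega> \<noteq> {}"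
  shows "\<exists>W V. openin X W \<and> saturated \<Delta> W \<and> \<omega> \<subseteq> W \<and> openin (half_space n) V \<and>
            foliated_homeomorphic_trivial n X \<Delta> W V"
proof -
  have V: "openin (half_space n) V" and \<gamma>: "continuous_map (subtopology (half_space n) V) X \<gamma>"
    and bdry: "\<gamma> ` (V \<inter> half_space_boundary n) \<subseteq> manifold_boundary (Suc n) X"
    and inj: "inj_on (leaf_proj \<Delta> \<circ> \<gamma>) V"
    using cs by (auto simp: cross_section_def)
  obtain v0 where v0: "v0 \<in> V" "\<gamma> v0 \<in> \<omega>" using meet by auto
  have "\<gamma> v0 \<in> topspace X" using v0 leaf_proj_iff[OF \<omega>] by blast
  then obtain U \<phi> a b B where A: "(U, \<phi>, a, b, B) \<in> \<A>" "\<gamma> v0 \<in> U" using atlas_cover by blast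
  have c: "foliated_chart n X U \<phi> a b B" by (rule atlas_chart[OF A(1)])
  then have U: "openin X U" and B: "openin (half_space n) B" by (auto simp: foliated_chart_def)
  have VH: "V \<subseteq> topspace (half_space n)" by (rule openin_subset[OF V])
  define V1 where "V1 = {v \<in> topspace (subtopology (half_space n) V). \<gamma> v \<in> U}"
  have V1V: "V1 \<subseteq> V" by (auto simp: V1_def)
  have "openin (subtopology (half_space n) V) V1"
    unfolding V1_def using \<gamma> U by (auto simp: continuous_map_def)
  then have V1: "openin (half_space n) V1" using V by (rule openin_trans_full)
  have v0': "v0 \<in> V1" using v0 A VH by (auto simp: V1_def)
  have \<gamma>U: "\<gamma> v \<in> U" if "v \<in> V1" for v using that by (simp add: V1_def)
  define \<beta> where "\<beta> v = snd (\<phi> (\<gamma> v))" for v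
  have \<beta>_inj: "inj_on \<beta> V1"
  proof (rule inj_onI)
    fix v w assume vw: "v \<in> V1" "w \<in> V1" "\<beta> v = \<beta> w"
    then have "leaf_proj \<Delta> (\<gamma> v) = leaf_proj \<Delta> (\<gamma> w)"
      by (intro same_plaque_same_leaf[OF A(1) \<gamma>U \<gamma>U]) (simp_all add: \<beta>_def)
    then show "v = w" using inj_onD[OF inj, of v w] vw V1V by auto
  qed
  have \<beta>_cont: "continuous_map (subtopology (half_space n) V1) (half_space n) \<beta>"
  proof -
    have "continuous_map (subtopology (half_space n) V1) X \<gamma>"
      using \<gamma> V1V by (rule continuous_map_from_subtopology_mono)
    then show ?thesis
      unfolding \<beta>_def by (rule continuous_transverse_coordinate[OF A(1)]) (simp add: V1_def)
  qed
  define V0 where "V0 = \<beta> ` V1"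
  have V0B: "V0 \<subseteq> B" using chart_value(2)[OF A(1) \<gamma>U] by (auto simp: V0_def \<beta>_def)
  have V0: "openin (half_space n) V0"
    unfolding V0_def
  proof (rule invariance_of_domain_half_space[OF n V1 \<beta>_cont \<beta>_inj])
    fix v assume v: "v \<in> V1" "v (n - 1) = 0"
    have "v \<in> topspace (half_space n)" using v V1V VH by blast
    then have "v \<in> V \<inter> half_space_boundary n"
      using v V1V by (auto simp: topspace_half_space half_space_boundary_def)
    then have "\<gamma> v \<in> manifold_boundary (Suc n) X" using bdry by blast
    then have "\<not> 0 < \<beta> v (n - 1)"
      using foliated_chart_interior[OF c \<gamma>U[OF v(1)]] unfolding \<beta>_def by blast
    moreover have "0 \<le> \<beta> v (n - 1)"
      using chart_value(2)[OF A(1) \<gamma>U[OF v(1)]] openin_subset[OF B] by (auto simp: \<beta>_def topspace_half_space)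
    ultimately show "\<beta> v (n - 1) = 0" by simp
  qed
  show ?thesis
  proof (rule foliated_chart_reparam[OF c chart_value(1)[OF A] V0, of "\<lambda>y. y"])
    show "continuous_map (subtopology (half_space n) V0) (half_space n) (\<lambda>y. y)"
      by (intro continuous_map_from_subtopology) (simp add: continuous_map_id[unfolded id_def])
    fix \<psi>0 assume \<psi>0: "continuous_map (cylinder (half_space n) V0) X \<psi>0"
      "open_map (cylinder (half_space n) V0) X \<psi>0"
      "inj_on \<psi>0 (UNIV \<times> V0)"
      "\<And>t y. y \<in> V0 \<Longrightarrow> \<psi>0 (t, y) \<in> U \<and> snd (\<phi> (\<psi>0 (t, y))) = y"
    define leaf where "leaf y = leaf_proj \<Delta> (\<psi>0 (0, y))" for y
    have leaf\<beta>: "leaf (\<beta> v) = leaf_proj \<Delta> (\<gamma> v)" if v: "v \<in> V1" for v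
    proof -
      have "\<beta> v \<in> V0" using v by (simp add: V0_def)
      then show ?thesis
        unfolding leaf_def using \<psi>0(4)[of "\<beta> v" 0] \<gamma>U[OF v]
        by (intro same_plaque_same_leaf[OF A(1)]) (simp_all add: \<beta>_def)
    qed
    interpret T: transversal n X \<Delta> \<A> V0 leaf \<psi>0
    proof
      show "openin (half_space n) V0" by (rule V0)
      show "leaf y \<in> \<Delta>" if "y \<in> V0" for y
        unfolding leaf_def using chart_value(3)[OF A(1)] \<psi>0(4)[OF that] by (intro leaf_proj_in) blast
      show "inj_on leaf V0"
      proof (rule inj_onI)
        fix y y' assume y: "y \<in> V0" "y' \<in> V0" "leaf y = leaf y'"
        then obtain v v' where v: "v \<in> V1" "y = \<beta> v" "v' \<in> V1" "y' = \<beta> v'" by (auto simp: V0_def)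
        then have "leaf_proj \<Delta> (\<gamma> v) = leaf_proj \<Delta> (\<gamma> v')" using y leaf\<beta> by simp
        then have "v = v'" using inj_onD[OF inj, of v v'] v V1V by auto
        then show "y = y'" using v by simp
      qed
      show "\<psi>0 (t, y) \<in> leaf y" if y: "y \<in> V0" for t y
      proof -
        have "leaf y = leaf_proj \<Delta> (\<psi>0 (t, y))"
          unfolding leaf_def using \<psi>0(4)[OF y] by (intro same_plaque_same_leaf[OF A(1)]) auto
        then show ?thesis using leaf_proj_in(2) chart_value(3)[OF A(1)] \<psi>0(4)[OF y] by metis
      qed
    qed (rule \<psi>0)+
    have "foliated_homeomorphic_trivial n X \<Delta> T.S V0" by (rule T.saturation_trivial[OF mfd nc])
    moreover have "saturated \<Delta> T.S"
      unfolding saturated_def T.S_def using T.leaf(1) by (intro exI[of _ "leaf ` V0"]) auto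
    moreover have "\<omega> \<subseteq> T.S"
    proof -
      have "leaf (\<beta> v0) = \<omega>" using leaf\<beta>[OF v0'] leaf_proj_eq[OF part \<omega> v0(2)] by simp
      moreover have "\<beta> v0 \<in> V0" using v0' by (simp add: V0_def)
      ultimately show ?thesis unfolding T.S_def by blast
    qed
    ultimately show ?thesis using T.S_open V0 by blast
  qed (use V0B in auto)
qed

end

lemma foliation_imp_foliated_space:
  assumes "foliation n X \<Delta>"
  obtains \<A> where "foliated_space n X \<Delta> \<A>"
proof -
  obtain \<A> where *: "\<forall>(U, \<phi>, a, b, B) \<in> \<A>. foliated_chart n X U \<phi> a b B"
    "(\<Union>(U, \<phi>, a, b, B) \<in> \<A>. U) = topspace X"
    "\<forall>\<omega> \<in> \<Delta>. \<forall>(U, \<phi>, a, b, B) \<in> \<A>. path_components_of (subtopology X (\<omega> \<inter> U)) \<subseteq> plaques U \<phi> a b B"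
    using assms by (auto simp: foliation_def)
  have "foliated_space n X \<Delta> \<A>"
  proof
    show "partition_on (topspace X) \<Delta>" "\<And>\<omega>. \<omega> \<in> \<Delta> \<Longrightarrow> path_connectedin X \<omega>"
      using assms by (auto simp: foliation_def)
    show "foliated_chart n X U \<phi> a b B" if "(U, \<phi>, a, b, B) \<in> \<A>" for U \<phi> a b B
      using *(1) that by blast
    show "\<exists>U \<phi> a b B. (U, \<phi>, a, b, B) \<in> \<A> \<and> x \<in> U" if "x \<in> topspace X" for x
    proof -
      have "x \<in> (\<Union>(U, \<phi>, a, b, B) \<in> \<A>. U)" using that *(2) by simp
      then obtain A where "A \<in> \<A>" "x \<in> (case A of (U, \<phi>, a, b, B) \<Rightarrow> U)" by blast
      then show ?thesis by (cases A) (simp, blast)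
    qed
    show "path_components_of (subtopology X (\<omega> \<inter> U)) \<subseteq> plaques U \<phi> a b B"
      if "\<omega> \<in> \<Delta>" "(U, \<phi>, a, b, B) \<in> \<A>" for \<omega> U \<phi> a b B
      using *(3) that by blast
  qed
  then show thesis by (rule that)
qed

text \<open>The zero section of the trivialization works; it respects the boundary by
  \<open>product_chart_boundary\<close>.\<close>

lemma trivial_imp_cross_section:
  assumes n: "n \<ge> 1" and part: "partition_on (topspace X) \<Delta>" and \<omega>: "\<omega> \<in> \<Delta>"
    and W: "openin X W" "\<omega> \<subseteq> W" and V: "openin (half_space n) V"
    and triv: "foliated_homeomorphic_trivial n X \<Delta> W V"
  shows "\<exists>V \<gamma>. cross_section n X \<Delta> V \<gamma> \<and> \<gamma> ` V \<inter> \<omega> \<noteq> {}"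
proof -
  let ?H = "subtopology (half_space n) V"
  obtain h where h: "homeomorphic_map (prod_topology euclideanreal ?H) (subtopology X W) h"
    and leaf: "\<And>v. v \<in> V \<Longrightarrow> h ` (UNIV \<times> {v}) \<in> \<Delta>"
    using triv by (auto simp: foliated_homeomorphic_trivial_def)
  have tH: "topspace (prod_topology euclideanreal ?H) = UNIV \<times> V" using openin_subset[OF V] by auto
  have tW: "topspace (subtopology X W) = W" using openin_subset[OF W(1)] by auto
  have proj: "leaf_proj \<Delta> (h (t, v)) = h ` (UNIV \<times> {v})" if "v \<in> V" for t v
    by (rule leaf_proj_eq[OF part leaf[OF that]]) auto
  have "\<omega> \<noteq> {}" using part \<omega> by (auto simp: partition_on_def)
  then obtain x where x: "x \<in> \<omega>" by auto
  then have "x \<in> h ` (UNIV \<times> V)" using homeomorphic_imp_surjective_map[OF h] W(2) unfolding tH tW by blast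
  then obtain t v where tv: "v \<in> V" "x = h (t, v)" by auto
  have "\<omega> = h ` (UNIV \<times> {v})" using leaf_proj_eq[OF part \<omega> x] proj[OF tv(1), of t] tv(2) by simp
  then have meet: "h (0, v) \<in> \<omega>" by simp
  have "cross_section n X \<Delta> V (\<lambda>v. h (0, v))"
    unfolding cross_section_def
  proof (intro conjI V)
    have "continuous_map ?H (prod_topology euclideanreal ?H) (\<lambda>v. (0, v))"
      by (simp add: continuous_map_pairwise o_def continuous_map_id[unfolded id_def])
    then have "continuous_map ?H (subtopology X W) (h \<circ> (\<lambda>v. (0, v)))"
      using homeomorphic_imp_continuous_map[OF h] by (rule continuous_map_compose)
    then show "continuous_map ?H X (\<lambda>v. h (0, v))" by (simp add: o_def continuous_map_in_subtopology)
    show "(\<lambda>v. h (0, v)) ` (V \<inter> half_space_boundary n) \<subseteq> manifold_boundary (Suc n) X"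
      using product_chart_boundary[OF n W(1) h V] by (auto simp: half_space_boundary_def)
    show "inj_on (leaf_proj \<Delta> \<circ> (\<lambda>v. h (0, v))) V"
    proof (rule inj_onI)
      fix v w assume vw: "v \<in> V" "w \<in> V" "(leaf_proj \<Delta> \<circ> (\<lambda>v. h (0, v))) v = (leaf_proj \<Delta> \<circ> (\<lambda>v. h (0, v))) w"
      then have "h (0, v) \<in> h ` (UNIV \<times> {w})" using proj by auto
      then obtain s where "h (0, v) = h (s, w)" by auto
      then have "(0, v) = (s, w)"
        using homeomorphic_imp_injective_map[OF h] vw unfolding tH by (auto dest: inj_onD)
      then show "v = w" by simp
    qed
  qed
  then show ?thesis using meet tv(1) by blast
qed

lemma homeomorphic_map_prod_swap:
  assumes "homeomorphic_map Y Z j"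
  shows "homeomorphic_map (prod_topology F Y) (prod_topology Z F) (\<lambda>p. (j (snd p), fst p))"
proof -
  obtain k where k: "homeomorphic_maps Y Z j k" using assms by (auto simp: homeomorphic_map_maps)
  have cj: "continuous_map Y Z j" and ck: "continuous_map Z Y k" using k by (auto simp: homeomorphic_maps_def)
  have "homeomorphic_maps (prod_topology F Y) (prod_topology Z F) (\<lambda>p. (j (snd p), fst p)) (\<lambda>p. (snd p, k (fst p)))"
    unfolding homeomorphic_maps_def
  proof (intro conjI)
    show "continuous_map (prod_topology F Y) (prod_topology Z F) (\<lambda>p. (j (snd p), fst p))"
      using continuous_map_compose[OF continuous_map_snd cj, of F]
      by (simp add: continuous_map_pairwise o_def continuous_map_fst)
    show "continuous_map (prod_topology Z F) (prod_topology F Y) (\<lambda>p. (snd p, k (fst p)))"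
      using continuous_map_compose[OF continuous_map_fst ck, of F]
      by (simp add: continuous_map_pairwise o_def continuous_map_snd)
  qed (use k in \<open>auto simp: homeomorphic_maps_def\<close>)
  then show ?thesis by (rule homeomorphic_maps_imp_map)
qed

text \<open>Over the intersection \<open>\<Z>\<close> of a trivializing set and a Euclidean set both
  structures are available: undo the chart \<open>j\<close> of the leaf space, then the fibration
  chart \<open>k\<close>. The line over a point of \<open>\<Z>\<close> is the leaf which that point
  is.\<close>

lemma fibration_imp_trivial:
  assumes part: "partition_on (topspace X) \<Delta>" and \<omega>: "\<omega> \<in> \<Delta>"
    and fib: "locally_trivial_fibration X (leaf_space X \<Delta>) (leaf_proj \<Delta>) euclideanreal"
    and lh: "locally_half_space n (leaf_space X \<Delta>)"
  shows "\<exists>W V. openin X W \<and> saturated \<Delta> W \<and> \<omega> \<subseteq> W \<and> openin (half_space n) V \<and>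
            foliated_homeomorphic_trivial n X \<Delta> W V"
proof -
  let ?Y = "leaf_space X \<Delta>" and ?p = "leaf_proj \<Delta>"
  have tY: "topspace ?Y = \<Delta>" by (rule topspace_leaf_space[OF part])
  have "\<forall>y \<in> \<Delta>. \<exists>\<W> k. openin ?Y \<W> \<and> y \<in> \<W> \<and>
      homeomorphic_map (subtopology X {x \<in> topspace X. ?p x \<in> \<W>}) (prod_topology (subtopology ?Y \<W>) euclideanreal) k \<and>
      (\<forall>x\<in>topspace X. ?p x \<in> \<W> \<longrightarrow> fst (k x) = ?p x)"
    using fib unfolding locally_trivial_fibration_def tY by (rule conjunct2)
  from bspec[OF this \<omega>] obtain \<W> k where W: "openin ?Y \<W>" "\<omega> \<in> \<W>"
    and k: "homeomorphic_map (subtopology X {x \<in> topspace X. ?p x \<in> \<W>}) (prod_topology (subtopology ?Y \<W>) euclideanreal) k"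
    and kp': "\<forall>x\<in>topspace X. ?p x \<in> \<W> \<longrightarrow> fst (k x) = ?p x"
    by (elim exE conjE)
  have kp: "fst (k x) = ?p x" if "x \<in> topspace X" "?p x \<in> \<W>" for x
    using kp' that by (elim ballE impE) auto
  obtain \<U> B where U: "openin ?Y \<U>" "\<omega> \<in> \<U>" "openin (half_space n) B"
    "subtopology ?Y \<U> homeomorphic_space subtopology (half_space n) B"
    using lh \<omega> unfolding locally_half_space_def tY by blast
  obtain j where j: "homeomorphic_map (subtopology ?Y \<U>) (subtopology (half_space n) B) j"
    using U(4) by (auto simp: homeomorphic_space)
  define \<Z> where "\<Z> = \<W> \<inter> \<U>"
  have Z: "openin ?Y \<Z>" "\<omega> \<in> \<Z>" "\<Z> \<subseteq> \<Delta>" unfolding \<Z>_def using W U openin_subset[OF W(1)] tY by auto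
  define V where "V = j ` \<Z>"
  have "openin (subtopology ?Y \<U>) \<Z>" using Z(1) U(1) by (simp add: openin_open_subtopology \<Z>_def)
  then have "openin (subtopology (half_space n) B) V"
    unfolding V_def using homeomorphic_imp_open_map[OF j] by (auto simp: open_map_def)
  then have V: "openin (half_space n) V" "V \<subseteq> B" using openin_trans_full[OF _ U(3)] openin_imp_subset by blast+
  define W where "W = \<Union>\<Z>"
  have W_open: "openin X W" unfolding W_def using Z(1) openin_leaf_space[OF part] by blast
  have mem: "x \<in> W \<longleftrightarrow> x \<in> topspace X \<and> ?p x \<in> \<Z>" for x
  proof
    assume "x \<in> W"
    then obtain z where z: "z \<in> \<Z>" "x \<in> z" by (auto simp: W_def)
    then have "?p x = z" using leaf_proj_eq[OF part] Z(3) by blast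
    then show "x \<in> topspace X \<and> ?p x \<in> \<Z>" using z openin_subset[OF W_open] W_def by auto
  next
    assume x: "x \<in> topspace X \<and> ?p x \<in> \<Z>"
    then show "x \<in> W" using leaf_proj_in_partition(2)[OF part] W_def by blast
  qed
  have j': "homeomorphic_map (subtopology ?Y \<Z>) (subtopology (half_space n) V) j"
  proof -
    have "homeomorphic_map (subtopology (subtopology ?Y \<U>) \<Z>) (subtopology (subtopology (half_space n) B) V) j"
    proof (rule homeomorphic_map_subtopologies[OF j])
      have "topspace (subtopology ?Y \<U>) \<inter> \<Z> = \<Z>" using Z(3) tY by (auto simp: \<Z>_def)
      moreover have "topspace (subtopology (half_space n) B) \<inter> V = V" using V openin_subset[OF V(1)] by auto
      ultimately show "j ` (topspace (subtopology ?Y \<U>) \<inter> \<Z>) = topspace (subtopology (half_space n) B) \<inter> V"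
        by (simp add: V_def)
    qed
    then show ?thesis using V(2) by (simp add: subtopology_subtopology \<Z>_def inf.absorb2 Int_commute Int_left_commute)
  qed
  have k': "homeomorphic_map (subtopology X W) (prod_topology (subtopology ?Y \<Z>) euclideanreal) k"
  proof -
    let ?D = "{x \<in> topspace X. ?p x \<in> \<W>}"
    have "homeomorphic_map (subtopology (subtopology X ?D) W)
        (subtopology (prod_topology (subtopology ?Y \<W>) euclideanreal) (\<Z> \<times> UNIV)) k"
    proof (rule homeomorphic_map_subtopologies_alt[OF k])
      fix x assume "x \<in> topspace (subtopology X ?D)"
      then have "fst (k x) = ?p x" "x \<in> topspace X" using kp by auto
      then show "k x \<in> \<Z> \<times> UNIV \<longleftrightarrow> x \<in> W" using mem by (cases "k x") auto
    qed
    moreover have "?D \<inter> W = W" using mem by (auto simp: \<Z>_def)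
    moreover have "\<W> \<inter> \<Z> = \<Z>" by (auto simp: \<Z>_def)
    ultimately show ?thesis by (simp add: subtopology_subtopology subtopology_Times)
  qed
  obtain j1 where j1: "homeomorphic_maps (subtopology ?Y \<Z>) (subtopology (half_space n) V) j j1"
    using j' by (auto simp: homeomorphic_map_maps)
  have j1h: "homeomorphic_map (subtopology (half_space n) V) (subtopology ?Y \<Z>) j1"
    using j1 homeomorphic_maps_sym homeomorphic_maps_imp_map by blast
  obtain k1 where k1: "homeomorphic_maps (subtopology X W) (prod_topology (subtopology ?Y \<Z>) euclideanreal) k k1"
    using k' by (auto simp: homeomorphic_map_maps)
  have k1h: "homeomorphic_map (prod_topology (subtopology ?Y \<Z>) euclideanreal) (subtopology X W) k1"
    using k1 homeomorphic_maps_sym homeomorphic_maps_imp_map by blast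
  define h where "h = k1 \<circ> (\<lambda>p. (j1 (snd p), fst p))"
  have h: "homeomorphic_map (cylinder (half_space n) V) (subtopology X W) h"
    unfolding h_def by (rule homeomorphic_map_compose[OF homeomorphic_map_prod_swap[OF j1h] k1h])
  have tV: "topspace (subtopology (half_space n) V) = V" using openin_subset[OF V(1)] by auto
  have tZ: "topspace (subtopology ?Y \<Z>) = \<Z>" using Z(3) tY by auto
  have tW: "topspace (subtopology X W) = W" using openin_subset[OF W_open] by auto
  have "h ` (UNIV \<times> {v}) \<in> \<Delta>" if v: "v \<in> V" for v
  proof -
    have z: "j1 v \<in> \<Z>" using homeomorphic_imp_surjective_map[OF j1h] v unfolding tV tZ by blast
    have "h ` (UNIV \<times> {v}) = j1 v"
    proof
      show "h ` (UNIV \<times> {v}) \<subseteq> j1 v"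
      proof clarify
        fix t
        have "(j1 v, t) \<in> topspace (prod_topology (subtopology ?Y \<Z>) euclideanreal)" using z tZ by simp
        then have kk: "k (k1 (j1 v, t)) = (j1 v, t)" and "k1 (j1 v, t) \<in> topspace (subtopology X W)"
          using k1 homeomorphic_imp_surjective_map[OF k1h] unfolding homeomorphic_maps_def by blast+
        then have w: "k1 (j1 v, t) \<in> W" using tW by simp
        then have "?p (k1 (j1 v, t)) = j1 v" using kk kp[of "k1 (j1 v, t)"] mem by (auto simp: \<Z>_def)
        moreover have "k1 (j1 v, t) \<in> ?p (k1 (j1 v, t))"
          using w mem leaf_proj_in_partition(2)[OF part] by blast
        ultimately show "h (t, v) \<in> j1 v" by (simp add: h_def)
      qed
      show "j1 v \<subseteq> h ` (UNIV \<times> {v})"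
      proof
        fix x assume x: "x \<in> j1 v"
        have px: "?p x = j1 v" using leaf_proj_eq[OF part _ x] z Z(3) by blast
        have xW: "x \<in> W" using x z by (auto simp: W_def)
        then have "k1 (k x) = x" using k1 tW unfolding homeomorphic_maps_def by blast
        moreover have "fst (k x) = j1 v" using kp[of x] xW mem px by (auto simp: \<Z>_def)
        ultimately have "h (snd (k x), v) = x" by (cases "k x") (simp add: h_def)
        then show "x \<in> h ` (UNIV \<times> {v})" by (intro image_eqI[of _ _ "(snd (k x), v)"]) simp_all
      qed
    qed
    then show ?thesis using z Z(3) by auto
  qed
  then have "foliated_homeomorphic_trivial n X \<Delta> W V"
    unfolding foliated_homeomorphic_trivial_def using h by blast
  moreover have "saturated \<Delta> W" unfolding saturated_def W_def using Z(3) by blast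
  moreover have "\<omega> \<subseteq> W" unfolding W_def using Z(2) by blast
  ultimately show ?thesis using W_open V(1) by blast
qed

text \<open>The leaves in \<open>W\<close> are indexed by \<open>V\<close>, and this indexing
  \<open>L\<close> is a homeomorphism onto an open set of the leaf space: over an open
  \<open>C\<close> the union of the leaves is the image of \<open>UNIV \<times> C\<close>, an open
  set. The chart \<open>k\<close> is the inverse trivialization with its factors exchanged and
  \<open>V\<close> replaced by leaves.\<close>

lemma trivial_imp_local_product:
  assumes part: "partition_on (topspace X) \<Delta>" and \<omega>: "\<omega> \<in> \<Delta>"
    and W: "openin X W" "\<omega> \<subseteq> W" and V: "openin (half_space n) V"
    and triv: "foliated_homeomorphic_trivial n X \<Delta> W V"
  obtains \<W> k where "openin (leaf_space X \<Delta>) \<W>" "\<omega> \<in> \<W>"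
    "homeomorphic_map (subtopology X {x \<in> topspace X. leaf_proj \<Delta> x \<in> \<W>})
       (prod_topology (subtopology (leaf_space X \<Delta>) \<W>) euclideanreal) k"
    "\<And>x. x \<in> topspace X \<Longrightarrow> leaf_proj \<Delta> x \<in> \<W> \<Longrightarrow> fst (k x) = leaf_proj \<Delta> x"
    "subtopology (leaf_space X \<Delta>) \<W> homeomorphic_space subtopology (half_space n) V"
proof -
  let ?H = "subtopology (half_space n) V" and ?Y = "leaf_space X \<Delta>" and ?p = "leaf_proj \<Delta>"
  obtain h where h: "homeomorphic_map (prod_topology euclideanreal ?H) (subtopology X W) h"
    and leaf: "\<And>v. v \<in> V \<Longrightarrow> h ` (UNIV \<times> {v}) \<in> \<Delta>"
    using triv by (auto simp: foliated_homeomorphic_trivial_def)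
  have VH: "topspace ?H = V" using openin_subset[OF V] by auto
  have tH: "topspace (prod_topology euclideanreal ?H) = UNIV \<times> V" using VH by simp
  have tW: "topspace (subtopology X W) = W" using openin_subset[OF W(1)] by auto
  have tY: "topspace ?Y = \<Delta>" by (rule topspace_leaf_space[OF part])
  define L where "L v = h ` (UNIV \<times> {v})" for v
  have L: "L v \<in> \<Delta>" if "v \<in> V" for v using leaf[OF that] by (simp add: L_def)
  have proj: "?p (h (t, v)) = L v" if "v \<in> V" for t v
    by (rule leaf_proj_eq[OF part L[OF that]]) (auto simp: L_def)
  define \<W> where "\<W> = L ` V"
  have img: "\<Union>(L ` C) = h ` (UNIV \<times> C)" for C by (auto simp: L_def)
  have hW: "h ` (UNIV \<times> V) = W" using homeomorphic_imp_surjective_map[OF h] tH tW by simp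
  have W\<Delta>: "\<W> \<subseteq> \<Delta>" using L by (auto simp: \<W>_def)
  have \<W>_open: "openin ?Y \<W>"
    unfolding openin_leaf_space[OF part] using W\<Delta> W(1) img[of V] hW by (simp add: \<W>_def)
  have pre: "{x \<in> topspace X. ?p x \<in> \<W>} = W"
  proof
    show "{x \<in> topspace X. ?p x \<in> \<W>} \<subseteq> W"
    proof clarify
      fix x assume x: "x \<in> topspace X" "?p x \<in> \<W>"
      then have "x \<in> ?p x" using leaf_proj_in_partition(2)[OF part] by blast
      then have "x \<in> \<Union>(L ` V)" using x(2) by (auto simp: \<W>_def)
      then show "x \<in> W" using img[of V] hW by simp
    qed
    show "W \<subseteq> {x \<in> topspace X. ?p x \<in> \<W>}"
    proof
      fix x assume x: "x \<in> W"
      then obtain t v where "v \<in> V" "x = h (t, v)" using hW by auto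
      then show "x \<in> {x \<in> topspace X. ?p x \<in> \<W>}" using proj x openin_subset[OF W(1)] by (auto simp: \<W>_def)
    qed
  qed
  have "\<omega> \<in> \<W>"
  proof -
    have "\<omega> \<noteq> {}" using part \<omega> by (auto simp: partition_on_def)
    then obtain x where x: "x \<in> \<omega>" by auto
    then have "?p x \<in> \<W>" using W(2) pre by blast
    then show ?thesis using leaf_proj_eq[OF part \<omega> x] by simp
  qed
  have Lh: "homeomorphic_map ?H (subtopology ?Y \<W>) L"
  proof (rule bijective_open_imp_homeomorphic_map)
    have "continuous_map ?H (prod_topology euclideanreal ?H) (\<lambda>v. (0, v))"
      by (simp add: continuous_map_pairwise o_def continuous_map_id[unfolded id_def])
    then have "continuous_map ?H (subtopology X W) (h \<circ> (\<lambda>v. (0, v)))"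
      using homeomorphic_imp_continuous_map[OF h] by (rule continuous_map_compose)
    then have "continuous_map ?H X (h \<circ> (\<lambda>v. (0, v)))" by (rule continuous_map_into_fulltopology)
    then have "continuous_map ?H ?Y (?p \<circ> (h \<circ> (\<lambda>v. (0, v))))"
      using quotient_imp_continuous_map[OF quotient_map_leaf_proj[OF part]] by (rule continuous_map_compose)
    then have "continuous_map ?H ?Y L"
      by (rule continuous_map_eq) (use proj VH in auto)
    then show "continuous_map ?H (subtopology ?Y \<W>) L"
      using VH by (auto simp: continuous_map_in_subtopology \<W>_def)
    show "L ` topspace ?H = topspace (subtopology ?Y \<W>)"
      unfolding VH using W\<Delta> tY by (auto simp: \<W>_def)
    show "inj_on L (topspace ?H)"
      unfolding VH
    proof (rule inj_onI)
      fix v w assume vw: "v \<in> V" "w \<in> V" "L v = L w"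
      have "h (0, v) \<in> L w" unfolding vw(3)[symmetric] by (simp add: L_def)
      then obtain s where "h (0, v) = h (s, w)" by (auto simp: L_def)
      then have "(0, v) = (s, w)"
        using homeomorphic_imp_injective_map[OF h] vw unfolding tH by (auto dest: inj_onD)
      then show "v = w" by simp
    qed
    show "open_map ?H (subtopology ?Y \<W>) L"
      unfolding open_map_def
    proof (intro allI impI)
      fix C assume C: "openin ?H C"
      then have CV: "C \<subseteq> V" using openin_subset VH by blast
      have "openin (prod_topology euclideanreal ?H) (UNIV \<times> C)" using C by (simp add: openin_prod_Times_iff)
      then have "openin (subtopology X W) (h ` (UNIV \<times> C))"
        using homeomorphic_imp_open_map[OF h] by (simp add: open_map_def)
      then have "openin X (\<Union>(L ` C))" unfolding img using W(1) by (rule openin_trans_full)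
      moreover have "L ` C \<subseteq> \<W>" using CV by (auto simp: \<W>_def)
      ultimately have "openin ?Y (L ` C)" unfolding openin_leaf_space[OF part] using W\<Delta> by blast
      then show "openin (subtopology ?Y \<W>) (L ` C)"
        using \<open>L ` C \<subseteq> \<W>\<close> \<W>_open by (simp add: openin_open_subtopology)
    qed
  qed
  obtain g where g: "homeomorphic_maps (prod_topology euclideanreal ?H) (subtopology X W) h g"
    using h by (auto simp: homeomorphic_map_maps)
  have gh: "homeomorphic_map (subtopology X W) (prod_topology euclideanreal ?H) g"
    using g homeomorphic_maps_sym homeomorphic_maps_imp_map by blast
  define k where "k = (\<lambda>p. (L (snd p), fst p)) \<circ> g"
  have k: "homeomorphic_map (subtopology X W) (prod_topology (subtopology ?Y \<W>) euclideanreal) k"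
    unfolding k_def by (rule homeomorphic_map_compose[OF gh homeomorphic_map_prod_swap[OF Lh]])
  have kp: "fst (k x) = ?p x" if x: "x \<in> W" for x
  proof -
    obtain t v where tv: "v \<in> V" "x = h (t, v)" using hW x by auto
    have "g x = (t, v)" using g tv tH unfolding homeomorphic_maps_def by blast
    then show ?thesis using tv proj by (simp add: k_def)
  qed
  show thesis
  proof (rule that[OF \<W>_open \<open>\<omega> \<in> \<W>\<close>])
    show "homeomorphic_map (subtopology X {x \<in> topspace X. ?p x \<in> \<W>})
       (prod_topology (subtopology ?Y \<W>) euclideanreal) k"
      unfolding pre by (rule k)
    show "fst (k x) = ?p x" if "x \<in> topspace X" "?p x \<in> \<W>" for x
      using that pre by (intro kp) blast
    show "subtopology ?Y \<W> homeomorphic_space ?H"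
      using homeomorphic_map_imp_homeomorphic_space[OF Lh] by (subst homeomorphic_space_sym)
  qed
qed

theorem theorem2p8:
  fixes X :: "'a topology" and \<Delta> :: "'a set set" and n :: nat
  assumes "n \<ge> 1"
    and "manifold_with_boundary (Suc n) X"
    and "foliation n X \<Delta>"
    and "\<forall>\<omega> \<in> \<Delta>. \<not> compactin X \<omega>"
    and "locally_finite_in X (special_leaves X \<Delta>)"
  shows "((locally_trivial_fibration X (leaf_space X \<Delta>) (leaf_proj \<Delta>) euclideanreal \<and>
          locally_half_space n (leaf_space X \<Delta>))
         \<longleftrightarrow>
         (\<forall>\<omega> \<in> \<Delta>. \<exists>W V. openin X W \<and> saturated \<Delta> W \<and> \<omega> \<subseteq> W \<and> openin (half_space n) V \<and>
            foliated_homeomorphic_trivial n X \<Delta> W V))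
         \<and>
         ((\<forall>\<omega> \<in> \<Delta>. \<exists>W V. openin X W \<and> saturated \<Delta> W \<and> \<omega> \<subseteq> W \<and> openin (half_space n) V \<and>
            foliated_homeomorphic_trivial n X \<Delta> W V)
         \<longleftrightarrow>
         (\<forall>\<omega> \<in> \<Delta>. \<exists>V \<gamma>. cross_section n X \<Delta> V \<gamma> \<and> \<gamma> ` V \<inter> \<omega> \<noteq> {}))"
  (is "(?fibration \<longleftrightarrow> ?trivial) \<and> (?trivial \<longleftrightarrow> ?sections)")
proof -
  have part: "partition_on (topspace X) \<Delta>" using assms(3) by (simp add: foliation_def)
  obtain \<A> where "foliated_space n X \<Delta> \<A>" using foliation_imp_foliated_space[OF assms(3)] .
  then interpret foliated_space n X \<Delta> \<A> .
  have nc: "\<not> compactin X \<omega>" if "\<omega> \<in> \<Delta>" for \<omega> using assms(4) that by blast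
  have 12: ?trivial if ?fibration
    using fibration_imp_trivial[OF part] that by blast
  have 21: ?fibration if triv: ?trivial
  proof -
    have local: "\<exists>\<W> k V. openin (leaf_space X \<Delta>) \<W> \<and> \<omega> \<in> \<W> \<and>
        homeomorphic_map (subtopology X {x \<in> topspace X. leaf_proj \<Delta> x \<in> \<W>})
          (prod_topology (subtopology (leaf_space X \<Delta>) \<W>) euclideanreal) k \<and>
        (\<forall>x \<in> topspace X. leaf_proj \<Delta> x \<in> \<W> \<longrightarrow> fst (k x) = leaf_proj \<Delta> x) \<and>
        openin (half_space n) V \<and>
        subtopology (leaf_space X \<Delta>) \<W> homeomorphic_space subtopology (half_space n) V"
      if w: "\<omega> \<in> \<Delta>" for \<omega>
    proof -
      obtain W V where WV: "openin X W" "\<omega> \<subseteq> W" "openin (half_space n) V" "foliated_homeomorphic_trivial n X \<Delta> W V"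
        using triv w by blast
      show ?thesis
        by (rule trivial_imp_local_product[OF part w WV]) (use WV(3) in blast)
    qed
    have "locally_trivial_fibration X (leaf_space X \<Delta>) (leaf_proj \<Delta>) euclideanreal"
      unfolding locally_trivial_fibration_def topspace_leaf_space[OF part]
      using quotient_imp_continuous_map[OF quotient_map_leaf_proj[OF part]] local by blast
    moreover have "locally_half_space n (leaf_space X \<Delta>)"
      unfolding locally_half_space_def topspace_leaf_space[OF part] using local by blast
    ultimately show ?thesis by blast
  qed
  have 23: ?sections if triv: ?trivial
  proof
    fix \<omega> assume w: "\<omega> \<in> \<Delta>"
    obtain W V where WV: "openin X W" "\<omega> \<subseteq> W" "openin (half_space n) V" "foliated_homeomorphic_trivial n X \<Delta> W V"
      using triv w by blast
    show "\<exists>V \<gamma>. cross_section n X \<Delta> V \<gamma> \<and> \<gamma> ` V \<inter> \<omega> \<noteq> {}"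
      by (rule trivial_imp_cross_section[OF assms(1) part w WV])
  qed
  have 32: ?trivial if sections: ?sections
  proof
    fix \<omega> assume w: "\<omega> \<in> \<Delta>"
    obtain V \<gamma> where cs: "cross_section n X \<Delta> V \<gamma>" "\<gamma> ` V \<inter> \<omega> \<noteq> {}"
      using bspec[OF sections w] by (elim exE conjE)
    show "\<exists>W V. openin X W \<and> saturated \<Delta> W \<and> \<omega> \<subseteq> W \<and> openin (half_space n) V \<and>
        foliated_homeomorphic_trivial n X \<Delta> W V"
      by (rule cross_section_imp_trivial[OF assms(1,2) _ w cs]) (rule nc)
  qed
  show ?thesis by (rule conjI[OF iffI[OF 12 21] iffI[OF 23 32]])
qed

end
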